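(* For any connected Bochner-Kähler $n$-manifold $(M,\Omega)$, the functions $$C_k=B_k-h_1B_{k-1}+h_2B_{k-2}-\cdots+(-1)^{k-1}h_{k-1}B_1+(-1)^kh_kB_0$$ are locally constant for $2\le k\le n+2$.
   Context: $\mathbb C^n$ consists of columns; $z^*$ denotes conjugate transpose; $\mathfrak u(n)=\{a\in M_n(\mathbb C): a^*=-a\}$. Let $(M,g,\Omega)$ be a Kähler manifold of complex dimension $n\ge1$. Its unitary coframe bundle $\pi:P\to M$ has as fiber $P_x$ the set of complex-linear isometries $u:T_xM\to\mathbb C^n$, with right $U(n)$-action $u\cdot a=a^{-1}\circ u$. Let $\omega$ be the $\mathbb C^n$-valued $1$-form on $P$ with $\omega(v)=u(\pi'(v))$ for $v\in T_uP$ (so $\pi^*\Omega=-\frac i2\,\omega^*\wedge\omega$), and let $\phi$ be the unique $\mathfrak u(n)$-valued $1$-form on $P$ with $d\omega=-\phi\wedge\omega$. The structure is called Bochner-Kähler if there are functions $H:P\to i\mathfrak u(n)$ (Hermitian matrices), $T:P\to\mathbb C^n$, $V:P\to\mathbb R$ satisfying $$d\phi=-\phi\wedge\phi+H\,\omega^*\wedge\omega-H\,\omega\wedge\omega^*-\omega\wedge\omega^*H+(\omega^*\wedge H\omega)\,I_n+(\operatorname{tr}H)\bigl(\omega^*\wedge\omega\,I_n-\omega\wedge\omega^*\bigr),$$ $$dH=-\phi H+H\phi+T\omega^*+\omega T^*,\qquad dT=-\phi T+\bigl(H^2+(\operatorname{tr}H)H+V I_n\bigr)\omega,$$ $$dV=(\operatorname{tr}H)(T^*\omega+\omega^*T)+(T^*H\omega+\omega^*HT).$$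 For $n\ge2$ this is equivalent to the vanishing of the Bochner curvature; for $n=1$ it is the definition. The functions $H,T,V$ are unique and satisfy $(H,T,V)(u\cdot a)=(a^{-1}Ha,a^{-1}T,V)(u)$. Bochner-Kähler structures are assumed real-analytic. Define $B_0=1$, $B_1=\operatorname{tr}H$, $B_2=V$, $B_k=T^*H^{k-3}T$ for $k\ge3$. For $0\le k\le n$ let $h_k$ be the $k$-th elementary symmetric function of the eigenvalues of $H$ ($h_0=1$), and set $h_k=0$ for $k<0$ or $k>n$. All of these functions are constant on the fibers of $\pi$ and so are regarded as functions on $M$. *)

theory Defs
  imports "HOL-Analysis.Analysis" "HOL-Computational_Algebra.Polynomial"
begin

section \<open>Complex columns and matrices\<close>

definition ctranspose :: "complex^'n^'n \<Rightarrow> complex^'n^'n" where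
  "ctranspose A = (\<chi> i j. cnj (A $ j $ i))"

definition hermitian :: "complex^'n^'n \<Rightarrow> bool" where
  "hermitian A \<longleftrightarrow> ctranspose A = A"

definition skew_hermitian :: "complex^'n^'n \<Rightarrow> bool" where
  "skew_hermitian A \<longleftrightarrow> ctranspose A = - A"

text \<open>For columns \<open>v\<close>, \<open>w\<close>: the scalar \<open>v\<^sup>* w\<close> and the matrix \<open>v w\<^sup>*\<close>.\<close>

definition cdot :: "complex^'n \<Rightarrow> complex^'n \<Rightarrow> complex" where
  "cdot v w = (\<Sum>i\<in>UNIV. cnj (v $ i) * w $ i)"

definition outer :: "complex^'n \<Rightarrow> complex^'n \<Rightarrow> complex^'n^'n" where
  "outer v w = (\<chi> i j. v $ i * cnj (w $ j))"

definition charpoly :: "complex^'n^'n \<Rightarrow> complex poly" where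
  "charpoly A = det (\<chi> i j. (if i = j then [:0, 1:] else 0) - [:A $ i $ j:])"

definition eigenvalues :: "complex^'n^'n \<Rightarrow> complex multiset" where
  "eigenvalues A = proots (charpoly A)"

text \<open>The repeated elements of a multiset are told apart by a second component, so that the
  sum below runs over the \<open>k\<close>-element subfamilies of the multiset.\<close>

definition elem_sym :: "nat \<Rightarrow> complex multiset \<Rightarrow> complex" where
  "elem_sym k L = (\<Sum>S | S \<subseteq> {(x, i). i < count L x} \<and> card S = k. \<Prod>(x, i)\<in>S. x)"


section \<open>Real-analytic functions and holomorphic maps of several variables\<close>

definition real_analytic_on :: "('a::euclidean_space \<Rightarrow> 'b::real_normed_vector) \<Rightarrow> 'a set \<Rightarrow> bool"
  where
  "real_analytic_on f S \<longleftrightarrow>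
    (\<forall>a\<in>S. \<exists>r>0. \<exists>c :: ('a \<Rightarrow> nat) \<Rightarrow> 'b. \<forall>x\<in>ball a r.
      ((\<lambda>\<alpha>. (\<Prod>b\<in>Basis. ((x - a) \<bullet> b) ^ \<alpha> b) *\<^sub>R c \<alpha>) has_sum f x)
        {\<alpha>. \<forall>b. b \<notin> Basis \<longrightarrow> \<alpha> b = 0})"

definition holomorphic_map_on :: "(complex^'n \<Rightarrow> complex^'m) \<Rightarrow> (complex^'n) set \<Rightarrow> bool" where
  "holomorphic_map_on f S \<longleftrightarrow>
    (\<forall>z\<in>S. \<exists>D. (f has_derivative D) (at z) \<and> (\<forall>a v. D (a *s v) = a *s D v))"


section \<open>Tangent vectors and differential forms\<close>

text \<open>A family of charts \<open>(U, e)\<close> presents each \<open>U\<close> as a submanifold \<open>e ` U\<close> of a Euclidean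
  space: an open subset in the case of a complex manifold, a submanifold of positive codimension
  in the case of its unitary coframe bundle.

  A tangent vector at \<open>p\<close> is a class of curves through \<open>p\<close> with the same velocity in
  every chart at \<open>p\<close>. The class is represented by the family of these velocities, put to \<open>0\<close> at
  everything that is not a chart at \<open>p\<close>; the vector space operations are then pointwise.\<close>

type_synonym ('p, 'e) chart = "'p set \<times> ('p \<Rightarrow> 'e)"
type_synonym ('p, 'e) tvec = "('p, 'e) chart \<Rightarrow> 'e"

definition curve_at :: "('p, 'e::euclidean_space) chart set \<Rightarrow> 'p \<Rightarrow> (real \<Rightarrow> 'p) \<Rightarrow> bool" where
  "curve_at \<A> p \<gamma> \<longleftrightarrow> \<gamma> 0 = p \<and>
    (\<forall>(U, e)\<in>\<A>. p \<in> U \<longrightarrow>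
      (\<forall>\<^sub>F t in nhds 0. \<gamma> t \<in> U) \<and> (e \<circ> \<gamma>) differentiable (at 0))"

definition velocity :: "('p, 'e::euclidean_space) chart set \<Rightarrow> (real \<Rightarrow> 'p) \<Rightarrow> ('p, 'e) tvec" where
  "velocity \<A> \<gamma> =
    (\<lambda>c. if c \<in> \<A> \<and> \<gamma> 0 \<in> fst c then vector_derivative (snd c \<circ> \<gamma>) (at 0) else 0)"

definition tangent_space :: "('p, 'e::euclidean_space) chart set \<Rightarrow> 'p \<Rightarrow> ('p, 'e) tvec set" where
  "tangent_space \<A> p = velocity \<A> ` {\<gamma>. curve_at \<A> p \<gamma>}"

text \<open>The differential \<open>f'(p)\<close> of a map \<open>f\<close> between two such spaces.\<close>

definition tangent_map ::
  "('p, 'e::euclidean_space) chart set \<Rightarrow> ('q, 'f::euclidean_space) chart set \<Rightarrow> ('p \<Rightarrow> 'q) \<Rightarrow>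
    'p \<Rightarrow> ('p, 'e) tvec \<Rightarrow> ('q, 'f) tvec" where
  "tangent_map \<A> \<B> f p v =
    (THE w. \<exists>\<gamma>. curve_at \<A> p \<gamma> \<and> velocity \<A> \<gamma> = v \<and> velocity \<B> (f \<circ> \<gamma>) = w)"

text \<open>\<open>df = \<alpha>\<close>. The derivative within \<open>e ` U\<close> is unique only along the tangent space of \<open>e ` U\<close>.\<close>

definition has_differential ::
  "('p, 'e::euclidean_space) chart set \<Rightarrow> ('p \<Rightarrow> 'b::real_normed_vector) \<Rightarrow>
    ('p \<Rightarrow> ('p, 'e) tvec \<Rightarrow> 'b) \<Rightarrow> bool" where
  "has_differential \<A> f \<alpha> \<longleftrightarrow>
    (\<forall>(U, e)\<in>\<A>. \<forall>p\<in>U. \<exists>D.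
      ((f \<circ> inv_into U e) has_derivative D) (at (e p) within e ` U) \<and>
      (\<forall>v\<in>tangent_space \<A> p. \<alpha> p v = D (v (U, e))))"

definition one_form ::
  "('p, 'e::euclidean_space) chart set \<Rightarrow> ('p \<Rightarrow> ('p, 'e) tvec \<Rightarrow> 'b::real_vector) \<Rightarrow> bool" where
  "one_form \<A> \<alpha> \<longleftrightarrow>
    (\<forall>p\<in>\<Union>(fst ` \<A>). \<forall>v\<in>tangent_space \<A> p. \<forall>w\<in>tangent_space \<A> p. \<forall>a b :: real.
      \<alpha> p (\<lambda>c. a *\<^sub>R v c + b *\<^sub>R w c) = a *\<^sub>R \<alpha> p v + b *\<^sub>R \<alpha> p w)"

text \<open>\<open>d\<alpha> = \<beta>\<close> for a 1-form \<open>\<alpha>\<close>. In a chart, \<open>\<alpha>\<close> is the restriction to the submanifold \<open>e ` U\<close>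
  of a form \<open>A\<close> on the ambient space, and \<open>d\<alpha>\<close> is the restriction of \<open>dA\<close>, where
  \<open>dA(v, w) = (D\<^sub>v A)(w) - (D\<^sub>w A)(v)\<close>; the restriction does not depend on the choice of \<open>A\<close>.
  The same is done for 2-forms below.\<close>

definition has_ext_deriv1 ::
  "('p, 'e::euclidean_space) chart set \<Rightarrow> ('p \<Rightarrow> ('p, 'e) tvec \<Rightarrow> 'b::real_normed_vector) \<Rightarrow>
    ('p \<Rightarrow> ('p, 'e) tvec \<Rightarrow> ('p, 'e) tvec \<Rightarrow> 'b) \<Rightarrow> bool" where
  "has_ext_deriv1 \<A> \<alpha> \<beta> \<longleftrightarrow>
    (\<forall>(U, e)\<in>\<A>. \<forall>p\<in>U. \<exists>(A :: 'e \<Rightarrow> 'e \<Rightarrow>\<^sub>L 'b) D.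
      (\<forall>q\<in>U. \<forall>v\<in>tangent_space \<A> q. \<alpha> q v = blinfun_apply (A (e q)) (v (U, e))) \<and>
      (A has_derivative D) (at (e p) within e ` U) \<and>
      (\<forall>v\<in>tangent_space \<A> p. \<forall>w\<in>tangent_space \<A> p.
        \<beta> p v w = blinfun_apply (D (v (U, e))) (w (U, e)) - blinfun_apply (D (w (U, e))) (v (U, e))))"

definition has_ext_deriv2 ::
  "('p, 'e::euclidean_space) chart set \<Rightarrow>
    ('p \<Rightarrow> ('p, 'e) tvec \<Rightarrow> ('p, 'e) tvec \<Rightarrow> 'b::real_normed_vector) \<Rightarrow>
    ('p \<Rightarrow> ('p, 'e) tvec \<Rightarrow> ('p, 'e) tvec \<Rightarrow> ('p, 'e) tvec \<Rightarrow> 'b) \<Rightarrow> bool" where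
  "has_ext_deriv2 \<A> \<alpha> \<beta> \<longleftrightarrow>
    (\<forall>(U, e)\<in>\<A>. \<forall>p\<in>U. \<exists>(A :: 'e \<Rightarrow> 'e \<Rightarrow>\<^sub>L 'e \<Rightarrow>\<^sub>L 'b) D.
      (\<forall>q\<in>U. \<forall>v\<in>tangent_space \<A> q. \<forall>w\<in>tangent_space \<A> q.
        \<alpha> q v w = blinfun_apply (blinfun_apply (A (e q)) (v (U, e))) (w (U, e))) \<and>
      (A has_derivative D) (at (e p) within e ` U) \<and>
      (\<forall>u\<in>tangent_space \<A> p. \<forall>v\<in>tangent_space \<A> p. \<forall>w\<in>tangent_space \<A> p.
        \<beta> p u v w =
          blinfun_apply (blinfun_apply (D (u (U, e))) (v (U, e))) (w (U, e))
          - blinfun_apply (blinfun_apply (D (v (U, e))) (u (U, e))) (w (U, e))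
          + blinfun_apply (blinfun_apply (D (w (U, e))) (u (U, e))) (v (U, e))))"

text \<open>The wedge product of vector-valued 1-forms with respect to a bilinear product \<open>m\<close>.\<close>

definition wedge ::
  "('a \<Rightarrow> 'b \<Rightarrow> 'c::ab_group_add) \<Rightarrow> ('p \<Rightarrow> 't \<Rightarrow> 'a) \<Rightarrow> ('p \<Rightarrow> 't \<Rightarrow> 'b) \<Rightarrow> 'p \<Rightarrow> 't \<Rightarrow> 't \<Rightarrow> 'c" where
  "wedge m \<alpha> \<beta> p v w = m (\<alpha> p v) (\<beta> p w) - m (\<alpha> p w) (\<beta> p v)"


section \<open>Kaehler manifolds\<close>

definition complex_manifold :: "'m topology \<Rightarrow> ('m, complex^'n) chart set \<Rightarrow> bool" where
  "complex_manifold M \<A> \<longleftrightarrow>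
    Hausdorff_space M \<and> second_countable M \<and> \<Union>(fst ` \<A>) = topspace M \<and>
    (\<forall>(U, z)\<in>\<A>. openin M U \<and> open (z ` U) \<and>
      homeomorphic_map (subtopology M U) (top_of_set (z ` U)) z) \<and>
    (\<forall>(U, z)\<in>\<A>. \<forall>(W, w)\<in>\<A>. holomorphic_map_on (w \<circ> inv_into U z) (z ` (U \<inter> W)))"

text \<open>Multiplication of a tangent vector of a complex manifold by a complex scalar.\<close>

definition cscale :: "complex \<Rightarrow> ('m, complex^'n) tvec \<Rightarrow> ('m, complex^'n) tvec" where
  "cscale a v = (\<lambda>c. a *s v c)"

definition riemannian_metric ::
  "('m, complex^'n) chart set \<Rightarrow>
    ('m \<Rightarrow> ('m, complex^'n) tvec \<Rightarrow> ('m, complex^'n) tvec \<Rightarrow> real) \<Rightarrow> bool" where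
  "riemannian_metric \<A> g \<longleftrightarrow>
    (\<forall>x\<in>\<Union>(fst ` \<A>). \<forall>v\<in>tangent_space \<A> x. \<forall>w\<in>tangent_space \<A> x.
      g x v w = g x w v \<and>
      (v \<noteq> (\<lambda>_. 0) \<longrightarrow> g x v v > 0) \<and>
      (\<forall>u\<in>tangent_space \<A> x. \<forall>a b :: real.
        g x (\<lambda>c. a *\<^sub>R v c + b *\<^sub>R w c) u = a * g x v u + b * g x w u)) \<and>
    (\<forall>(U, z)\<in>\<A>. \<exists>G :: complex^'n \<Rightarrow> (complex^'n) \<Rightarrow>\<^sub>L (complex^'n) \<Rightarrow>\<^sub>L real.
      real_analytic_on G (z ` U) \<and>
      (\<forall>x\<in>U. \<forall>v\<in>tangent_space \<A> x. \<forall>w\<in>tangent_space \<A> x.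
        g x v w = blinfun_apply (blinfun_apply (G (z x)) (v (U, z))) (w (U, z))))"

definition kaehler_form ::
  "('m \<Rightarrow> ('m, complex^'n) tvec \<Rightarrow> ('m, complex^'n) tvec \<Rightarrow> real) \<Rightarrow>
    'm \<Rightarrow> ('m, complex^'n) tvec \<Rightarrow> ('m, complex^'n) tvec \<Rightarrow> real" where
  "kaehler_form g x v w = g x (cscale \<i> v) w"

text \<open>The sign of \<open>kaehler_form\<close> is the one for which its pull-back to the coframe bundle is
  \<open>-(\<i>/2) \<omega>\<^sup>* \<and> \<omega>\<close>. Metrics are real-analytic throughout.\<close>

definition kaehler_manifold ::
  "'m topology \<Rightarrow> ('m, complex^'n) chart set \<Rightarrow>
    ('m \<Rightarrow> ('m, complex^'n) tvec \<Rightarrow> ('m, complex^'n) tvec \<Rightarrow> real) \<Rightarrow> bool" where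
  "kaehler_manifold M \<A> g \<longleftrightarrow>
    complex_manifold M \<A> \<and> riemannian_metric \<A> g \<and>
    (\<forall>x\<in>topspace M. \<forall>v\<in>tangent_space \<A> x. \<forall>w\<in>tangent_space \<A> x.
      g x (cscale \<i> v) (cscale \<i> w) = g x v w) \<and>
    has_ext_deriv2 \<A> (kaehler_form g) (\<lambda>x u v w. 0)"


section \<open>The unitary coframe bundle\<close>

type_synonym ('m, 'n) coframe = "'m \<times> (('m, complex^'n) tvec \<Rightarrow> complex^'n)"

text \<open>A coframe at \<open>x\<close> is made extensional on \<open>T\<^sub>xM\<close>, so that it is determined by its values there.
  The inner product on \<open>complex^'n\<close> is the real part of \<open>cdot\<close>.\<close>

definition unitary_coframes ::
  "('m, complex^'n) chart set \<Rightarrow>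
    ('m \<Rightarrow> ('m, complex^'n) tvec \<Rightarrow> ('m, complex^'n) tvec \<Rightarrow> real) \<Rightarrow>
    'm \<Rightarrow> (('m, complex^'n) tvec \<Rightarrow> complex^'n) set" where
  "unitary_coframes \<A> g x =
    {u \<in> extensional (tangent_space \<A> x).
      bij_betw u (tangent_space \<A> x) UNIV \<and>
      (\<forall>v\<in>tangent_space \<A> x. \<forall>w\<in>tangent_space \<A> x.
        u (\<lambda>c. v c + w c) = u v + u w \<and>
        (\<forall>a. u (cscale a v) = a *s u v) \<and>
        g x v w = u v \<bullet> u w)}"

definition coframe_bundle ::
  "('m, complex^'n) chart set \<Rightarrow>
    ('m \<Rightarrow> ('m, complex^'n) tvec \<Rightarrow> ('m, complex^'n) tvec \<Rightarrow> real) \<Rightarrow> ('m, 'n) coframe set" where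
  "coframe_bundle \<A> g = (SIGMA x:\<Union>(fst ` \<A>). unitary_coframes \<A> g x)"

definition coframe_matrix ::
  "('m, complex^'n) chart set \<Rightarrow> ('m, complex^'n) chart \<Rightarrow> ('m, 'n) coframe \<Rightarrow> complex^'n^'n" where
  "coframe_matrix \<A> c p = (THE A. \<forall>v\<in>tangent_space \<A> (fst p). snd p v = A *v v c)"

text \<open>A chart \<open>(U, z)\<close> of the base embeds \<open>\<pi>\<^sup>-\<^sup>1(U)\<close> in \<open>\<complex>\<^sup>n \<times> M\<^sub>n(\<complex>)\<close>, with image the submanifold
  of all \<open>(y, A)\<close>, \<open>y\<close> in \<open>z ` U\<close>, such that \<open>A\<^sup>* A\<close> is the matrix of the Hermitian metric at
  \<open>y\<close>.\<close>

definition bundle_charts ::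
  "('m, complex^'n) chart set \<Rightarrow>
    ('m \<Rightarrow> ('m, complex^'n) tvec \<Rightarrow> ('m, complex^'n) tvec \<Rightarrow> real) \<Rightarrow>
    (('m, 'n) coframe, (complex^'n) \<times> (complex^'n^'n)) chart set" where
  "bundle_charts \<A> g =
    (\<lambda>(U, z). ({p \<in> coframe_bundle \<A> g. fst p \<in> U},
               \<lambda>p. (z (fst p), coframe_matrix \<A> (U, z) p))) ` \<A>"

type_synonym ('m, 'n) bundle_tvec =
  "(('m, 'n) coframe, (complex^'n) \<times> (complex^'n^'n)) tvec"

definition tautological_form ::
  "('m, complex^'n) chart set \<Rightarrow>
    ('m \<Rightarrow> ('m, complex^'n) tvec \<Rightarrow> ('m, complex^'n) tvec \<Rightarrow> real) \<Rightarrow>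
    ('m, 'n) coframe \<Rightarrow> ('m, 'n) bundle_tvec \<Rightarrow> complex^'n" where
  "tautological_form \<A> g p v = snd p (tangent_map (bundle_charts \<A> g) \<A> fst p v)"

definition connection_form ::
  "('m, complex^'n) chart set \<Rightarrow>
    ('m \<Rightarrow> ('m, complex^'n) tvec \<Rightarrow> ('m, complex^'n) tvec \<Rightarrow> real) \<Rightarrow>
    (('m, 'n) coframe \<Rightarrow> ('m, 'n) bundle_tvec \<Rightarrow> complex^'n^'n) \<Rightarrow> bool" where
  "connection_form \<A> g \<phi> \<longleftrightarrow>
    (let \<B> = bundle_charts \<A> g; \<omega> = tautological_form \<A> g in
      one_form \<B> \<phi> \<and>
      (\<forall>p\<in>coframe_bundle \<A> g. \<forall>v\<in>tangent_space \<B> p. skew_hermitian (\<phi> p v)) \<and>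
      has_ext_deriv1 \<B> \<omega> (\<lambda>p v w. - wedge (*v) \<phi> \<omega> p v w))"


section \<open>Bochner-Kaehler structures\<close>

text \<open>In a product with a matrix, \<open>mat s\<close> stands for the scalar \<open>s\<close>.\<close>

definition bochner_kaehler ::
  "('m, complex^'n) chart set \<Rightarrow>
    ('m \<Rightarrow> ('m, complex^'n) tvec \<Rightarrow> ('m, complex^'n) tvec \<Rightarrow> real) \<Rightarrow>
    (('m, 'n) coframe \<Rightarrow> ('m, 'n) bundle_tvec \<Rightarrow> complex^'n^'n) \<Rightarrow>
    (('m, 'n) coframe \<Rightarrow> complex^'n^'n) \<Rightarrow>
    (('m, 'n) coframe \<Rightarrow> complex^'n) \<Rightarrow>
    (('m, 'n) coframe \<Rightarrow> real) \<Rightarrow> bool" where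
  "bochner_kaehler \<A> g \<phi> H T V \<longleftrightarrow>
    (let \<B> = bundle_charts \<A> g; \<omega> = tautological_form \<A> g in
      (\<forall>p\<in>coframe_bundle \<A> g. hermitian (H p)) \<and>
      has_ext_deriv1 \<B> \<phi> (\<lambda>p v w.
        - wedge (**) \<phi> \<phi> p v w
        + mat (wedge cdot \<omega> \<omega> p v w) ** H p
        - H p ** wedge outer \<omega> \<omega> p v w
        - wedge outer \<omega> \<omega> p v w ** H p
        + mat (wedge cdot \<omega> (\<lambda>p v. H p *v \<omega> p v) p v w)
        + mat (trace (H p)) ** (mat (wedge cdot \<omega> \<omega> p v w) - wedge outer \<omega> \<omega> p v w)) \<and>
      has_differential \<B> H (\<lambda>p v.
        - (\<phi> p v ** H p) + H p ** \<phi> p v + outer (T p) (\<omega> p v) + outer (\<omega> p v) (T p)) \<and>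
      has_differential \<B> T (\<lambda>p v.
        - (\<phi> p v *v T p)
        + (H p ** H p + mat (trace (H p)) ** H p + mat (of_real (V p))) *v \<omega> p v) \<and>
      has_differential \<B> (\<lambda>p. complex_of_real (V p)) (\<lambda>p v.
        trace (H p) * (cdot (T p) (\<omega> p v) + cdot (\<omega> p v) (T p))
        + (cdot (T p) (H p *v \<omega> p v) + cdot (\<omega> p v) (H p *v T p))))"

definition bochner_B :: "complex^'n^'n \<Rightarrow> complex^'n \<Rightarrow> real \<Rightarrow> nat \<Rightarrow> complex" where
  "bochner_B H T V k =
    (if k = 0 then 1
     else if k = 1 then trace H
     else if k = 2 then of_real V
     else cdot T ((((*v) H) ^^ (k - 3)) T))"

definition bochner_h :: "complex^'n^'n \<Rightarrow> nat \<Rightarrow> complex" where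
  "bochner_h H k = elem_sym k (eigenvalues H)"

definition bochner_C :: "complex^'n^'n \<Rightarrow> complex^'n \<Rightarrow> real \<Rightarrow> nat \<Rightarrow> complex" where
  "bochner_C H T V k = (\<Sum>j\<le>k. (-1) ^ j * bochner_h H j * bochner_B H T V (k - j))"

definition locally_constant :: "'m topology \<Rightarrow> ('m \<Rightarrow> 'b) \<Rightarrow> bool" where
  "locally_constant M f \<longleftrightarrow>
    (\<forall>x\<in>topspace M. \<exists>U. openin M U \<and> x \<in> U \<and> f constant_on U)"

end

theory Submission
  imports Defs "HOL-Complex_Analysis.Cauchy_Integral_Formula"
    "HOL-Computational_Algebra.Fundamental_Theorem_Algebra"
begin

text \<open>Let \<open>R = (1 - s H)\<^sup>-\<^sup>1\<close>. The function \<open>det (1 - s H) (1 + s tr H + s\<^sup>2 V + s\<^sup>3 T\<^sup>* R T)\<close>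
  is the generating function of the \<open>C\<^sub>k\<close>, and the structure equations, together with Jacobi's formula
  for the derivative of a determinant, show that its derivative along every curve in the coframe bundle vanishes.
  For imaginary \<open>s\<close> the matrix \<open>1 - s H\<close> is invertible because \<open>H\<close> is Hermitian, and the values on the
  imaginary axis near \<open>0\<close> determine all the coefficients \<open>C\<^sub>k\<close>. It remains to have enough curves in the
  bundle. In a chart of the base the fibre consists of the matrices \<open>A\<close> such that \<open>A\<^sup>* A\<close> is the Gram matrix of
  the metric. Two points of a fibre are joined by an explicit path of unitary matrices. A line in
  the base is lifted, to first order at a given point, by a square root of the Gram matrix near the identity.\<close>

section \<open>Complex matrices\<close>

text \<open>Differentiating the C_k one by one would require recursions for the derivatives of the
  h_k; the generating function replaces them by the single term trace (R H'), and the cancellation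
  happens among a handful of scalars. For real s the range in which 1 - s H is invertible shrinks
  with the size of H, whereas an imaginary s works at every point of the bundle at once, so that one
  function on the whole bundle can be differentiated. The obstacle is geometric. Tangent vectors of
  the bundle are velocities of curves that are differentiable in every bundle chart, and a change of
  bundle charts involves the Jacobian of the base transition. A curve is therefore admissible only
  once the first derivatives of transition maps, and for lifts also the Gram matrix, are known to be
  differentiable. Constancy on the fibres comes before constancy along the base: it makes the
  generating function a function on M, so that lifts chosen near different parameter values need not
  fit together.\<close>

lemma mat_mult_nth: "(A ** B) $ i $ j = (\<Sum>k\<in>UNIV. A $ i $ k * B $ k $ j)"
  by (simp add: matrix_matrix_mult_def)

lemma mat_nth: "mat c $ i $ j = (if i = j then c else 0)"
  by (simp add: mat_def)

lemma ctranspose_nth: "ctranspose A $ i $ j = cnj (A $ j $ i)"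
  by (simp add: ctranspose_def)

lemma matrix_mult_simps:
  fixes A B C :: "'a::comm_ring_1^'n^'n"
  shows "(A + B) ** C = A ** C + B ** C" "(A - B) ** C = A ** C - B ** C" "(- A) ** C = - (A ** C)"
    "C ** (A + B) = C ** A + C ** B" "C ** (A - B) = C ** A - C ** B" "C ** (- A) = - (C ** A)"
  by (simp_all add: vec_eq_iff mat_mult_nth sum.distrib sum_subtractf algebra_simps sum_negf)

lemma matrix_vector_uminus:
  fixes A :: "'a::comm_ring_1^'n^'n"
  shows "(- A) *v x = - (A *v x)" "A *v (- x) = - (A *v x)"
  by (simp_all add: vec_eq_iff matrix_vector_mult_def sum_negf)

lemma mat_scalar:
  fixes A B :: "'a::comm_ring_1^'n^'n"
  shows "(mat c ** A) $ i $ j = c * A $ i $ j" "(A ** mat c) = mat c ** A"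
    "A ** (mat c ** B) = mat c ** (A ** B)" "mat c *v x = c *s x"
    "(mat c ** A) *v x = c *s (A *v x)" "A *v (c *s x) = c *s (A *v x)"
proof -
  show 1: "(mat c ** A) $ i $ j = c * A $ i $ j" for A i j
    by (simp add: mat_mult_nth mat_nth if_distrib if_distribR sum.delta' cong: if_cong)
  show 2: "A ** mat c = mat c ** A" for A
    by (simp add: vec_eq_iff 1) (simp add: mat_mult_nth mat_nth if_distrib if_distribR cong: if_cong)
  show "A ** (mat c ** B) = mat c ** (A ** B)"
    by (metis 2 matrix_mul_assoc)
  show 3: "mat c *v x = c *s x" for x
    by (simp add: vec_eq_iff matrix_vector_mult_def mat_nth if_distrib if_distribR cong: if_cong)
  show "(mat c ** A) *v x = c *s (A *v x)"
    by (metis 3 matrix_vector_mul_assoc)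
  show "A *v (c *s x) = c *s (A *v x)"
    by (metis 2 3 matrix_vector_mul_assoc)
qed

lemma trace_simps:
  fixes A B :: "'a::comm_ring_1^'n^'n"
  shows "trace (- A) = - trace A" "trace (mat c ** A) = c * trace A"
  by (simp_all add: trace_def mat_scalar sum_negf sum_distrib_left)

lemma ctranspose_simps:
  "ctranspose (A ** B) = ctranspose B ** ctranspose A"
  "ctranspose (A + B) = ctranspose A + ctranspose B"
  "ctranspose (A - B) = ctranspose A - ctranspose B"
  "ctranspose (- A) = - ctranspose A"
  "ctranspose (mat c) = mat (cnj c)"
  "ctranspose (ctranspose A) = A"
  "ctranspose (r *\<^sub>R A) = r *\<^sub>R ctranspose A"
  by (simp_all add: vec_eq_iff mat_mult_nth ctranspose_nth mat_nth mult.commute)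

lemma cdot_simps:
  "cdot (v + v') w = cdot v w + cdot v' w" "cdot v (w + w') = cdot v w + cdot v w'"
  "cdot (v - v') w = cdot v w - cdot v' w" "cdot v (w - w') = cdot v w - cdot v w'"
  "cdot (- v) w = - cdot v w" "cdot v (- w) = - cdot v w"
  "cdot (a *s v) w = cnj a * cdot v w" "cdot v (a *s w) = a * cdot v w"
  by (simp_all add: cdot_def algebra_simps sum.distrib sum_subtractf sum_negf sum_distrib_left)

lemma cdot_matrix: "cdot v (A *v w) = cdot (ctranspose A *v v) w"
proof -
  have "cdot v (A *v w) = (\<Sum>i\<in>UNIV. \<Sum>j\<in>UNIV. cnj (v $ i) * (A $ i $ j * w $ j))"
    by (simp add: cdot_def matrix_vector_mult_def sum_distrib_left)
  also have "\<dots> = (\<Sum>j\<in>UNIV. \<Sum>i\<in>UNIV. cnj (v $ i) * (A $ i $ j * w $ j))"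
    by (rule sum.swap)
  also have "\<dots> = cdot (ctranspose A *v v) w"
    by (simp add: cdot_def matrix_vector_mult_def ctranspose_nth sum_distrib_left sum_distrib_right mult_ac)
  finally show ?thesis .
qed

lemma inner_eq_Re_cdot: "v \<bullet> w = Re (cdot v w)" for v w :: "complex^'n"
  by (simp add: inner_vec_def cdot_def inner_complex_def)

lemma cdot_self: "cdot v v = of_real ((norm v)\<^sup>2)"
proof -
  have "Im (cdot v v) = 0"
    by (simp add: cdot_def)
  then show ?thesis
    by (simp add: complex_eq_iff power2_norm_eq_inner inner_eq_Re_cdot)
qed

lemma outer_vector: "outer v w *v x = cdot w x *s v"
  by (simp add: vec_eq_iff outer_def cdot_def matrix_vector_mult_def sum_distrib_left sum_distrib_right mult_ac)

lemma trace_outer: "trace (A ** outer v w) = cdot w (A *v v)"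
  by (simp add: trace_def mat_mult_nth outer_def cdot_def matrix_vector_mult_def
      sum_distrib_left sum_distrib_right mult_ac)

lemma trace_hermitian_real: "hermitian H \<Longrightarrow> cnj (trace H) = trace H"
  by (auto simp: hermitian_def trace_def ctranspose_def vec_eq_iff)

lemma norm_vector_scalar: "norm (c *s x) = norm c * norm x" for x :: "complex^'n"
  by (simp add: norm_vec_def norm_mult L2_set_right_distrib)

lemma bounded_bilinear_matrix_mult:
  "bounded_bilinear ((**) :: complex^'n^'n \<Rightarrow> complex^'n^'n \<Rightarrow> complex^'n^'n)"
  by (simp add: bilinear_conv_bounded_bilinear[symmetric] bilinear_def)
    (auto intro!: linearI simp: vec_eq_iff mat_mult_nth algebra_simps sum.distrib scaleR_sum_right)

lemma bounded_bilinear_matrix_vector: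
  "bounded_bilinear ((*v) :: complex^'n^'n \<Rightarrow> complex^'n \<Rightarrow> complex^'n)"
  by (simp add: bilinear_conv_bounded_bilinear[symmetric] bilinear_def)
    (auto intro!: linearI simp: vec_eq_iff matrix_vector_mult_def algebra_simps sum.distrib scaleR_sum_right)

lemma bounded_bilinear_cdot: "bounded_bilinear (cdot :: complex^'n \<Rightarrow> complex^'n \<Rightarrow> complex)"
  by (simp add: bilinear_conv_bounded_bilinear[symmetric] bilinear_def)
    (auto intro!: linearI simp: cdot_def algebra_simps sum.distrib scaleR_sum_right)

lemma bounded_linear_trace: "bounded_linear (trace :: complex^'n^'n \<Rightarrow> complex)"
  by (simp add: linear_conv_bounded_linear[symmetric])
    (auto intro!: linearI simp: trace_def sum.distrib scaleR_sum_right)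

lemma bounded_linear_ctranspose:
  "bounded_linear (ctranspose :: complex^'n^'n \<Rightarrow> complex^'n^'n)"
  by (simp add: linear_conv_bounded_linear[symmetric])
    (auto intro!: linearI simp: ctranspose_simps)

lemmas has_vector_derivative_matrix_mult =
  bounded_bilinear.has_vector_derivative[OF bounded_bilinear_matrix_mult]
lemmas has_vector_derivative_matrix_vector =
  bounded_bilinear.has_vector_derivative[OF bounded_bilinear_matrix_vector]
lemmas has_vector_derivative_cdot =
  bounded_bilinear.has_vector_derivative[OF bounded_bilinear_cdot]

lemma matrix_inv_unique:
  fixes A B :: "'a::field^'n^'n"
  assumes "A ** B = mat 1"
  shows "matrix_inv A = B"
proof -
  have "invertible A"
    using assms invertible_right_inverse by blast
  then have "matrix_inv A ** A = mat 1"
    unfolding invertible_def matrix_inv_def by (rule someI2_ex) simp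
  then show ?thesis
    by (metis assms matrix_mul_assoc matrix_mul_lid matrix_mul_rid)
qed

lemma matrix_inv_mult:
  fixes A :: "complex^'n^'n"
  assumes "det A \<noteq> 0"
  shows "matrix_inv A ** A = mat 1" "A ** matrix_inv A = mat 1"
proof -
  have "\<exists>B. A ** B = mat 1 \<and> B ** A = mat 1"
    using assms unfolding invertible_det_nz[symmetric] invertible_def .
  then show "matrix_inv A ** A = mat 1" "A ** matrix_inv A = mat 1"
    unfolding matrix_inv_def by (rule someI2_ex, blast)+
qed

section \<open>Differentiability of determinants and inverses of matrix functions\<close>

lemma has_vector_derivative_vec_nth:
  "(f has_vector_derivative f') F \<Longrightarrow> ((\<lambda>t. f t $ i) has_vector_derivative f' $ i) F"
  by (rule bounded_linear.has_vector_derivative[OF bounded_linear_vec_nth])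

lemma differentiable_vec_nth: "f differentiable F \<Longrightarrow> (\<lambda>t. f t $ i) differentiable F"
  unfolding differentiable_def
  by (blast intro: bounded_linear.has_derivative[OF bounded_linear_vec_nth])

lemma differentiable_vecI:
  fixes f :: "'a::real_normed_vector \<Rightarrow> 'b::real_normed_vector^'n"
  assumes "\<And>i. (\<lambda>t. f t $ i) differentiable (at x)"
  shows "f differentiable (at x)"
proof -
  have bl: "bounded_linear (axis i :: 'b \<Rightarrow> 'b^'n)" for i
    by (rule bounded_linear_intro[where K=1])
      (auto simp: vec_eq_iff axis_def norm_vec_def L2_set_def if_distrib if_distribR cong: if_cong)
  have "(\<lambda>t. axis i (f t $ i)) differentiable (at x)" for i
    using assms[of i] bounded_linear.has_derivative[OF bl] unfolding differentiable_def by blast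
  then have "(\<lambda>t. \<Sum>i\<in>UNIV. axis i (f t $ i)) differentiable (at x)"
    by (intro differentiable_sum) auto
  moreover have "(\<Sum>i\<in>UNIV. axis i (f t $ i)) = f t" for t
    by (simp add: vec_eq_iff axis_def if_distrib if_distribR cong: if_cong)
  ultimately show ?thesis
    by simp
qed

lemma differentiable_prod:
  fixes f :: "'i \<Rightarrow> 'a::real_normed_vector \<Rightarrow> complex"
  assumes "\<And>i. i \<in> I \<Longrightarrow> f i differentiable (at x)"
  shows "(\<lambda>t. \<Prod>i\<in>I. f i t) differentiable (at x)"
  using assms by (induction I rule: infinite_finite_induct) auto

lemma differentiable_det:
  fixes A :: "'a::real_normed_vector \<Rightarrow> complex^'n^'n"
  assumes "A differentiable (at x)"
  shows "(\<lambda>t. det (A t)) differentiable (at x)"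
  unfolding det_def
  by (intro differentiable_sum finite_permutations finite differentiable_mult differentiable_const ballI
      differentiable_prod differentiable_vec_nth assms)

lemma eventually_det_nonzero:
  fixes A :: "'a::real_normed_vector \<Rightarrow> complex^'n^'n"
  assumes "A differentiable (at x)" "det (A x) \<noteq> 0"
  shows "\<forall>\<^sub>F t in nhds x. det (A t) \<noteq> 0"
proof -
  have "isCont (\<lambda>t. det (A t)) x"
    using differentiable_det[OF assms(1)] by (rule differentiable_imp_continuous_within)
  then have "\<forall>\<^sub>F t in at x. det (A t) \<noteq> 0"
    by (metis assms(2) isCont_def tendsto_imp_eventually_ne)
  then show ?thesis
    using assms(2) by (simp add: eventually_nhds_conv_at)
qed

lemma differentiable_transform_nhds:
  assumes "f differentiable (at x)" "\<forall>\<^sub>F t in nhds x. f t = g t"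
  shows "g differentiable (at x)"
proof -
  obtain D where D: "(f has_derivative D) (at x)"
    using assms(1) by (auto simp: differentiable_def)
  have "(g has_derivative D) (at x)"
    by (rule has_derivative_transform_eventually[OF D])
      (use assms(2) eventually_nhds_x_imp_x[OF assms(2)] in \<open>auto simp: eventually_nhds_conv_at\<close>)
  then show ?thesis
    by (auto simp: differentiable_def)
qed

text \<open>Column l of the inverse solves \<open>A *v y = axis l 1\<close>, so Cramer's rule gives
  its entries. As quotients of determinants they are visibly differentiable in the entries of
  \<open>A\<close>.\<close>

lemma matrix_inv_cramer:
  fixes A :: "complex^'n^'n"
  assumes "det A \<noteq> 0"
  shows "matrix_inv A = (\<chi> k l. det (\<chi> i j. if j = k then axis l 1 $ i else A $ i $ j) / det A)"
    (is "_ = ?B")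
proof (rule matrix_inv_unique)
  show "A ** ?B = mat 1"
  proof -
    have "column l (A ** ?B) = column l (mat 1)" for l
    proof -
      have "A *v (\<chi> k. ?B $ k $ l) = axis l 1"
        using cramer[OF assms, of "\<chi> k. ?B $ k $ l" "axis l 1"] by simp
      then show ?thesis
        by (simp add: vec_eq_iff column_def mat_mult_nth matrix_vector_mult_def mat_nth axis_def)
    qed
    then show ?thesis
      by (simp add: vec_eq_iff column_def)
  qed
qed

text \<open>Cramer's formula represents \<open>matrix_inv\<close> only where the determinant is
  nonzero. By continuity this is a neighbourhood of x, hence the transfer along an eventual
  equality.\<close>

lemma differentiable_matrix_inv:
  fixes A :: "'a::real_normed_vector \<Rightarrow> complex^'n^'n"
  assumes A: "A differentiable (at x)" and det: "det (A x) \<noteq> 0"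
  shows "(\<lambda>t. matrix_inv (A t)) differentiable (at x)"
proof (rule differentiable_transform_nhds)
  show "(\<lambda>t. \<chi> k l. det (\<chi> i j. if j = k then axis l 1 $ i else A t $ i $ j) / det (A t))
      differentiable (at x)"
  proof (rule differentiable_vecI, rule differentiable_vecI, simp,
      rule differentiable_divide[OF _ differentiable_det[OF A] det], rule differentiable_det)
    fix k l
    show "(\<lambda>t. \<chi> i j. if j = k then axis l 1 $ i else A t $ i $ j) differentiable (at x)"
      by (rule differentiable_vecI, rule differentiable_vecI)
        (case_tac "ia = k", simp_all add: differentiable_vec_nth A)
  qed
  show "\<forall>\<^sub>F t in nhds x. (\<chi> k l. det (\<chi> i j. if j = k then axis l 1 $ i else A t $ i $ j) / det (A t)) =
      matrix_inv (A t)"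
    using eventually_det_nonzero[OF assms] by eventually_elim (simp add: matrix_inv_cramer)
qed

section \<open>The generating function of the first integrals\<close>

text \<open>A permutation other than the identity moves at least two indices. After one factor of
  its Leibniz product has been differentiated, an off-diagonal entry of the identity matrix remains,
  so only the identity permutation contributes.\<close>

lemma has_vector_derivative_det_at_id:
  fixes A :: "real \<Rightarrow> complex^'n^'n"
  assumes A: "(A has_vector_derivative A') (at t)" and id: "A t = mat 1"
  shows "((\<lambda>t. det (A t)) has_vector_derivative trace A') (at t)"
proof -
  let ?U = "UNIV :: 'n set"
  have nth: "((\<lambda>t. A t $ i $ j) has_derivative (\<lambda>h. h *\<^sub>R A' $ i $ j)) (at t)" for i j
    using has_vector_derivative_vec_nth[OF has_vector_derivative_vec_nth[OF A]]
    by (simp add: has_vector_derivative_def)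
  have "((\<lambda>t. det (A t)) has_derivative
      (\<lambda>h. \<Sum>p\<in>{p. p permutes ?U}. of_int (sign p) *
        (\<Sum>i\<in>?U. (h *\<^sub>R A' $ i $ p i) * (\<Prod>j\<in>?U - {i}. A t $ j $ p j)))) (at t)"
    unfolding det_def
    by (intro has_derivative_sum has_derivative_mult_right has_derivative_prod nth)
  also have "(\<lambda>h. \<Sum>p\<in>{p. p permutes ?U}. of_int (sign p) *
        (\<Sum>i\<in>?U. (h *\<^sub>R A' $ i $ p i) * (\<Prod>j\<in>?U - {i}. A t $ j $ p j))) = (\<lambda>h. h *\<^sub>R trace A')"
  proof
    fix h
    have zero: "(\<Prod>j\<in>?U - {i}. A t $ j $ p j) = 0" if perm: "p permutes ?U" and nid: "p \<noteq> id" for p i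
    proof -
      obtain a where a: "p a \<noteq> a"
        using nid by (auto simp: fun_eq_iff)
      moreover have "p (p a) \<noteq> p a"
        using a permutes_inj[OF perm] by (auto simp: inj_eq)
      ultimately obtain j where "j \<noteq> i" "p j \<noteq> j"
        by (metis)
      then show ?thesis
        by (intro prod_zero) (auto simp: id mat_nth intro!: bexI[of _ j])
    qed
    have "(\<Sum>p\<in>{p. p permutes ?U}. of_int (sign p) *
        (\<Sum>i\<in>?U. (h *\<^sub>R A' $ i $ p i) * (\<Prod>j\<in>?U - {i}. A t $ j $ p j)))
      = (\<Sum>p\<in>{id}. of_int (sign p) *
        (\<Sum>i\<in>?U. (h *\<^sub>R A' $ i $ p i) * (\<Prod>j\<in>?U - {i}. A t $ j $ p j)))"
      by (rule sum.mono_neutral_right) (auto simp: permutes_id zero finite_permutations)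
    also have "\<dots> = h *\<^sub>R trace A'"
      by (simp add: sign_id id mat_nth trace_def scaleR_sum_right)
    finally show "(\<Sum>p\<in>{p. p permutes ?U}. of_int (sign p) *
        (\<Sum>i\<in>?U. (h *\<^sub>R A' $ i $ p i) * (\<Prod>j\<in>?U - {i}. A t $ j $ p j))) = h *\<^sub>R trace A'" .
  qed
  finally show ?thesis
    by (simp add: has_vector_derivative_def)
qed

lemma has_vector_derivative_const_mult_matrix:
  fixes A :: "real \<Rightarrow> complex^'n^'n" and B :: "complex^'n^'n"
  assumes "(A has_vector_derivative A') F"
  shows "((\<lambda>t. B ** A t) has_vector_derivative B ** A') F"
  by (rule bounded_linear.has_vector_derivative[OF
        bounded_bilinear.bounded_linear_right[OF bounded_bilinear_matrix_mult] assms])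

text \<open>Jacobi's formula is transported from the identity matrix: det A(s) = det A(t) det (R
  A(s)), and R A(s) passes through the identity at s = t.\<close>

lemma has_vector_derivative_det:
  fixes A :: "real \<Rightarrow> complex^'n^'n"
  assumes A: "(A has_vector_derivative A') (at t)" and R: "R ** A t = mat 1"
  shows "((\<lambda>t. det (A t)) has_vector_derivative det (A t) * trace (R ** A')) (at t)"
proof -
  have "A t ** R = mat 1"
    using R by (simp add: matrix_left_right_inverse)
  then have "det (A t) * det (R ** A s) = det (A s)" for s
    by (metis det_mul matrix_mul_assoc matrix_mul_lid)
  moreover have "((\<lambda>s. det (A t) * det (R ** A s)) has_vector_derivative det (A t) * trace (R ** A')) (at t)"
    by (intro has_vector_derivative_mult_right has_vector_derivative_det_at_id
        has_vector_derivative_const_mult_matrix A) (simp add: R)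
  ultimately show ?thesis
    by simp
qed

text \<open>The product rule for R A = 1 determines the derivative once it is known to exist;
  existence comes from Cramer's rule through \<open>differentiable_matrix_inv\<close>.\<close>

lemma has_vector_derivative_matrix_inv:
  fixes A :: "real \<Rightarrow> complex^'n^'n"
  assumes A: "(A has_vector_derivative A') (at t)" and det: "det (A t) \<noteq> 0"
  shows "((\<lambda>t. matrix_inv (A t)) has_vector_derivative
    - (matrix_inv (A t) ** A' ** matrix_inv (A t))) (at t)"
proof -
  let ?R = "\<lambda>t. matrix_inv (A t)"
  have diff: "A differentiable (at t)"
    using A by (rule differentiableI_vector)
  obtain R' where R': "(?R has_vector_derivative R') (at t)"
    using differentiable_matrix_inv[OF diff det] vector_derivative_works by blast
  have inv: "?R s ** A s = mat 1" if "det (A s) \<noteq> 0" for s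
    by (rule matrix_inv_mult(1)[OF that])
  have "((\<lambda>s. ?R s ** A s) has_vector_derivative ?R t ** A' + R' ** A t) (at t)"
    by (rule has_vector_derivative_matrix_mult[OF R' A])
  moreover have "((\<lambda>s. ?R s ** A s) has_vector_derivative 0) (at t)"
  proof -
    obtain S where "open S" "t \<in> S" "\<forall>s\<in>S. det (A s) \<noteq> 0"
      using eventually_det_nonzero[OF diff det] by (auto simp: eventually_nhds)
    moreover have "((\<lambda>_. mat 1 :: complex^'n^'n) has_vector_derivative 0) (at t)"
      by (rule has_vector_derivative_const)
    ultimately show ?thesis
      using inv by (metis (mono_tags, lifting) has_vector_derivative_transform_within_open)
  qed
  ultimately have "?R t ** A' + R' ** A t = 0"
    by (rule vector_derivative_unique_at)
  then have "R' ** A t = - (?R t ** A')"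
    by (metis add.commute eq_neg_iff_add_eq_0)
  then have "R' ** A t ** ?R t = - (?R t ** A' ** ?R t)"
    by (simp only: matrix_mult_simps)
  moreover have "A t ** ?R t = mat 1"
    using inv[OF det] matrix_left_right_inverse by blast
  ultimately have "R' = - (?R t ** A' ** ?R t)"
    by (simp only: matrix_mul_assoc[symmetric] matrix_mul_rid)
  then show ?thesis
    using R' by simp
qed

text \<open>With \<open>R = (1 - s H)\<^sup>-\<^sup>1\<close> one has \<open>\<Sum>k. B\<^sub>k s\<^sup>k = 1 + s tr H + s\<^sup>2 V + s\<^sup>3 T\<^sup>* R T\<close> and
  \<open>\<Sum>k. (-1)\<^sup>k h\<^sub>k s\<^sup>k = det (1 - s H)\<close>, so the function below generates the \<open>C\<^sub>k\<close>.\<close>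

definition bochner_gen :: "complex \<Rightarrow> complex^'n^'n \<Rightarrow> complex^'n \<Rightarrow> real \<Rightarrow> complex" where
  "bochner_gen s H T V = det (mat 1 - mat s ** H) *
    (1 + s * trace H + s\<^sup>2 * of_real V + s ^ 3 * cdot T (matrix_inv (mat 1 - mat s ** H) *v T))"

text \<open>The primed letters are the derivatives prescribed by the structure equations;
  \<open>\<phi>\<close> and \<open>w\<close> stand for the values of the connection form and the
  tautological form on one tangent vector. The common factor det (1 - s H) is already divided out.
  The \<open>\<phi>\<close>-terms cancel because the generating function is invariant under unitary
  conjugation. What remains is an identity between the scalars w^* H^j R T and T^* R H^j w for j =
  0, 1, 2.\<close>

lemma bochner_gen_derivative_zero:
  fixes H H' R \<phi> :: "complex^'n^'n" and T w :: "complex^'n" and V :: real and s V' :: complex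
  assumes H: "hermitian H" and phi: "skew_hermitian \<phi>"
    and R: "R ** (mat 1 - mat s ** H) = mat 1"
    and H': "H' = - (\<phi> ** H) + H ** \<phi> + outer T w + outer w T"
    and T': "T' = - (\<phi> *v T) + (H ** H + mat (trace H) ** H + mat (of_real V)) *v w"
    and V': "V' = trace H * (cdot T w + cdot w T) + (cdot T (H *v w) + cdot w (H *v T))"
  shows "trace (R ** - (mat s ** H')) * (1 + s * trace H + s\<^sup>2 * of_real V + s ^ 3 * cdot T (R *v T))
    + (s * trace H' + s\<^sup>2 * V' +
      s ^ 3 * (cdot T (R *v T' + (R ** (mat s ** H') ** R) *v T) + cdot T' (R *v T))) = 0"
proof -
  let ?N = "H ** H + mat (trace H) ** H + mat (of_real V)"
  let ?\<tau> = "trace H"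
  have PR: "(mat 1 - mat s ** H) ** R = mat 1"
    using R by (simp add: matrix_left_right_inverse)
  have RH: "mat s ** (R ** H) = R - mat 1" and HR: "mat s ** (H ** R) = R - mat 1"
    using R PR by (simp_all add: matrix_mult_simps mat_scalar matrix_mul_assoc[symmetric] algebra_simps)
  have "R ** H = H ** R"
  proof (cases "s = 0")
    case True
    then have "R = mat 1"
      using R by (simp add: vec_eq_iff mat_mult_nth mat_nth if_distrib cong: if_cong)
    then show ?thesis
      by simp
  next
    case False
    have "mat (1/s) ** (mat s ** (R ** H)) = mat (1/s) ** (mat s ** (H ** R))"
      using RH HR by simp
    then show ?thesis
      using False by (simp add: vec_eq_iff mat_scalar(1))
  qed
  then have comm: "R ** H = H ** R" .
  have tr: "trace (R ** H') = cdot w (R *v T) + cdot T (R *v w)"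
  proof -
    have "trace (R ** (\<phi> ** H)) = trace (R ** (H ** \<phi>))"
      by (metis comm matrix_mul_assoc trace_mul_sym)
    then show ?thesis
      by (simp add: H' matrix_mult_simps trace_add trace_sub trace_simps trace_outer)
  qed
  have trH: "trace H' = cdot w T + cdot T w"
  proof -
    have "trace (mat 1 ** outer T w) = cdot w T" "trace (mat 1 ** outer w T) = cdot T w"
      by (simp_all only: trace_outer matrix_vector_mul_lid)
    then show ?thesis
      by (simp add: H' trace_add trace_sub trace_simps trace_mul_sym[of \<phi> H])
  qed
  have NH: "ctranspose ?N = ?N"
    using H trace_hermitian_real[OF H]
    by (simp add: hermitian_def ctranspose_simps mat_scalar)
  have cT': "cdot T' x = cdot T (\<phi> *v x) + cdot w (?N *v x)" for x
    using phi by (simp add: T' cdot_simps cdot_matrix NH skew_hermitian_def matrix_vector_uminus)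
  define x where "x = R *v T"
  have Tx: "T = x - s *s (H *v x)"
  proof -
    have "T = (mat 1 - mat s ** H) *v x"
      by (simp add: x_def matrix_vector_mul_assoc PR)
    then show ?thesis
      by (simp add: matrix_vector_mult_diff_rdistrib mat_scalar)
  qed
  define a b c where "a = cdot w x" "b = cdot w (H *v x)" "c = cdot w (H *v (H *v x))"
  define a' b' c' where "a' = cdot T (R *v w)" "b' = cdot T (R *v (H *v w))"
    "c' = cdot T (R *v (H *v (H *v w)))"
  \<comment> \<open>1 = R (1 - s H) trades a pairing with T that contains no resolvent for two that
    do. Together with \<open>Tx\<close> it expresses every term by a, b, c, a', b', c'.\<close>
  have Rz: "cdot T z = cdot T (R *v z) - s * cdot T (R *v (H *v z))" for z
  proof -
    have "z = R *v ((mat 1 - mat s ** H) *v z)"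
      by (simp add: matrix_vector_mul_assoc R)
    also have "\<dots> = R *v z - s *s (R *v (H *v z))"
      by (simp add: matrix_vector_mult_diff_rdistrib matrix_vector_mult_diff_distrib mat_scalar)
    finally have "cdot T z = cdot T (R *v z - s *s (R *v (H *v z)))"
      by simp
    then show ?thesis
      by (simp add: cdot_simps)
  qed
  define Q where "Q = cdot T x"
  have wT: "cdot w T = a - s * b" "cdot w (H *v T) = b - s * c"
    by (subst Tx, simp add: a_b_c_def cdot_simps matrix_vector_mult_diff_distrib mat_scalar)+
  have Tw: "cdot T w = a' - s * b'" "cdot T (H *v w) = b' - s * c'"
    using Rz[of w] Rz[of "H *v w"] by (simp_all add: a'_b'_c'_def)
  have wN: "cdot w (?N *v x) = c + ?\<tau> * b + of_real V * a"
    by (simp add: a_b_c_def matrix_vector_mult_add_rdistrib mat_scalar cdot_simps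
        matrix_vector_mul_assoc[symmetric])
  have TN: "cdot T (R *v (?N *v w)) = c' + ?\<tau> * b' + of_real V * a'"
    by (simp add: a'_b'_c'_def matrix_vector_mult_add_rdistrib mat_scalar cdot_simps
        matrix_vector_mul_assoc[symmetric] matrix_vector_right_distrib)
  have RHx: "s *s (H *v x) = x - T"
    using Tx by (simp add: algebra_simps)
  \<comment> \<open>The \<open>\<phi>\<close>-terms kept here are the ones that cancel in
    \<open>Q'\<close> against those of \<open>T'\<close> on either side of the pairing.\<close>
  have RHR: "s * cdot T (R *v (H' *v x)) =
    - cdot T (R *v (\<phi> *v (x - T))) + (cdot T (R *v (\<phi> *v x)) - cdot T (\<phi> *v x)) + s * (Q * a + a' * Q)"
  proof -
    have 1: "s * cdot T (R *v (\<phi> *v (H *v x))) = cdot T (R *v (\<phi> *v (s *s (H *v x))))"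
      by (simp add: mat_scalar cdot_simps)
    have 2: "s * cdot T (R *v (H *v (\<phi> *v x))) = cdot T (R *v (\<phi> *v x)) - cdot T (\<phi> *v x)"
      using Rz[of "\<phi> *v x"] by simp
    have "H' *v x = - (\<phi> *v (H *v x)) + H *v (\<phi> *v x) + a *s T + Q *s w"
      by (simp add: H' matrix_vector_mult_add_rdistrib matrix_vector_mult_diff_rdistrib matrix_vector_uminus matrix_vector_mul_assoc[symmetric]
          outer_vector a_b_c_def Q_def)
    then have "cdot T (R *v (H' *v x)) = - cdot T (R *v (\<phi> *v (H *v x)))
       + cdot T (R *v (H *v (\<phi> *v x))) + (a * Q + Q * a')"
      by (simp only: matrix_vector_right_distrib matrix_vector_uminus mat_scalar(6) cdot_simps
          x_def[symmetric] Q_def[symmetric] a'_b'_c'_def(1)[symmetric] add.assoc)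
    then have "s * cdot T (R *v (H' *v x)) = - (s * cdot T (R *v (\<phi> *v (H *v x))))
       + s * cdot T (R *v (H *v (\<phi> *v x))) + s * (a * Q + Q * a')"
      by (simp only: distrib_left mult_minus_right)
    then show ?thesis
      unfolding 1 2 RHx by (simp add: algebra_simps)
  qed
  have Q': "cdot T (R *v T' + (R ** (mat s ** H') ** R) *v T) + cdot T' (R *v T) =
     (c + ?\<tau> * b + of_real V * a) + (c' + ?\<tau> * b' + of_real V * a') + s * Q * (a + a')"
  proof -
    have "cdot T (R *v T') = - cdot T (R *v (\<phi> *v T)) + (c' + ?\<tau> * b' + of_real V * a')"
      by (simp only: T' matrix_vector_right_distrib matrix_vector_uminus cdot_simps TN)
    moreover have "cdot T ((R ** (mat s ** H') ** R) *v T) = s * cdot T (R *v (H' *v x))"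
      by (simp add: matrix_vector_mul_assoc[symmetric] mat_scalar cdot_simps x_def)
    moreover have "cdot T' (R *v T) = cdot T (\<phi> *v x) + (c + ?\<tau> * b + of_real V * a)"
      using cT'[of x] wN by (simp add: x_def)
    ultimately show ?thesis
      by (simp add: RHR cdot_simps matrix_vector_mult_diff_distrib algebra_simps)
  qed
  have trs: "trace (R ** - (mat s ** H')) = - s * (a + a')"
    by (simp add: matrix_mult_simps trace_simps mat_scalar tr a_b_c_def a'_b'_c'_def x_def)
  have "cdot T (R *v T) = Q"
    by (simp add: Q_def x_def)
  \<comment> \<open>With A = a + a', B = b + b', C = c + c' and t = tr H the sum is - s A (1 + s t +
    s^2 V + s^3 Q) + s (A - s B) + s^2 (t (A - s B) + B - s C) + s^3 (C + t B + V A + s Q A), which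
    telescopes.\<close>
  then show ?thesis
    unfolding trs Q' trH V' wT Tw
    by (simp add: algebra_simps power2_eq_square power3_eq_cube)
qed

lemma bochner_gen_has_vector_derivative:
  fixes H :: "real \<Rightarrow> complex^'n^'n" and T :: "real \<Rightarrow> complex^'n" and V :: "real \<Rightarrow> real"
  assumes herm: "hermitian (H t)" and phi: "skew_hermitian \<phi>"
    and det: "det (mat 1 - mat s ** H t) \<noteq> 0"
    and H: "(H has_vector_derivative - (\<phi> ** H t) + H t ** \<phi> + outer (T t) w + outer w (T t)) (at t)"
    and T: "(T has_vector_derivative
      - (\<phi> *v T t) + (H t ** H t + mat (trace (H t)) ** H t + mat (of_real (V t))) *v w) (at t)"
    and V: "((\<lambda>t. complex_of_real (V t)) has_vector_derivative
      trace (H t) * (cdot (T t) w + cdot w (T t)) + (cdot (T t) (H t *v w) + cdot w (H t *v T t))) (at t)"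
  shows "((\<lambda>t. bochner_gen s (H t) (T t) (V t)) has_vector_derivative 0) (at t)"
proof -
  define H' where "H' = - (\<phi> ** H t) + H t ** \<phi> + outer (T t) w + outer w (T t)"
  define T' where "T' = - (\<phi> *v T t) + (H t ** H t + mat (trace (H t)) ** H t + mat (of_real (V t))) *v w"
  define V' where "V' = trace (H t) * (cdot (T t) w + cdot w (T t)) + (cdot (T t) (H t *v w) + cdot w (H t *v T t))"
  let ?P = "\<lambda>t. mat 1 - mat s ** H t"
  let ?R = "\<lambda>t. matrix_inv (?P t)"
  have R: "?R t ** ?P t = mat 1"
    by (rule matrix_inv_mult(1)[OF det])
  have P: "(?P has_vector_derivative - (mat s ** H')) (at t)"
    using has_vector_derivative_diff[OF has_vector_derivative_const
        has_vector_derivative_const_mult_matrix[OF H]] by (simp add: H'_def)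
  have R': "(?R has_vector_derivative ?R t ** (mat s ** H') ** ?R t) (at t)"
    using has_vector_derivative_matrix_inv[OF P det] by (simp add: matrix_mult_simps)
  have Q: "((\<lambda>t. cdot (T t) (?R t *v T t)) has_vector_derivative
     cdot (T t) (?R t *v T' + (?R t ** (mat s ** H') ** ?R t) *v T t) + cdot T' (?R t *v T t)) (at t)"
    by (intro has_vector_derivative_cdot has_vector_derivative_matrix_vector R' T[folded T'_def])
  have tr: "((\<lambda>t. trace (H t)) has_vector_derivative trace H') (at t)"
    by (rule bounded_linear.has_vector_derivative[OF bounded_linear_trace H[folded H'_def]])
  have "((\<lambda>t. bochner_gen s (H t) (T t) (V t)) has_vector_derivative
     det (?P t) * (0 + s * trace H' + s\<^sup>2 * V' + s ^ 3 *
       (cdot (T t) (?R t *v T' + (?R t ** (mat s ** H') ** ?R t) *v T t) + cdot T' (?R t *v T t)))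
     + det (?P t) * trace (?R t ** - (mat s ** H')) *
       (1 + s * trace (H t) + s\<^sup>2 * of_real (V t) + s ^ 3 * cdot (T t) (?R t *v T t))) (at t)"
    unfolding bochner_gen_def
    by (intro has_vector_derivative_mult has_vector_derivative_add has_vector_derivative_mult_right
        has_vector_derivative_const Q tr V[folded V'_def] has_vector_derivative_det[OF P R])
  moreover have "det (?P t) * (0 + s * trace H' + s\<^sup>2 * V' + s ^ 3 *
       (cdot (T t) (?R t *v T' + (?R t ** (mat s ** H') ** ?R t) *v T t) + cdot T' (?R t *v T t)))
     + det (?P t) * trace (?R t ** - (mat s ** H')) *
       (1 + s * trace (H t) + s\<^sup>2 * of_real (V t) + s ^ 3 * cdot (T t) (?R t *v T t))
     = 0"
  proof -
    have "d * (0 + x + y + z) + d * u * v = d * (u * v + (x + y + z))" for d x y z u v :: complex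
      by (simp add: algebra_simps)
    then show ?thesis
      by (simp only: bochner_gen_derivative_zero[OF herm phi R H'_def T'_def V'_def] mult_zero_right)
  qed
  ultimately show ?thesis
    by (simp only:)
qed

text \<open>x^* S x is purely imaginary, so x and S x are orthogonal for the real inner product and
  Pythagoras applies. On the imaginary axis this gives both the invertibility of 1 - s H and the
  fact that the resolvent does not increase norms.\<close>

lemma norm_one_minus_skew_hermitian:
  assumes "skew_hermitian S"
  shows "norm x \<le> norm ((mat 1 - S) *v x)"
proof -
  have "cdot x (S *v x) = - cdot (S *v x) x"
    using assms by (simp add: cdot_matrix skew_hermitian_def matrix_vector_uminus cdot_simps)
  then have "x \<bullet> (S *v x) = - ((S *v x) \<bullet> x)"
    by (simp add: inner_eq_Re_cdot)
  then have "x \<bullet> (S *v x) = 0"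
    by (simp add: inner_commute)
  then have "(norm (x - S *v x))\<^sup>2 = (norm x)\<^sup>2 + (norm (S *v x))\<^sup>2"
    by (simp add: power2_norm_eq_inner inner_diff_left inner_diff_right inner_commute)
  then have "(norm x)\<^sup>2 \<le> (norm (x - S *v x))\<^sup>2"
    by simp
  then show ?thesis
    by (simp add: matrix_vector_mult_diff_rdistrib power2_le_iff_abs_le)
qed

lemma det_nonzero_iff_kernel:
  fixes A :: "complex^'n^'n"
  shows "det A \<noteq> 0 \<longleftrightarrow> (\<forall>x. A *v x = 0 \<longrightarrow> x = 0)"
  by (metis invertible_det_nz invertible_left_inverse matrix_left_invertible_ker)

lemma skew_hermitian_imaginary:
  "hermitian H \<Longrightarrow> skew_hermitian (mat (\<i> * of_real r) ** H)"
  by (simp add: hermitian_def skew_hermitian_def ctranspose_simps mat_scalar)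
    (simp add: vec_eq_iff mat_scalar)

lemma det_one_minus_imaginary:
  assumes "hermitian H"
  shows "det (mat 1 - mat (\<i> * of_real r) ** H) \<noteq> 0"
  unfolding det_nonzero_iff_kernel
  using norm_one_minus_skew_hermitian[OF skew_hermitian_imaginary[OF assms]] by (metis norm_le_zero_iff norm_zero)

section \<open>Elementary symmetric functions of the eigenvalues as coefficients of det (1 - s
  H)\<close>

lemma multiset_positions_eq_Sigma:
  "{(x, i). i < count L x} = Sigma (set_mset L) (\<lambda>x. {..<count L x})"
proof -
  have "x \<in># L" if "i < count L x" for x i
    using that by (metis not_in_iff not_less_zero)
  then show ?thesis
    by auto
qed

lemma finite_multiset_positions: "finite {(x, i). i < count L x}"
  unfolding multiset_positions_eq_Sigma by simp

lemma prod_multiset_positions: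
  "(\<Prod>(x, i)\<in>{(x, i). i < count L x}. f x) = prod_mset (image_mset f L)"
  unfolding multiset_positions_eq_Sigma
  by (simp add: prod.Sigma[symmetric] image_prod_mset_multiplicity)

text \<open>Expanding the product means choosing 1 or -x s from each factor. The factors are indexed
  by positions (x, i), so equal eigenvalues stay separate, and a choice of k positions contributes
  (-1)^k times their product to the coefficient of s^k.\<close>

lemma coeff_prod_mset_elem_sym:
  "coeff (prod_mset (image_mset (\<lambda>x. [:1, - x:]) L)) k = (-1) ^ k * elem_sym k L"
proof -
  let ?A = "{(x, i). i < count L x}"
  have monom: "(\<Prod>p\<in>X. monom (- fst p) (Suc 0)) = monom ((-1) ^ card X * (\<Prod>(x, i)\<in>X. x)) (card X)"
    if "finite X" for X :: "(complex \<times> nat) set"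
    using that by (induction X) (auto simp: mult_monom case_prod_beta monom_0)
  have "prod_mset (image_mset (\<lambda>x. [:1, - x:]) L) = (\<Prod>p\<in>?A. monom (- fst p) 1 + 1)"
    unfolding prod_multiset_positions[symmetric]
    by (intro prod.cong) (auto simp: monom_Suc monom_0 one_pCons)
  also have "\<dots> = (\<Sum>X\<in>Pow ?A. monom ((-1) ^ card X * (\<Prod>(x, i)\<in>X. x)) (card X))"
    by (subst prod_add[OF finite_multiset_positions])
      (auto intro!: sum.cong simp: monom finite_subset[OF _ finite_multiset_positions])
  finally have "coeff (prod_mset (image_mset (\<lambda>x. [:1, - x:]) L)) k =
      (\<Sum>X\<in>Pow ?A. if card X = k then (-1) ^ k * (\<Prod>(x, i)\<in>X. x) else 0)"
    by (auto simp: coeff_sum coeff_monom intro!: sum.cong)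
  also have "\<dots> = (\<Sum>X | X \<subseteq> ?A \<and> card X = k. (-1) ^ k * (\<Prod>(x, i)\<in>X. x))"
    by (rule sum.mono_neutral_cong_right) (auto simp: finite_multiset_positions)
  finally show ?thesis
    by (simp add: elem_sym_def sum_distrib_left)
qed

lemma poly_det: "poly (det P) x = det (\<chi> i j. poly (P $ i $ j) x)" for P :: "complex poly^'n^'n"
  by (simp add: det_def poly_sum poly_prod)

lemma poly_charpoly: "poly (charpoly A) x = det (mat x - A)" for A :: "complex^'n^'n"
proof -
  have "(\<chi> i j. poly ((\<chi> i j. (if i = j then [:0, 1:] else 0) - [:A $ i $ j:]) $ i $ j) x) = mat x - A"
    by (simp add: vec_eq_iff mat_nth)
  then show ?thesis
    by (simp add: charpoly_def poly_det)
qed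

text \<open>In the Leibniz expansion the degree of a term is at most the number of fixed points of
  its permutation. Only the identity fixes all indices, and its term is a product of monic linear
  factors.\<close>

lemma charpoly_monic:
  fixes A :: "complex^'n^'n"
  shows "degree (charpoly A) = CARD('n)" "lead_coeff (charpoly A) = 1"
proof -
  let ?U = "UNIV :: 'n set"
  let ?e = "\<lambda>i j. (if i = j then [:0, 1:] else 0) - [:A $ i $ j:]"
  let ?t = "\<lambda>p. of_int (sign p) * (\<Prod>i\<in>?U. ?e i (p i))"
  have deg: "degree (?t p) \<le> card {i. p i = i}" for p
  proof -
    have "degree (?t p) \<le> degree (of_int (sign p) :: complex poly) + degree (\<Prod>i\<in>?U. ?e i (p i))"
      by (rule degree_mult_le)
    also have "\<dots> \<le> (\<Sum>i\<in>?U. degree (?e i (p i)))"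
      using degree_prod_sum_le[of ?U "\<lambda>i. ?e i (p i)"] by (simp add: o_def)
    also have "\<dots> \<le> (\<Sum>i\<in>?U. if p i = i then 1 else 0)"
      by (intro sum_mono) auto
    also have "\<dots> = card {i. p i = i}"
      by (simp add: sum.If_cases)
    finally show ?thesis .
  qed
  have lt: "card {i. p i = i} < CARD('n)" if "p \<noteq> id" for p :: "'n \<Rightarrow> 'n"
    using that by (intro psubset_card_mono) (auto simp: fun_eq_iff)
  have id: "?t id = (\<Prod>i\<in>?U. [:- A $ i $ i, 1:])"
    by (simp add: sign_id)
  have cid: "coeff (?t id) (CARD('n)) = 1"
  proof -
    have "lead_coeff (\<Prod>i\<in>?U. [:- A $ i $ i, 1:]) = 1"
      by (simp add: lead_coeff_prod)
    moreover have "degree (\<Prod>i\<in>?U. [:- A $ i $ i, 1:]) = CARD('n)"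
      by (subst degree_prod_eq_sum_degree) auto
    ultimately show ?thesis
      by (simp only: id)
  qed
  have det: "charpoly A = (\<Sum>p | p permutes ?U. ?t p)"
    by (simp add: charpoly_def det_def)
  have "coeff (charpoly A) (CARD('n)) = (\<Sum>p | p permutes ?U. coeff (?t p) (CARD('n)))"
    by (simp only: det coeff_sum)
  also have "\<dots> = (\<Sum>p\<in>{id}. coeff (?t p) (CARD('n)))"
    by (rule sum.mono_neutral_right)
      (auto simp: finite_permutations permutes_id intro!: coeff_eq_0 le_less_trans[OF deg lt])
  finally have c: "coeff (charpoly A) (CARD('n)) = 1"
    using cid by simp
  have "degree (charpoly A) \<le> CARD('n)"
    unfolding det
    by (intro degree_sum_le finite_permutations finite order_trans[OF deg] card_mono) auto
  then show "degree (charpoly A) = CARD('n)"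
    using c by (metis le_antisym le_degree zero_neq_one)
  then show "lead_coeff (charpoly A) = 1"
    using c by simp
qed

lemma det_mat: "det (mat c :: complex^'n^'n) = c ^ CARD('n)"
  by (subst det_diagonal) (simp_all add: mat_nth)

text \<open>For nonzero s, 1 - s H = s (1/s - H), so the determinant is the reversed characteristic
  polynomial. Since the roots are as many as the matrix has rows, each factor s of s^n can be paired
  with one factor 1/s - x.\<close>

lemma det_one_minus_eq_eigenvalues:
  fixes H :: "complex^'n^'n"
  shows "det (mat 1 - mat s ** H) = poly (prod_mset (image_mset (\<lambda>x. [:1, - x:]) (eigenvalues H))) s"
proof (cases "s = 0")
  case True
  have "mat 0 ** H = 0"
    by (simp add: vec_eq_iff mat_scalar(1))
  then show ?thesis
    using True by (simp add: poly_prod_mset image_mset.compositionality o_def)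
next
  case False
  have "mat 1 - mat s ** H = mat s ** (mat (1 / s) - H)"
    using False by (simp add: vec_eq_iff mat_scalar(1) mat_nth algebra_simps)
  then have "det (mat 1 - mat s ** H) = s ^ CARD('n) * poly (charpoly H) (1 / s)"
    by (simp add: det_mul det_mat poly_charpoly)
  also have "charpoly H = (\<Prod>x\<in>#proots (charpoly H). [:- x, 1:])"
  proof -
    have "charpoly H \<noteq> 0"
      using charpoly_monic(2)[of H] by auto
    from alg_closed_imp_factorization[OF this]
    obtain A where A: "charpoly H = (\<Prod>x\<in>#A. [:- x, 1:])"
      by (auto simp: charpoly_monic(2))
    moreover have "proots (\<Prod>x\<in>#A. [:- x, 1:]) = A"
    proof (induction A)
      case (add x A)
      have "(\<Prod>x\<in>#A. [:- x, 1:]) \<noteq> 0"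
        by (auto simp: prod_mset_zero_iff)
      then have "proots ([:- x, 1:] * (\<Prod>x\<in>#A. [:- x, 1:])) = proots [:- x, 1:] + A"
        by (subst proots_mult) (auto simp: add simp del: proots_linear_factor)
      then show ?case
        by (simp del: mult_pCons_left)
    qed simp
    ultimately show ?thesis
      by simp
  qed
  also have "s ^ CARD('n) * poly (\<Prod>x\<in>#proots (charpoly H). [:- x, 1:]) (1 / s)
     = s ^ size (proots (charpoly H)) * (\<Prod>x\<in>#proots (charpoly H). 1 / s - x)"
    by (simp add: size_proots_complex charpoly_monic poly_prod_mset image_mset.compositionality o_def)
  also have "\<dots> = (\<Prod>x\<in>#proots (charpoly H). s * (1 / s - x))"
    by (simp add: prod_mset.distrib)
  also have "\<dots> = (\<Prod>x\<in>#proots (charpoly H). 1 - s * x)"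
    using False by (simp add: algebra_simps)
  finally show ?thesis
    by (simp add: eigenvalues_def poly_prod_mset image_mset.compositionality o_def)
qed

text \<open>The constant term is the limit at 0 along the imaginary axis and hence vanishes.
  Dividing by the variable, whose modulus is r, lowers the exponent of the bound by one, and the
  induction continues with the quotient.\<close>

lemma coeff_zero_if_small_on_imaginary_axis:
  fixes d :: "complex poly"
  assumes "\<And>r. 0 < r \<Longrightarrow> r < 1 \<Longrightarrow> norm (poly d (\<i> * of_real r)) \<le> K * r ^ m" and "k < m"
  shows "coeff d k = 0"
  using assms
proof (induction m arbitrary: d k)
  case (Suc m)
  obtain a d' where d: "d = pCons a d'"
    by (cases d)
  have "((\<lambda>r. poly d (\<i> * of_real r)) \<longlongrightarrow> poly d (\<i> * of_real 0)) (at_right 0)"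
    by (intro tendsto_intros)
  moreover have "((\<lambda>r. poly d (\<i> * of_real r)) \<longlongrightarrow> 0) (at_right 0)"
  proof (rule Lim_null_comparison)
    show "\<forall>\<^sub>F r in at_right 0. norm (poly d (\<i> * of_real r)) \<le> K * r ^ Suc m"
      using eventually_at_right_real[of 0 "1::real", OF zero_less_one]
      by eventually_elim (use Suc.prems(1) in auto)
    have "((\<lambda>r::real. K * r ^ Suc m) \<longlongrightarrow> K * 0 ^ Suc m) (at_right 0)"
      by (intro tendsto_intros)
    then show "((\<lambda>r::real. K * r ^ Suc m) \<longlongrightarrow> 0) (at_right 0)"
      by simp
  qed
  ultimately have "poly d (\<i> * of_real 0) = 0"
    by (rule tendsto_unique[OF trivial_limit_at_right_real])
  then have a: "a = 0"
    by (simp add: d)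
  have "norm (poly d' (\<i> * of_real r)) \<le> K * r ^ m" if r: "0 < r" "r < 1" for r
  proof -
    have "r * norm (poly d' (\<i> * of_real r)) \<le> r * (K * r ^ m)"
      using Suc.prems(1)[OF r] r by (simp add: d a norm_mult mult_ac)
    then show ?thesis
      using r by simp
  qed
  then have "coeff d' j = 0" if "j < m" for j
    using Suc.IH that by blast
  then show ?case
    using Suc.prems(2) by (cases k) (auto simp: d a)
qed simp

text \<open>Iterating R = 1 + s R H gives a geometric series with an exact remainder, so no
  convergence is involved.\<close>

lemma resolvent_expansion:
  fixes H R :: "complex^'n^'n"
  assumes R: "R ** (mat 1 - mat s ** H) = mat 1"
  shows "R *v T = (\<Sum>m<L. s ^ m *s ((((*v) H) ^^ m) T)) + s ^ L *s (R *v ((((*v) H) ^^ L) T))"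
proof (induction L)
  case (Suc L)
  have "R *v y = y + s *s (R *v (H *v y))" for y
  proof -
    have "y = R *v ((mat 1 - mat s ** H) *v y)"
      by (simp add: matrix_vector_mul_assoc R)
    also have "\<dots> = R *v y - s *s (R *v (H *v y))"
      by (simp add: matrix_vector_mult_diff_rdistrib matrix_vector_mult_diff_distrib mat_scalar)
    finally show ?thesis
      by (simp add: algebra_simps)
  qed
  from this[of "(((*v) H) ^^ L) T"] show ?case
    unfolding Suc by (simp add: vec_eq_iff algebra_simps)
qed simp

text \<open>The generating function with the series of the B_k cut off before s^N: a true
  polynomial, whose coefficients below N are nevertheless exactly the
  \<open>bochner_C\<close>.\<close>

definition bochner_poly :: "complex^'n^'n \<Rightarrow> complex^'n \<Rightarrow> real \<Rightarrow> nat \<Rightarrow> complex poly" where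
  "bochner_poly H T V N = prod_mset (image_mset (\<lambda>x. [:1, - x:]) (eigenvalues H)) *
    (\<Sum>i<N. monom (bochner_B H T V i) i)"

lemma coeff_bochner_poly:
  assumes "k < N"
  shows "coeff (bochner_poly H T V N) k = bochner_C H T V k"
  unfolding bochner_poly_def bochner_C_def coeff_mult coeff_prod_mset_elem_sym
  using assms by (intro sum.cong) (auto simp: bochner_h_def coeff_sum coeff_monom sum.delta' sum.delta)

text \<open>Up to sign the difference is det (1 - s H) s^(L+3) T^* R H^L T. On the imaginary axis R
  does not increase norms, and the determinant is bounded on the unit disc, so the constant does not
  depend on r. The shift by 3 accounts for B_0, B_1, B_2, which precede the resolvent terms.\<close>

lemma bochner_poly_approximates:
  fixes H :: "complex^'n^'n" and T :: "complex^'n" and V :: real and L :: nat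
  assumes H: "hermitian H"
  obtains K where "\<And>r. 0 < r \<Longrightarrow> r < 1 \<Longrightarrow>
    norm (poly (bochner_poly H T V (L + 3)) (\<i> * of_real r) - bochner_gen (\<i> * of_real r) H T V)
      \<le> K * r ^ (L + 3)"
proof -
  let ?p = "bochner_poly H T V (L + 3)"
  define q where "q = prod_mset (image_mset (\<lambda>x. [:1, - x:]) (eigenvalues H))"
  let ?y = "(((*v) H) ^^ L) T"
  obtain K1 where K1: "\<And>z. norm z \<le> 1 \<Longrightarrow> norm (poly q z) \<le> K1"
    using poly_bound_exists[of 1 q] by blast
  obtain K2 where K2: "\<And>v w :: complex^'n. norm (cdot v w) \<le> norm v * norm w * K2" "0 < K2"
    using bounded_bilinear.pos_bounded[OF bounded_bilinear_cdot] by blast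
  have "norm (poly ?p s - bochner_gen s H T V) \<le> (K1 * (norm T * norm ?y * K2)) * r ^ (L + 3)"
    if r: "0 < r" "r < 1" and s: "s = \<i> * of_real r" for r s
  proof -
    let ?P = "mat 1 - mat s ** H"
    let ?R = "matrix_inv ?P"
    have det: "det ?P \<noteq> 0"
      using det_one_minus_imaginary[OF H] s by blast
    have R: "?R ** ?P = mat 1"
      by (rule matrix_inv_mult(1)[OF det])
    then have PR: "?P ** ?R = mat 1"
      using matrix_left_right_inverse by blast
    have "cdot T (?R *v T) = (\<Sum>m<L. s ^ m * bochner_B H T V (m + 3)) + s ^ L * cdot T (?R *v ?y)"
      unfolding resolvent_expansion[OF R, of T L]
      by (simp add: bochner_B_def cdot_simps bounded_linear.linear[OF
            bounded_bilinear.bounded_linear_right[OF bounded_bilinear_cdot], THEN linear_sum])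
    moreover have "poly (\<Sum>i<L + 3. monom (bochner_B H T V i) i) s =
       1 + s * trace H + s\<^sup>2 * of_real V + s ^ 3 * (\<Sum>m<L. s ^ m * bochner_B H T V (m + 3))"
    proof -
      have "poly (\<Sum>i<L + 3. monom (bochner_B H T V i) i) s = (\<Sum>i<L + 3. bochner_B H T V i * s ^ i)"
        by (simp add: poly_sum poly_monom)
      also have "\<dots> = (\<Sum>i<3. bochner_B H T V i * s ^ i) + (\<Sum>i<L. bochner_B H T V (i + 3) * s ^ (i + 3))"
        using sum.atLeastLessThan_concat[of 0 3 "L + 3" "\<lambda>i. bochner_B H T V i * s ^ i"]
          sum.shift_bounds_nat_ivl[of "\<lambda>i. bochner_B H T V i * s ^ i" 0 3 L]
        by (simp add: lessThan_atLeast0)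
      finally show ?thesis
        by (simp add: numeral_3_eq_3 bochner_B_def sum_distrib_left power2_eq_square power3_eq_cube
            power_add mult_ac)
    qed
    ultimately have "bochner_gen s H T V - poly ?p s = poly q s * (s ^ (L + 3) * cdot T (?R *v ?y))"
      unfolding bochner_gen_def det_one_minus_eq_eigenvalues bochner_poly_def q_def[symmetric]
      by (simp add: algebra_simps power_add power3_eq_cube)
    then have "norm (poly ?p s - bochner_gen s H T V) =
        norm (poly q s) * (r ^ (L + 3) * norm (cdot T (?R *v ?y)))"
      using r by (metis (no_types, lifting) abs_of_pos mult_1 norm_ii norm_minus_commute norm_mult
          norm_of_real norm_power s)
    also have "\<dots> \<le> K1 * (r ^ (L + 3) * (norm T * norm ?y * K2))"
    proof (intro mult_mono mult_left_mono)
      show "norm (poly q s) \<le> K1"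
        using r by (intro K1) (simp add: s norm_mult)
      then show "0 \<le> K1"
        using norm_ge_zero order_trans by blast
      have "norm (?R *v ?y) \<le> norm (?P *v (?R *v ?y))"
        unfolding s by (rule norm_one_minus_skew_hermitian[OF skew_hermitian_imaginary[OF H]])
      then have "norm (?R *v ?y) \<le> norm ?y"
        by (simp add: matrix_vector_mul_assoc PR)
      then have "norm T * norm (?R *v ?y) * K2 \<le> norm T * norm ?y * K2"
        using K2(2) by (intro mult_right_mono mult_left_mono) auto
      then show "norm (cdot T (?R *v ?y)) \<le> norm T * norm ?y * K2"
        using K2(1) order_trans by blast
    qed (use r in auto)
    finally show ?thesis
      by (simp add: mult_ac)
  qed
  then show ?thesis
    using that by blast
qed

text \<open>Two truncations that approximate the same values to order r^(k+3) differ by a polynomial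
  too small on the imaginary axis to have a nonzero coefficient at k. Working with truncations
  avoids power series.\<close>

lemma bochner_C_eqI:
  fixes H H' :: "complex^'n^'n"
  assumes "hermitian H" "hermitian H'"
    and eq: "\<And>r. bochner_gen (\<i> * of_real r) H T V = bochner_gen (\<i> * of_real r) H' T' V'"
  shows "bochner_C H T V k = bochner_C H' T' V' k"
proof -
  let ?p = "bochner_poly H T V (k + 3)" and ?p' = "bochner_poly H' T' V' (k + 3)"
  obtain K where K: "\<And>r. 0 < r \<Longrightarrow> r < 1 \<Longrightarrow>
      norm (poly ?p (\<i> * of_real r) - bochner_gen (\<i> * of_real r) H T V) \<le> K * r ^ (k + 3)"
    using bochner_poly_approximates[OF assms(1)] by blast
  obtain K' where K': "\<And>r. 0 < r \<Longrightarrow> r < 1 \<Longrightarrow>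
      norm (poly ?p' (\<i> * of_real r) - bochner_gen (\<i> * of_real r) H' T' V') \<le> K' * r ^ (k + 3)"
    using bochner_poly_approximates[OF assms(2)] by blast
  have small: "norm (poly (?p - ?p') (\<i> * of_real r)) \<le> (K + K') * r ^ (k + 3)" if "0 < r" "r < 1" for r
  proof -
    have "poly (?p - ?p') (\<i> * of_real r) = (poly ?p (\<i> * of_real r) - bochner_gen (\<i> * of_real r) H T V)
        - (poly ?p' (\<i> * of_real r) - bochner_gen (\<i> * of_real r) H' T' V')"
      by (simp add: eq)
    also have "norm \<dots> \<le> K * r ^ (k + 3) + K' * r ^ (k + 3)"
      by (rule order_trans[OF norm_triangle_ineq4 add_mono[OF K[OF that] K'[OF that]]])
    finally show ?thesis
      by (simp add: distrib_right)
  qed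
  have "coeff (?p - ?p') k = 0"
    by (rule coeff_zero_if_small_on_imaginary_axis[where m="k + 3" and K="K + K'"])
      (use small in auto)
  moreover have "coeff ?p k = bochner_C H T V k" "coeff ?p' k = bochner_C H' T' V' k"
    by (rule coeff_bochner_poly, simp)+
  ultimately show ?thesis
    by simp
qed

section \<open>Square roots of Hermitian matrices and unitary paths\<close>

text \<open>A fixed point of \<open>E \<mapsto> (Y - E\<^sup>2) / 2\<close> satisfies \<open>(1 + E)\<^sup>2 = 1 + Y\<close>.\<close>

lemma hermitian_sqrt_near_identity:
  obtains \<epsilon> K where "\<epsilon> > 0" and "\<And>Y :: complex^'n^'n. hermitian Y \<Longrightarrow> norm Y \<le> \<epsilon> \<Longrightarrow>
    \<exists>E. hermitian E \<and> E + E + E ** E = Y \<and> norm (E - (1/2) *\<^sub>R Y) \<le> K * (norm Y)\<^sup>2"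
proof -
  have "\<exists>C>0. \<forall>(A :: complex^'n^'n) (B :: complex^'n^'n). norm (A ** B) \<le> norm A * norm B * C"
    by (rule bounded_bilinear.pos_bounded[OF bounded_bilinear_matrix_mult])
  then obtain C where C: "\<And>(A :: complex^'n^'n) (B :: complex^'n^'n). norm (A ** B) \<le> norm A * norm B * C" "0 < C"
    by blast
  show ?thesis
  \<comment> \<open>If C r is at most 1/2 for r = norm Y, the map sends the ball of radius r into
    itself, since (r + C r^2) / 2 is at most 3 r / 4, and it contracts by 1/2. The second constant
    bounds the deviation (1/2) E E of the fixed point from Y / 2.\<close>
  proof (rule that[of "1 / (2 * C)" "C / 2"])
    show "0 < 1 / (2 * C)"
      using C(2) by simp
    fix Y :: "complex^'n^'n"
    assume Y: "hermitian Y" and small: "norm Y \<le> 1 / (2 * C)"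
    define r where "r = norm Y"
    have r: "r \<ge> 0" "C * r \<le> 1 / 2"
      using small C(2) by (auto simp: r_def field_simps)
    \<comment> \<open>Hermitian matrices form a closed set preserved by the map, so the fixed point
      found in \<open>S\<close> is Hermitian.\<close>
    define S where "S = {E :: complex^'n^'n. ctranspose E = E} \<inter> cball 0 r"
    let ?f = "\<lambda>E :: complex^'n^'n. (1/2) *\<^sub>R (Y - E ** E)"
    have sq: "norm (E ** E) \<le> C * r * r" if "norm E \<le> r" for E :: "complex^'n^'n"
    proof -
      have "norm (E ** E) \<le> norm E * norm E * C"
        by (rule C(1))
      also have "\<dots> \<le> r * r * C"
        using that C(2) r by (intro mult_right_mono mult_mono) auto
      finally show ?thesis
        by (simp add: mult_ac)
    qed
    have "closed {E :: complex^'n^'n. ctranspose E = E}"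
      by (intro closed_Collect_eq continuous_on_id linear_continuous_on bounded_linear_ctranspose)
    then have "complete S"
      unfolding S_def complete_eq_closed by (intro closed_Int closed_cball)
    moreover have "S \<noteq> {}"
    proof -
      have "0 \<in> S"
        using r by (simp add: S_def vec_eq_iff ctranspose_nth)
      then show ?thesis
        by blast
    qed
    moreover have "?f ` S \<subseteq> S"
    proof safe
      fix E assume E: "E \<in> S"
      then have nE: "norm E \<le> r" and hE: "ctranspose E = E"
        by (auto simp: S_def)
      have "norm (Y - E ** E) \<le> r + C * r * r"
        using norm_triangle_ineq4[of Y "E ** E"] sq[OF nE] by (simp add: r_def)
      also have "\<dots> \<le> r + 1 / 2 * r"
        using r by (intro add_left_mono mult_right_mono) auto
      finally have "norm (?f E) \<le> r"
        using r by simp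
      then show "?f E \<in> S"
        using Y hE by (simp add: S_def ctranspose_simps hermitian_def)
    qed
    moreover have "dist (?f E) (?f F) \<le> 1 / 2 * dist E F" if "E \<in> S" "F \<in> S" for E F
    proof -
      have nE: "norm E \<le> r" and nF: "norm F \<le> r"
        using that by (auto simp: S_def)
      have "E ** E - F ** F = E ** (E - F) + (E - F) ** F"
        by (simp add: matrix_mult_simps)
      then have "norm (E ** E - F ** F) \<le> norm (E ** (E - F)) + norm ((E - F) ** F)"
        by (metis norm_triangle_ineq)
      also have "\<dots> \<le> norm E * norm (E - F) * C + norm (E - F) * norm F * C"
        by (intro add_mono C(1))
      also have "\<dots> \<le> r * norm (E - F) * C + norm (E - F) * r * C"
        using nE nF C(2) by (intro add_mono mult_right_mono mult_left_mono) auto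
      also have "\<dots> = 2 * (C * r) * norm (E - F)"
        by simp
      also have "\<dots> \<le> norm (E - F)"
        using r(2) mult_right_mono[of "2 * (C * r)" 1 "norm (E - F)"] by simp
      finally have "norm (E ** E - F ** F) \<le> norm (E - F)" .
      moreover have "?f E - ?f F = (1/2) *\<^sub>R (F ** F - E ** E)"
        by (simp add: algebra_simps)
      ultimately show ?thesis
        unfolding dist_norm by (simp add: norm_minus_commute)
    qed
    ultimately have "\<exists>!E\<in>S. ?f E = E"
      by (intro Banach_fix[where c="1/2"]) auto
    then obtain E where E: "E \<in> S" "?f E = E"
      by blast
    have "E + E = ?f E + ?f E"
      by (simp only: E(2))
    also have "\<dots> = (1/2 + 1/2) *\<^sub>R (Y - E ** E)"
      by (rule scaleR_add_left[symmetric])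
    finally have eq: "E + E = Y - E ** E"
      by simp
    have "norm (E - (1/2) *\<^sub>R Y) = norm ((1/2) *\<^sub>R (E ** E))"
    proof -
      have "E - (1/2) *\<^sub>R Y = - ((1/2) *\<^sub>R (E ** E))"
        by (subst E(2)[symmetric]) (simp add: algebra_simps)
      then show ?thesis
        by (metis norm_minus_cancel)
    qed
    also have "\<dots> \<le> C / 2 * (norm Y)\<^sup>2"
      using sq[of E] E(1) by (simp add: S_def r_def power2_eq_square)
    finally have "norm (E - (1/2) *\<^sub>R Y) \<le> C / 2 * (norm Y)\<^sup>2" .
    then show "\<exists>E. hermitian E \<and> E + E + E ** E = Y \<and> norm (E - (1/2) *\<^sub>R Y) \<le> C / 2 * (norm Y)\<^sup>2"
      using E(1) eq by (intro exI[of _ E]) (auto simp: S_def hermitian_def)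
  qed
qed

lemma has_derivative_if_quadratic_error:
  fixes f :: "'a::real_normed_vector \<Rightarrow> 'b::real_normed_vector"
  assumes D: "bounded_linear D"
    and err: "\<forall>\<^sub>F y in nhds x. norm (f y - f x - D (y - x)) \<le> M * (norm (y - x))\<^sup>2"
  shows "(f has_derivative D) (at x)"
  unfolding has_derivative_within_alt
proof (intro conjI allI impI D)
  fix e :: real assume e: "e > 0"
  obtain d where d: "d > 0" "\<And>y. dist y x < d \<Longrightarrow> norm (f y - f x - D (y - x)) \<le> M * (norm (y - x))\<^sup>2"
    using err unfolding eventually_nhds_metric by blast
  define d' where "d' = min d (e / (\<bar>M\<bar> + 1))"
  have "norm (f y - f x - D (y - x)) \<le> e * norm (y - x)" if y: "norm (y - x) < d'" for y
  proof -
    have "norm (f y - f x - D (y - x)) \<le> M * (norm (y - x))\<^sup>2"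
      using y by (intro d(2)) (simp add: d'_def dist_norm)
    also have "\<dots> \<le> (\<bar>M\<bar> + 1) * (norm (y - x))\<^sup>2"
      by (intro mult_right_mono) auto
    also have "\<dots> = ((\<bar>M\<bar> + 1) * norm (y - x)) * norm (y - x)"
      by (simp add: power2_eq_square)
    also have "\<dots> \<le> e * norm (y - x)"
    proof (rule mult_right_mono)
      have "norm (y - x) < e / (\<bar>M\<bar> + 1)"
        using y by (simp add: d'_def)
      then show "(\<bar>M\<bar> + 1) * norm (y - x) \<le> e"
        by (simp add: pos_less_divide_eq mult.commute)
    qed simp
    finally show ?thesis .
  qed
  moreover have "d' > 0"
    using d(1) e by (simp add: d'_def)
  ultimately show "\<exists>d>0. \<forall>y\<in>UNIV. norm (y - x) < d \<longrightarrow>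
      norm (f y - f x - D (y - x)) \<le> e * norm (y - x)"
    by blast
qed

lemma differentiable_matrix_mult:
  fixes A B :: "'a::real_normed_vector \<Rightarrow> complex^'n^'n"
  assumes "A differentiable (at x)" "B differentiable (at x)"
  shows "(\<lambda>t. A t ** B t) differentiable (at x)"
proof -
  obtain A' B' where "(A has_derivative A') (at x)" "(B has_derivative B') (at x)"
    using assms unfolding differentiable_def by blast
  from bounded_bilinear.FDERIV[OF bounded_bilinear_matrix_mult this] show ?thesis
    unfolding differentiable_def by blast
qed

text \<open>Multiplication by the inverse of \<open>A1\<close> on both sides turns h into 1 + Y with
  Y(0) = 0; if (1 + E)^2 = 1 + Y, then (1 + E) A1 is a frame for h. The derivative of E at 0 comes
  from E = Y / 2 + O(|Y|^2) together with Y = O(t), instead of a smoothness theorem for square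
  roots.\<close>

lemma frame_curve:
  fixes h :: "real \<Rightarrow> complex^'n^'n"
  assumes h: "h differentiable (at 0)" and herm: "\<And>t. hermitian (h t)"
    and A1: "ctranspose A1 ** A1 = h 0" and det: "det A1 \<noteq> 0"
  obtains A where "A 0 = A1" "A differentiable (at 0)"
    "\<forall>\<^sub>F t in nhds 0. ctranspose (A t) ** A t = h t"
proof -
  obtain \<epsilon> K where \<epsilon>: "\<epsilon> > 0" and sqrt: "\<And>Y :: complex^'n^'n. hermitian Y \<Longrightarrow> norm Y \<le> \<epsilon> \<Longrightarrow>
    \<exists>E. hermitian E \<and> E + E + E ** E = Y \<and> norm (E - (1/2) *\<^sub>R Y) \<le> K * (norm Y)\<^sup>2"
    using hermitian_sqrt_near_identity by blast
  define B where "B = matrix_inv A1"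
  have BA: "B ** A1 = mat 1"
    unfolding B_def by (rule matrix_inv_mult(1)[OF det])
  then have AB: "A1 ** B = mat 1"
    using matrix_left_right_inverse by blast
  have BA': "ctranspose A1 ** ctranspose B = mat 1"
    by (metis BA complex_cnj_one ctranspose_simps(1,5))
  have AB': "ctranspose B ** ctranspose A1 = mat 1"
    by (metis AB complex_cnj_one ctranspose_simps(1,5))
  define Y where "Y t = ctranspose B ** h t ** B - mat 1" for t
  have "ctranspose B ** (ctranspose A1 ** A1) ** B = mat 1"
    by (metis AB AB' matrix_mul_assoc matrix_mul_rid)
  then have Y0: "Y 0 = 0"
    by (simp add: Y_def A1[symmetric])
  have hY: "hermitian (Y t)" for t
    using herm[of t] by (simp add: hermitian_def Y_def ctranspose_simps matrix_mul_assoc)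
  have dY: "Y differentiable (at 0)"
    unfolding Y_def by (intro differentiable_diff differentiable_matrix_mult differentiable_const h)
  then obtain D where D: "(Y has_derivative D) (at 0)"
    by (auto simp: differentiable_def)
  obtain M where M: "\<forall>\<^sub>F t in nhds 0. norm (Y t) \<le> M * \<bar>t\<bar>" "M > 0"
  proof -
    obtain N where N: "\<And>t. norm (D t) \<le> norm t * N" "0 < N"
      using bounded_linear.pos_bounded[OF has_derivative_bounded_linear[OF D]] by blast
    obtain d where d: "d > 0" "\<And>t. \<bar>t\<bar> < d \<Longrightarrow> norm (Y t - Y 0 - D (t - 0)) \<le> 1 * \<bar>t\<bar>"
    proof -
      have "\<exists>d>0. \<forall>t\<in>UNIV. norm (t - 0) < d \<longrightarrow> norm (Y t - Y 0 - D (t - 0)) \<le> 1 * norm (t - 0)"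
        using D zero_less_one unfolding has_derivative_within_alt by blast
      then show ?thesis
        using that by auto
    qed
    have "norm (Y t) \<le> (N + 1) * \<bar>t\<bar>" if "dist t 0 < d" for t
    proof -
      have "norm (Y t) \<le> norm (Y t - D t) + norm (D t)"
        by (metis add.commute diff_add_cancel norm_triangle_ineq)
      also have "\<dots> \<le> \<bar>t\<bar> + \<bar>t\<bar> * N"
        using d(2)[of t] N(1)[of t] that by (intro add_mono) (auto simp: Y0)
      finally show ?thesis
        by (simp add: algebra_simps)
    qed
    then have "\<forall>\<^sub>F t in nhds 0. norm (Y t) \<le> (N + 1) * \<bar>t\<bar>"
      unfolding eventually_nhds_metric using d(1) by blast
    then show ?thesis
      using that[of "N + 1"] N(2) by simp
  qed
  \<comment> \<open>The smallness of Y becomes the premise of an implication so that E can be chosen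
    for every t at once; where Y is large the choice is arbitrary.\<close>
  have "\<exists>E. norm (Y t) \<le> \<epsilon> \<longrightarrow>
    hermitian E \<and> E + E + E ** E = Y t \<and> norm (E - (1/2) *\<^sub>R Y t) \<le> K * (norm (Y t))\<^sup>2" for t
    using sqrt[OF hY] by blast
  then obtain E where E: "\<And>t. norm (Y t) \<le> \<epsilon> \<Longrightarrow>
    hermitian (E t) \<and> E t + E t + E t ** E t = Y t \<and> norm (E t - (1/2) *\<^sub>R Y t) \<le> K * (norm (Y t))\<^sup>2"
    by metis
  have E0: "E 0 = 0"
    using E[of 0] \<epsilon> by (simp add: Y0)
  have small: "\<forall>\<^sub>F t in nhds 0. norm (Y t) \<le> \<epsilon>"
  proof -
    have "isCont Y 0"
      using dY by (rule differentiable_imp_continuous_within)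
    then have "(Y \<longlongrightarrow> 0) (nhds 0)"
      using tendsto_at_iff_tendsto_nhds[of Y 0] by (simp add: isCont_def Y0)
    then have "\<forall>\<^sub>F t in nhds 0. dist (Y t) 0 < \<epsilon>"
      using \<epsilon> by (rule tendstoD)
    then show ?thesis
      by eventually_elim simp
  qed
  have "\<forall>\<^sub>F t in nhds 0. norm (E t - (1/2) *\<^sub>R Y t) \<le> \<bar>K\<bar> * M\<^sup>2 * t\<^sup>2"
    using small M(1)
  proof eventually_elim
    case (elim t)
    have "norm (E t - (1/2) *\<^sub>R Y t) \<le> K * (norm (Y t))\<^sup>2"
      using E elim by blast
    also have "\<dots> \<le> \<bar>K\<bar> * (norm (Y t))\<^sup>2"
      by (intro mult_right_mono) auto
    also have "\<dots> \<le> \<bar>K\<bar> * (M * \<bar>t\<bar>)\<^sup>2"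
      using elim by (intro mult_left_mono power_mono) auto
    finally show ?case
      by (simp add: power_mult_distrib mult_ac)
  qed
  then have "((\<lambda>t. E t - (1/2) *\<^sub>R Y t) has_derivative (\<lambda>_. 0)) (at 0)"
    by (intro has_derivative_if_quadratic_error) (simp_all add: E0 Y0)
  then have "(\<lambda>t. E t - (1/2) *\<^sub>R Y t) differentiable (at 0)"
    by (auto simp: differentiable_def)
  then have "(\<lambda>t. (E t - (1/2) *\<^sub>R Y t) + (1/2) *\<^sub>R Y t) differentiable (at 0)"
    by (intro differentiable_add differentiable_scaleR differentiable_const dY)
  then have dE: "E differentiable (at 0)"
    by simp
  show ?thesis
  proof (rule that[of "\<lambda>t. (mat 1 + E t) ** A1"])
    show "(mat 1 + E 0) ** A1 = A1"
      by (simp add: E0)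
    show "(\<lambda>t. (mat 1 + E t) ** A1) differentiable (at 0)"
      by (intro differentiable_matrix_mult differentiable_add differentiable_const dE)
    show "\<forall>\<^sub>F t in nhds 0. ctranspose ((mat 1 + E t) ** A1) ** ((mat 1 + E t) ** A1) = h t"
      using small
    proof eventually_elim
      case (elim t)
      have "(mat 1 + E t) ** (mat 1 + E t) = mat 1 + (E t + E t + E t ** E t)"
        by (simp add: matrix_mult_simps)
      also have "\<dots> = ctranspose B ** h t ** B"
        using E[OF elim] by (simp add: Y_def)
      finally have sq: "(mat 1 + E t) ** (mat 1 + E t) = ctranspose B ** h t ** B" .
      have "ctranspose ((mat 1 + E t) ** A1) ** ((mat 1 + E t) ** A1)
          = ctranspose A1 ** ((mat 1 + E t) ** (mat 1 + E t)) ** A1"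
        using E[OF elim] by (simp add: ctranspose_simps hermitian_def matrix_mul_assoc)
      also have "\<dots> = (ctranspose A1 ** ctranspose B) ** h t ** (B ** A1)"
        unfolding sq by (simp add: matrix_mul_assoc)
      finally show ?case
        by (simp add: BA BA')
    qed
  qed
qed

text \<open>All frames of a fixed Gram matrix therefore lie on one sphere, and a bound on the traces
  of several Gram matrices bounds their frames.\<close>

lemma trace_ctranspose_mult: "trace (ctranspose A ** A) = of_real ((norm A)\<^sup>2)" for A :: "complex^'n^'n"
proof -
  have "trace (ctranspose A ** A) = (\<Sum>j\<in>UNIV. \<Sum>i\<in>UNIV. of_real ((cmod (A $ i $ j))\<^sup>2))"
    by (simp add: trace_def mat_mult_nth ctranspose_nth complex_norm_square mult.commute del: of_real_power)
  also have "\<dots> = (\<Sum>i\<in>UNIV. \<Sum>j\<in>UNIV. of_real ((cmod (A $ i $ j))\<^sup>2))"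
    by (rule sum.swap)
  also have "\<dots> = of_real ((norm A)\<^sup>2)"
    by (simp add: norm_vec_def L2_set_def real_sqrt_pow2 sum_nonneg del: of_real_power)
  finally show ?thesis .
qed

lemma det_frame_nonzero:
  assumes "ctranspose A ** A = X" and pos: "\<And>v. v \<noteq> 0 \<Longrightarrow> 0 < Re (cdot v (X *v v))"
  shows "det A \<noteq> 0"
  unfolding det_nonzero_iff_kernel
proof (intro allI impI)
  fix v assume "A *v v = 0"
  then have "X *v v = 0"
    by (simp add: assms(1)[symmetric] matrix_vector_mul_assoc[symmetric])
  then show "v = 0"
    using pos[of v] by (auto simp: cdot_def)
qed

text \<open>The set of \<open>t\<close> for which \<open>(1 - t) 1 + t X\<close> is of the form \<open>A\<^sup>* A\<close> is open and closed in \<open>[0, 1]\<close>.\<close>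

lemma posdef_has_frame:
  fixes X :: "complex^'n^'n"
  assumes X: "hermitian X" and pos: "\<And>v. v \<noteq> 0 \<Longrightarrow> 0 < Re (cdot v (X *v v))"
  obtains A where "ctranspose A ** A = X"
proof -
  \<comment> \<open>The segment from the identity to X; convexity keeps it positive definite for t
    in [0, 1].\<close>
  define h where "h t = (1 - t) *\<^sub>R mat 1 + t *\<^sub>R X" for t :: real
  have herm: "hermitian (h t)" for t
    using X by (simp add: h_def hermitian_def ctranspose_simps)
  have hpos: "0 < Re (cdot v (h t *v v))" if "v \<noteq> 0" "t \<in> {0..1}" for v t
  proof -
    have "h t *v v = (1 - t) *\<^sub>R v + t *\<^sub>R (X *v v)"
      by (simp add: h_def matrix_vector_mult_add_rdistrib bounded_bilinear.scaleR_left[OF bounded_bilinear_matrix_vector])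
    then have "Re (cdot v (h t *v v)) = (1 - t) * (norm v)\<^sup>2 + t * Re (cdot v (X *v v))"
      by (simp add: inner_eq_Re_cdot[symmetric] inner_add_right power2_norm_eq_inner)
    moreover have "(norm v)\<^sup>2 > 0" "Re (cdot v (X *v v)) > 0"
      using that pos by auto
    ultimately show ?thesis
      using that(2) by (cases "t = 0") (auto intro!: add_nonneg_pos)
  qed
  define Z where "Z = {t \<in> {0..1}. \<exists>A. ctranspose A ** A = h t}"
  have "openin (top_of_set {0..1}) Z"
    unfolding openin_euclidean_subtopology_iff
  proof (intro conjI ballI)
    show "Z \<subseteq> {0..1}"
      by (auto simp: Z_def)
    fix t assume "t \<in> Z"
    then obtain A where t: "t \<in> {0..1}" and A: "ctranspose A ** A = h t"
      by (auto simp: Z_def)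
    have "det A \<noteq> 0"
      using det_frame_nonzero[OF A] hpos[OF _ t] by blast
    moreover have "(\<lambda>s. h (t + s)) differentiable (at 0)"
      unfolding h_def
      by (intro differentiable_add differentiable_scaleR differentiable_diff differentiable_const
          differentiable_ident)
    ultimately obtain F where "\<forall>\<^sub>F s in nhds 0. ctranspose (F s) ** F s = h (t + s)"
      using frame_curve[of "\<lambda>s. h (t + s)" A] herm A by (metis add.right_neutral)
    then obtain d where "d > 0" and d: "\<And>s. \<bar>s\<bar> < d \<Longrightarrow> ctranspose (F s) ** F s = h (t + s)"
      unfolding eventually_nhds_metric by (auto simp: dist_norm)
    have "t' \<in> Z" if "t' \<in> {0..1}" "dist t' t < d" for t'
      using d[of "t' - t"] that by (auto simp: Z_def dist_norm)
    then show "\<exists>e>0. \<forall>t'\<in>{0..1}. dist t' t < e \<longrightarrow> t' \<in> Z"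
      using \<open>d > 0\<close> by blast
  qed
  moreover have "closedin (top_of_set {0..1}) Z"
  proof -
    have "closed Z"
      unfolding closed_sequential_limits
    proof (intro allI impI, elim conjE)
      fix t l assume t: "\<forall>n. t n \<in> Z" and lim: "t \<longlonglongrightarrow> l"
      have l: "l \<in> {0..1}"
        using closed_sequentially[OF closed_atLeastAtMost _ lim] t by (auto simp: Z_def)
      have "\<exists>A. ctranspose A ** A = h (t n)" for n
        using t by (auto simp: Z_def)
      then obtain A where A: "\<And>n. ctranspose (A n) ** A n = h (t n)"
        by metis
      have hl: "(\<lambda>n. h (t n)) \<longlonglongrightarrow> h l"
        unfolding h_def by (intro tendsto_intros lim)
      have "(\<lambda>n. trace (h (t n))) \<longlonglongrightarrow> trace (h l)"
        by (rule bounded_linear.tendsto[OF bounded_linear_trace hl])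
      then have "Bseq (\<lambda>n. trace (h (t n)))"
        by (intro convergent_imp_Bseq convergentI)
      then obtain K where K: "\<And>n. norm (trace (h (t n))) \<le> K"
        by (auto simp: Bseq_def)
      \<comment> \<open>The traces of h along the convergent sequence are bounded and hence bound
        the frames; a limit of a subsequence is then a frame at l.\<close>
      have nA: "(norm (A n))\<^sup>2 \<le> K" for n
        using K[of n] by (simp add: A[symmetric] trace_ctranspose_mult norm_power)
      then have "norm (A n) \<le> sqrt K" for n
        by (simp add: real_le_rsqrt)
      then have "bounded (range A)"
        by (auto simp: bounded_iff)
      then obtain L r where r: "strict_mono r" and L: "(A \<circ> r) \<longlonglongrightarrow> L"
        using bounded_imp_convergent_subsequence by blast
      have "(\<lambda>n. ctranspose ((A \<circ> r) n) ** (A \<circ> r) n) \<longlonglongrightarrow> ctranspose L ** L"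
        by (intro bounded_bilinear.tendsto[OF bounded_bilinear_matrix_mult]
            bounded_linear.tendsto[OF bounded_linear_ctranspose] L)
      moreover have "(\<lambda>n. ctranspose ((A \<circ> r) n) ** (A \<circ> r) n) \<longlonglongrightarrow> h l"
        using LIMSEQ_subseq_LIMSEQ[OF hl r] by (simp add: o_def A)
      ultimately have "ctranspose L ** L = h l"
        by (rule LIMSEQ_unique)
      then show "l \<in> Z"
        using l by (auto simp: Z_def)
    qed
    then show ?thesis
      by (rule closed_subset[rotated]) (auto simp: Z_def)
  qed
  moreover have "0 \<in> Z"
    by (auto simp: Z_def h_def ctranspose_simps intro!: exI[of _ "mat 1"])
  ultimately have "Z = {0..1}"
    using connected_Icc[of 0 "1::real"] unfolding connected_clopen by blast
  then have "1 \<in> Z"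
    by simp
  then show ?thesis
    using that by (auto simp: Z_def h_def)
qed

section \<open>Paths between two frames of the same Gram matrix\<close>

lemma differentiable_of_real:
  "f differentiable F \<Longrightarrow> (\<lambda>t. complex_of_real (f t)) differentiable F"
  unfolding differentiable_def by (blast intro: has_derivative_of_real)

lemma differentiable_mat:
  "f differentiable (at x) \<Longrightarrow> (\<lambda>t. mat (f t) :: complex^'n^'n) differentiable (at x)"
  by (intro differentiable_vecI, case_tac "i = ia") (simp_all add: mat_nth)

lemma differentiable_cnj: "f differentiable F \<Longrightarrow> (\<lambda>t. cnj (f t)) differentiable F"
  unfolding differentiable_def by (blast intro: has_derivative_cnj)

lemma norm_isometry:
  assumes "ctranspose W ** W = mat 1"
  shows "norm (W *v x) = norm x"
proof -
  have "cdot (W *v x) (W *v x) = cdot x x"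
    using assms by (simp add: cdot_matrix[of "W *v x"] matrix_vector_mul_assoc)
  then have "complex_of_real ((norm (W *v x))\<^sup>2) = of_real ((norm x)\<^sup>2)"
    by (simp only: cdot_self)
  then show ?thesis
    by (simp only: of_real_eq_iff) (simp add: power2_eq_iff_nonneg)
qed

lemma mat_mult_mat: "mat a ** mat b = (mat (a * b) :: 'a::comm_ring_1^'n^'n)"
  by (simp add: vec_eq_iff mat_scalar(1) mat_nth)

lemma cis_eq_of_real_cos_sin: "cis x = of_real (cos x) + \<i> * of_real (sin x)"
  by (simp add: complex_eq_iff)

text \<open>Two frames \<open>A\<^sub>1\<close> and \<open>A\<^sub>0\<close> differ by a unitary matrix \<open>W\<close>. For a unit scalar \<open>c\<close> such
  that \<open>c + W\<close> is invertible, the matrices \<open>(W + a) (1 + cnj a W)\<^sup>-\<^sup>1\<close> with \<open>a\<close> from \<open>0\<close> to \<open>c\<close> form a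
  path of unitary matrices from \<open>W\<close> to \<open>c\<close>.\<close>

lemma frames_path_connected:
  fixes A0 A1 X :: "complex^'n^'n" and f :: "complex^'n^'n \<Rightarrow> 'b"
  assumes A0: "ctranspose A0 ** A0 = X" and A1: "ctranspose A1 ** A1 = X" and det: "det A0 \<noteq> 0"
    and const: "\<And>A s t. (\<And>t :: real. A differentiable (at t)) \<Longrightarrow> (\<And>t. ctranspose (A t) ** A t = X) \<Longrightarrow>
      f (A s) = f (A t)"
  shows "f A0 = f A1"
proof -
  define B where "B = matrix_inv A0"
  have BA: "B ** A0 = mat 1"
    unfolding B_def by (rule matrix_inv_mult(1)[OF det])
  then have AB: "A0 ** B = mat 1"
    using matrix_left_right_inverse by blast
  have AB': "ctranspose B ** ctranspose A0 = mat 1"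
    by (metis AB complex_cnj_one ctranspose_simps(1,5))
  define W where "W = A1 ** B"
  have WA: "W ** A0 = A1"
    by (simp add: W_def matrix_mul_assoc[symmetric] BA)
  have WW: "ctranspose W ** W = mat 1"
  proof -
    have "ctranspose W ** W = ctranspose B ** (ctranspose A1 ** A1) ** B"
      by (simp add: W_def ctranspose_simps matrix_mul_assoc)
    also have "\<dots> = (ctranspose B ** ctranspose A0) ** (A0 ** B)"
      by (simp add: A1 A0[symmetric] matrix_mul_assoc)
    finally show ?thesis
      by (simp add: AB AB')
  qed
  \<comment> \<open>The matrix -W has finitely many eigenvalues and the unit circle is infinite, so
    some c on the circle avoids them.\<close>
  obtain c where c: "norm c = 1" "det (mat c + W) \<noteq> 0"
  proof -
    have "charpoly (- W) \<noteq> 0"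
      using charpoly_monic(2)[of "- W"] by auto
    then have "finite {x. poly (charpoly (- W)) x = 0}"
      by (rule poly_roots_finite)
    moreover have "infinite (sphere (0::complex) 1)"
    proof -
      have "connected (sphere (0::complex) 1)"
        by (rule connected_sphere) simp
      moreover have "1 \<in> sphere (0::complex) 1" "\<i> \<in> sphere (0::complex) 1" "(1::complex) \<noteq> \<i>"
        by (auto simp: complex_eq_iff)
      ultimately show ?thesis
        by (metis connected_finite_iff_sing empty_iff singletonD)
    qed
    ultimately obtain c where "c \<in> sphere 0 1" "poly (charpoly (- W)) c \<noteq> 0"
      by (metis (mono_tags, lifting) finite_subset mem_Collect_eq subsetI)
    then show ?thesis
      using that[of c] by (simp add: poly_charpoly)
  qed
  \<comment> \<open>The hypothesis on f asks for curves differentiable at every real t. The function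
    sin^2 is smooth on the whole line, keeps |a| at most 1, and runs from 0 at t = 0 to 1 at t = pi
    / 2.\<close>
  define a where "a t = of_real ((sin t)\<^sup>2) * c" for t :: real
  let ?N = "\<lambda>t. mat 1 + mat (cnj (a t)) ** W"
  let ?P = "\<lambda>t. (W + mat (a t)) ** matrix_inv (?N t) ** A0"
  have cc: "mat (cnj c) ** (mat c + W) = mat 1 + mat (cnj c) ** W"
    using c(1) complex_norm_square[of c]
    by (simp add: vec_eq_iff mat_scalar(1) mat_nth algebra_simps)
  \<comment> \<open>W is an isometry, so a kernel vector satisfies |x| = |a| |x|. Only |a| = 1 is
    left, and there the matrix is cnj c times c + W.\<close>
  have detN: "det (?N t) \<noteq> 0" for t
    unfolding det_nonzero_iff_kernel
  proof (intro allI impI)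
    fix x assume "?N t *v x = 0"
    then have x: "x = - (cnj (a t) *s (W *v x))"
      by (simp add: matrix_vector_mult_add_rdistrib mat_scalar eq_neg_iff_add_eq_0)
    have "norm x = norm (cnj (a t)) * norm x"
      by (subst x) (simp add: norm_vector_scalar norm_isometry[OF WW])
    then have "norm x = (sin t)\<^sup>2 * norm x"
      using c(1) by (simp add: a_def norm_mult norm_power)
    then consider "x = 0" | "(sin t)\<^sup>2 = 1"
      by auto
    then show "x = 0"
    proof cases
      case 2
      have "cnj c *s ((mat c + W) *v x) = 0"
        using \<open>?N t *v x = 0\<close> 2 by (simp add: a_def cc[symmetric] mat_scalar)
      moreover have "c \<noteq> 0"
        using c(1) by auto
      ultimately have "(mat c + W) *v x = 0"
        by (simp add: vec_eq_iff)
      then show ?thesis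
        using c(2) unfolding det_nonzero_iff_kernel by blast
    qed
  qed
  have inv: "?N t ** matrix_inv (?N t) = mat 1" for t
    by (rule matrix_inv_mult(2)[OF detN])
  have da: "a differentiable (at t)" for t
    unfolding a_def
    by (intro differentiable_mult differentiable_of_real differentiable_const differentiable_power)
      (auto intro!: derivative_intros simp: real_differentiable_def DERIV_sin)
  have dN: "?N differentiable (at t)" for t
    by (intro differentiable_add differentiable_const differentiable_matrix_mult differentiable_mat
        differentiable_cnj da)
  have "f (?P (pi / 2)) = f (?P 0)"
  proof (rule const[of ?P])
    show "?P differentiable (at t)" for t
      by (intro differentiable_add differentiable_const differentiable_matrix_mult differentiable_mat
          differentiable_matrix_inv da dN detN)
    fix t
    let ?R = "matrix_inv (?N t)"
    have R': "ctranspose ?R ** ctranspose (?N t) = mat 1"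
      by (metis inv complex_cnj_one ctranspose_simps(1,5))
    let ?z = "a t" and ?W' = "ctranspose W"
    have "ctranspose (W + mat ?z) ** (W + mat ?z) =
        ?W' ** W + mat ?z ** ?W' + (mat (cnj ?z) ** W + mat (cnj ?z * ?z))"
      by (simp only: ctranspose_simps matrix_mult_simps mat_scalar(2)[of ?W'] mat_mult_mat add_ac)
    moreover have "ctranspose (?N t) ** ?N t =
        mat 1 + mat (cnj ?z) ** W + (mat ?z ** ?W' + mat ?z ** (mat (cnj ?z) ** (?W' ** W)))"
      by (simp only: ctranspose_simps matrix_mult_simps mat_scalar(2)[of ?W'] mat_scalar(3)[of ?W']
          complex_cnj_cnj complex_cnj_one matrix_mul_assoc[symmetric] matrix_mul_lid matrix_mul_rid add_ac)
    \<comment> \<open>Both sides equal 1 + |a|^2 + cnj a W + a W^* after W^* W = 1; this is the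
      unitarity of the path in a form free of inverses.\<close>
    ultimately have sq: "ctranspose (W + mat ?z) ** (W + mat ?z) = ctranspose (?N t) ** ?N t"
      by (simp add: WW mat_mult_mat algebra_simps)
    have "ctranspose (?P t) ** ?P t =
        ctranspose A0 ** (ctranspose ?R ** ((ctranspose (W + mat ?z) ** (W + mat ?z)) ** (?R ** A0)))"
      by (simp only: ctranspose_simps(1) matrix_mul_assoc)
    also have "\<dots> = ctranspose A0 ** ((ctranspose ?R ** ctranspose (?N t)) ** ((?N t ** ?R) ** A0))"
      unfolding sq by (simp only: matrix_mul_assoc)
    finally show "ctranspose (?P t) ** ?P t = X"
      by (simp only: R' inv matrix_mul_lid A0)
  qed
  moreover have "?P 0 = A1"
  proof -
    have "mat 0 ** W = 0" "(mat 0 :: complex^'n^'n) = 0"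
      by (simp_all add: vec_eq_iff mat_scalar(1) mat_nth)
    moreover have "matrix_inv (mat 1 :: complex^'n^'n) = mat 1"
      by (rule matrix_inv_unique) simp
    ultimately show ?thesis
      by (simp add: a_def WA)
  qed
  moreover have "?P (pi / 2) = mat c ** A0"
  proof -
    have "mat c ** (mat 1 + mat (cnj c) ** W) = W + mat c"
      using c(1) complex_norm_square[of c]
      by (simp add: vec_eq_iff mat_scalar(1) mat_nth algebra_simps)
    then have "?P (pi / 2) = (mat c ** ?N (pi / 2)) ** matrix_inv (?N (pi / 2)) ** A0"
      by (simp add: a_def)
    also have "\<dots> = mat c ** ((?N (pi / 2) ** matrix_inv (?N (pi / 2))) ** A0)"
      by (simp only: matrix_mul_assoc)
    finally show ?thesis
      by (simp only: inv matrix_mul_lid)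
  qed
  \<comment> \<open>The first path ends at the scalar c; a second one moves c to 1 along the unit
    circle.\<close>
  moreover have "f (mat c ** A0) = f A0"
  proof -
    have "c \<noteq> 0"
      using c(1) by auto
    then have "cis (Arg c) = c"
      using cis_Arg[of c] c(1) by (simp add: sgn_eq)
    then obtain \<theta> where \<theta>: "c = cis \<theta>"
      by metis
    let ?Q = "\<lambda>t. mat (cis (t * \<theta>)) ** A0"
    have "f (?Q 1) = f (?Q 0)"
    proof (rule const[of ?Q])
      have "(\<lambda>t. cis (t * \<theta>)) differentiable (at t)" for t
        unfolding cis_eq_of_real_cos_sin
        by (intro differentiable_add differentiable_mult differentiable_const differentiable_of_real)
          (auto intro!: derivative_eq_intros simp: real_differentiable_def)
      then show "?Q differentiable (at t)" for t
        by (intro differentiable_matrix_mult differentiable_const differentiable_mat)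
      show "ctranspose (?Q t) ** ?Q t = X" for t
      proof -
        let ?z = "cis (t * \<theta>)"
        have "ctranspose (?Q t) ** ?Q t = ctranspose A0 ** ((mat (cnj ?z) ** mat ?z) ** A0)"
          by (simp only: ctranspose_simps matrix_mul_assoc)
        also have "\<dots> = X"
          by (simp add: mat_mult_mat cis_cnj cis_mult A0)
        finally show ?thesis .
      qed
    qed
    then show ?thesis
      by (simp add: \<theta>)
  qed
  ultimately show ?thesis
    by simp
qed

section \<open>Differentiability of power series and of holomorphic maps\<close>

text \<open>The functional \<open>l\<close> makes the series real, where unconditional convergence
  is absolute. Evaluation at a point whose coordinates all exceed those of a by one \<rho> > 0 shows
  that the coefficients weighted with \<rho>^deg are absolutely summable. The terms of degree at
  least 2 then add up to at most a multiple of |x - a|^2, which makes the linear terms the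
  derivative.\<close>

lemma real_analytic_on_linear_differentiable:
  fixes f :: "'a::euclidean_space \<Rightarrow> 'b::real_normed_vector" and l :: "'b \<Rightarrow> real"
  assumes f: "real_analytic_on f S" and a: "a \<in> S" and l: "bounded_linear l"
  shows "(\<lambda>x. l (f x)) differentiable (at a)"
proof -
  define I where "I = {\<alpha> :: 'a \<Rightarrow> nat. \<forall>b. b \<notin> Basis \<longrightarrow> \<alpha> b = 0}"
  define m where "m x \<alpha> = (\<Prod>b\<in>Basis. ((x - a) \<bullet> b) ^ \<alpha> b)" for x and \<alpha> :: "'a \<Rightarrow> nat"
  define deg where "deg \<alpha> = (\<Sum>b\<in>Basis. \<alpha> b)" for \<alpha> :: "'a \<Rightarrow> nat"
  have "\<exists>r>0. \<exists>c. \<forall>x\<in>ball a r. ((\<lambda>\<alpha>. m x \<alpha> *\<^sub>R c \<alpha>) has_sum f x) I"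
    using bspec[OF f[unfolded real_analytic_on_def] a] unfolding I_def m_def .
  then obtain r c where r: "r > 0"
    and c: "\<And>x. x \<in> ball a r \<Longrightarrow> ((\<lambda>\<alpha>. m x \<alpha> *\<^sub>R c \<alpha>) has_sum f x) I"
    by blast
  define d where "d \<alpha> = l (c \<alpha>)" for \<alpha>
  have sum: "((\<lambda>\<alpha>. m x \<alpha> * d \<alpha>) has_sum l (f x)) I" if "x \<in> ball a r" for x
    using has_sum_bounded_linear[OF l c[OF that]]
    by (simp add: d_def linear_cmul[OF bounded_linear.linear[OF l]] o_def)
  \<comment> \<open>The divisor makes the displacement to \<open>x0\<close>, a sum of DIM coordinate
    steps, at most r / 2 in norm.\<close>
  define \<rho> where "\<rho> = r / (2 * real DIM('a))"
  have \<rho>: "\<rho> > 0"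
    using r by (simp add: \<rho>_def)
  have \<rho>r: "\<rho> < r"
  proof -
    have "1 \<le> real DIM('a)"
      using DIM_positive[where 'a='a] by linarith
    then have "1 < 2 * real DIM('a)"
      by linarith
    then show ?thesis
      using r by (simp add: \<rho>_def divide_less_eq)
  qed
  define x0 where "x0 = a + (\<Sum>b\<in>Basis. \<rho> *\<^sub>R b)"
  have "norm (\<Sum>b\<in>Basis. \<rho> *\<^sub>R b :: 'a) \<le> (\<Sum>b\<in>(Basis :: 'a set). \<rho>)"
    using \<rho> by (intro sum_norm_le) auto
  also have "\<dots> = r / 2"
    by (simp add: \<rho>_def)
  finally have x0: "x0 \<in> ball a r"
    using r by (simp add: x0_def dist_norm)
  have m0: "m x0 \<alpha> = \<rho> ^ deg \<alpha>" for \<alpha>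
  proof -
    have "m x0 \<alpha> = (\<Prod>b\<in>Basis. \<rho> ^ \<alpha> b)"
      unfolding m_def by (intro prod.cong) (simp_all add: x0_def)
    then show ?thesis
      by (simp add: deg_def power_sum)
  qed
  have "(\<lambda>\<alpha>. m x0 \<alpha> * d \<alpha>) summable_on I"
    using sum[OF x0] by (auto simp: summable_on_def)
  then have abs: "(\<lambda>\<alpha>. norm (\<rho> ^ deg \<alpha> * d \<alpha>)) summable_on I"
    unfolding m0 by (rule summable_on_iff_abs_summable_on_real[THEN iffD1])
  define e where "e b = (\<lambda>b'. if b' = b then 1 else 0 :: nat)" for b :: 'a
  define F where "F = insert (\<lambda>_. 0) (e ` Basis)"
  have e_eq: "e b b' = 1 \<longleftrightarrow> b' = b" for b b'
    by (simp add: e_def)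
  have finF: "finite F" and FI: "F \<subseteq> I"
    by (auto simp: F_def I_def e_def)
  have deg2: "deg \<alpha> \<ge> 2" if \<alpha>: "\<alpha> \<in> I" "\<alpha> \<notin> F" for \<alpha>
  proof (rule ccontr)
    assume "\<not> deg \<alpha> \<ge> 2"
    then consider "deg \<alpha> = 0" | "deg \<alpha> = Suc 0"
      by linarith
    then show False
    proof cases
      case 1
      then have "\<alpha> = (\<lambda>_. 0)"
        using \<alpha>(1) by (auto simp: deg_def I_def fun_eq_iff)
      then show False
        using \<alpha>(2) by (simp add: F_def)
    next
      case 2
      then obtain b where b: "b \<in> Basis" "\<alpha> b = Suc 0" "\<forall>b'\<in>Basis. b \<noteq> b' \<longrightarrow> \<alpha> b' = 0"
        unfolding deg_def by (subst (asm) sum_eq_Suc0_iff) auto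
      have "\<alpha> = e b"
      proof
        fix b'
        show "\<alpha> b' = e b b'"
          using b \<alpha>(1) by (cases "b' \<in> Basis") (auto simp: e_def I_def)
      qed
      then show False
        using \<alpha>(2) b(1) by (simp add: F_def)
    qed
  qed
  define L where "L h = (\<Sum>b\<in>Basis. (h \<bullet> b) * d (e b))" for h
  define K where "K = (\<Sum>\<^sub>\<infinity>\<alpha>\<in>I - F. norm (\<rho> ^ deg \<alpha> * d \<alpha>)) / \<rho>\<^sup>2"
  have main: "norm (l (f x) - (d (\<lambda>_. 0) + L (x - a))) \<le> K * (norm (x - a))\<^sup>2"
    if x: "norm (x - a) < \<rho>" for x
  proof -
    let ?s = "norm (x - a)"
    have xb: "x \<in> ball a r"
      using x \<rho>r by (simp add: dist_norm norm_minus_commute)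
    have "(\<Sum>\<alpha>\<in>F. m x \<alpha> * d \<alpha>) = d (\<lambda>_. 0) + L (x - a)"
    proof -
      have "(\<lambda>_. 0) \<notin> e ` Basis"
        using e_eq by (metis imageE zero_neq_one)
      moreover have "inj_on e Basis"
        using e_eq by (metis inj_onI)
      moreover have "m x (e b) = (x - a) \<bullet> b" if "b \<in> Basis" for b
      proof -
        have "m x (e b) = (\<Prod>b'\<in>Basis. if b' = b then (x - a) \<bullet> b' else 1)"
          unfolding m_def e_def by (intro prod.cong) auto
        then show ?thesis
          using that by simp
      qed
      moreover have "m x (\<lambda>_. 0) = 1"
        by (simp add: m_def)
      ultimately show ?thesis
        by (simp add: F_def L_def sum.reindex)
    qed
    then have rest: "((\<lambda>\<alpha>. m x \<alpha> * d \<alpha>) has_sum (l (f x) - (d (\<lambda>_. 0) + L (x - a)))) (I - F)"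
      using has_sum_Diff[OF sum[OF xb] has_sum_finite[OF finF] FI] by metis
    \<comment> \<open>Of the factors of the monomial, two are kept as |x - a|^2 and the remaining j
      are estimated by \<rho>.\<close>
    have bnd: "norm (m x \<alpha> * d \<alpha>) \<le> norm (\<rho> ^ deg \<alpha> * d \<alpha>) * (?s\<^sup>2 / \<rho>\<^sup>2)" if "\<alpha> \<in> I - F" for \<alpha>
    proof -
      obtain j where j: "deg \<alpha> = j + 2"
        using deg2[of \<alpha>] \<open>\<alpha> \<in> I - F\<close> by (metis DiffD1 DiffD2 add.commute le_Suc_ex)
      have "\<bar>m x \<alpha>\<bar> = (\<Prod>b\<in>Basis. \<bar>(x - a) \<bullet> b\<bar> ^ \<alpha> b)"
        by (simp add: m_def abs_prod power_abs)
      also have "\<dots> \<le> (\<Prod>b\<in>Basis. ?s ^ \<alpha> b)"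
        by (intro prod_mono conjI power_mono) (auto simp: Basis_le_norm)
      also have "\<dots> = ?s ^ j * ?s\<^sup>2"
        by (simp add: power_sum[symmetric] deg_def[symmetric] j power_add power2_eq_square)
      also have "\<dots> \<le> \<rho> ^ j * ?s\<^sup>2"
        using x by (intro mult_right_mono power_mono) auto
      also have "\<dots> = \<rho> ^ deg \<alpha> * (?s\<^sup>2 / \<rho>\<^sup>2)"
        using \<rho> by (simp add: j power_add power2_eq_square)
      finally have "\<bar>m x \<alpha>\<bar> * \<bar>d \<alpha>\<bar> \<le> \<rho> ^ deg \<alpha> * (?s\<^sup>2 / \<rho>\<^sup>2) * \<bar>d \<alpha>\<bar>"
        by (rule mult_right_mono) simp
      then show ?thesis
        using \<rho> by (simp add: abs_mult power_abs mult_ac)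
    qed
    have abs': "(\<lambda>\<alpha>. norm (\<rho> ^ deg \<alpha> * d \<alpha>)) summable_on (I - F)"
      by (rule summable_on_subset_banach[OF abs]) auto
    have up: "((\<lambda>\<alpha>. norm (\<rho> ^ deg \<alpha> * d \<alpha>) * (?s\<^sup>2 / \<rho>\<^sup>2)) has_sum (K * ?s\<^sup>2)) (I - F)"
      using has_sum_cmult_left[OF has_sum_infsum[OF abs'], of "?s\<^sup>2 / \<rho>\<^sup>2"] by (simp add: K_def)
    have "l (f x) - (d (\<lambda>_. 0) + L (x - a)) \<le> K * ?s\<^sup>2"
      by (rule has_sum_mono[OF rest up]) (use bnd in \<open>fastforce simp: abs_le_iff\<close>)
    moreover
    have neg: "((\<lambda>\<alpha>. - (m x \<alpha> * d \<alpha>)) has_sum - (l (f x) - (d (\<lambda>_. 0) + L (x - a)))) (I - F)"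
      by (simp only: has_sum_uminus minus_minus rest)
    have "- (l (f x) - (d (\<lambda>_. 0) + L (x - a))) \<le> K * ?s\<^sup>2"
      by (rule has_sum_mono[OF neg up]) (use bnd in \<open>fastforce simp: abs_le_iff\<close>)
    ultimately show ?thesis
      by (simp add: abs_le_iff)
  qed
  have La: "L 0 = 0"
    by (simp add: L_def)
  have fa: "l (f a) = d (\<lambda>_. 0)"
    using main[of a] \<rho> by (simp add: La)
  have "((\<lambda>x. l (f x)) has_derivative L) (at a)"
  proof (rule has_derivative_if_quadratic_error)
    show "bounded_linear L"
      unfolding L_def by (intro bounded_linear_sum bounded_linear_mult_left[THEN bounded_linear_compose]
          bounded_linear_inner_left)
    have "norm (l (f x) - l (f a) - L (x - a)) \<le> K * (norm (x - a))\<^sup>2" if "dist x a < \<rho>" for x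
      using main[of x] that by (simp add: fa dist_norm diff_diff_eq)
    then show "\<forall>\<^sub>F x in nhds a. norm (l (f x) - l (f a) - L (x - a)) \<le> K * (norm (x - a))\<^sup>2"
      unfolding eventually_nhds_metric using \<rho> by blast
  qed
  then show ?thesis
    by (auto simp: differentiable_def)
qed

section \<open>Holomorphic maps and the differentiability of their first derivatives\<close>

lemma scaleR_eq_of_real_mult: "t *\<^sub>R v = of_real t *s v" for v :: "complex^'n"
  by (simp add: vec_eq_iff scaleR_conv_of_real[where 'a=complex])

text \<open>Taylor's formula with the second derivative bounded by Cauchy's inequality on discs of
  radius r / 4, where 2 M / (r / 4)^2 = 32 M / r^2. The bound depends on f only through M and is
  thus uniform over a family of functions with a common bound.\<close>

lemma complex_difference_quotient_bound:
  assumes f: "f holomorphic_on ball 0 r" and bound: "\<And>z. z \<in> ball 0 r \<Longrightarrow> norm (f z) \<le> M"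
    and z: "norm z \<le> r / 4" "z \<noteq> 0" and r: "r > 0"
  shows "norm ((f z - f 0) / z - deriv f 0) \<le> 32 * M / r\<^sup>2 * norm z"
proof -
  let ?f = "\<lambda>i. (deriv ^^ i) f"
  have B: "norm (?f (Suc 1) x) \<le> 32 * M / r\<^sup>2" if x: "x \<in> cball 0 (r / 4)" for x
  proof -
    have sub: "cball x (r / 4) \<subseteq> ball 0 r"
    proof
      fix y assume "y \<in> cball x (r / 4)"
      then have "norm y \<le> norm x + r / 4"
        by (metis add.commute add_mono_thms_linordered_semiring(2) diff_add_cancel dist_commute dist_norm
            mem_cball norm_triangle_ineq order_trans)
      then show "y \<in> ball 0 r"
        using x r by simp
    qed
    have "norm (?f 2 x) \<le> fact 2 * M / (r / 4) ^ 2"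
    proof (rule Cauchy_inequality)
      show "f holomorphic_on ball x (r / 4)"
        using sub by (intro holomorphic_on_subset[OF f]) auto
      show "continuous_on (cball x (r / 4)) f"
        using sub by (intro holomorphic_on_imp_continuous_on holomorphic_on_subset[OF f])
      show "norm (f y) \<le> M" if "norm (x - y) = r / 4" for y
        using sub that by (intro bound) (auto simp: dist_norm)
    qed (use r in auto)
    also have "\<dots> = 32 * M / r\<^sup>2"
      by (simp add: power_divide fact_2)
    finally show ?thesis
      by (simp only: numeral_2_eq_2 One_nat_def)
  qed
  have D: "(?f i has_field_derivative ?f (Suc i) x) (at x within cball 0 (r / 4))"
    if "x \<in> cball 0 (r / 4)" for i x
  proof -
    have "?f i holomorphic_on ball 0 r"
      by (rule holomorphic_higher_deriv[OF f open_ball])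
    moreover have "x \<in> ball 0 r"
      using that r by auto
    ultimately have "(?f i has_field_derivative deriv (?f i) x) (at x)"
      using holomorphic_derivI[OF _ open_ball] by blast
    then show ?thesis
      by (simp add: has_field_derivative_at_within)
  qed
  have "norm (?f 0 z - (\<Sum>i\<le>1. ?f i 0 * (z - 0) ^ i / fact i)) \<le>
      32 * M / r\<^sup>2 * norm (z - 0) ^ Suc 1 / fact 1"
    by (rule complex_Taylor[OF convex_cball[of 0 "r / 4"], where f="?f"]) (use B D z r in auto)
  then have *: "norm (f z - f 0 - deriv f 0 * z) \<le> 32 * M / r\<^sup>2 * norm z * norm z"
    by (simp add: diff_diff_eq power2_eq_square mult_ac)
  have "(f z - f 0) / z - deriv f 0 = (f z - f 0 - deriv f 0 * z) / z"
    using z(2) by (simp add: field_simps)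
  then have "norm ((f z - f 0) / z - deriv f 0) = norm (f z - f 0 - deriv f 0 * z) / norm z"
    by (simp add: norm_divide)
  also have "\<dots> \<le> 32 * M / r\<^sup>2 * norm z"
    using * z(2) by (simp add: divide_le_eq)
  finally show ?thesis .
qed

lemma holomorphic_map_has_derivative:
  assumes "holomorphic_map_on \<psi> S" "y \<in> S"
  shows "(\<psi> has_derivative frechet_derivative \<psi> (at y)) (at y)"
    "frechet_derivative \<psi> (at y) (a *s v) = a *s frechet_derivative \<psi> (at y) v"
proof -
  obtain D where D: "(\<psi> has_derivative D) (at y)" "\<forall>a v. D (a *s v) = a *s D v"
    using assms by (auto simp: holomorphic_map_on_def)
  moreover have "frechet_derivative \<psi> (at y) = D"
    using frechet_derivative_at[OF D(1)] by simp
  ultimately show "(\<psi> has_derivative frechet_derivative \<psi> (at y)) (at y)"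
    "frechet_derivative \<psi> (at y) (a *s v) = a *s frechet_derivative \<psi> (at y) v"
    by auto
qed

lemma has_derivative_complex_line:
  "((\<lambda>s. y + s *s v) has_derivative (\<lambda>h. h *s v)) F" for v :: "complex^'n"
proof -
  have "bounded_linear (\<lambda>h. h *s v)"
    by (rule bounded_linear_intro[where K="norm v"])
      (auto simp: vec_eq_iff algebra_simps norm_vector_scalar)
  then show ?thesis
    using has_derivative_add[OF has_derivative_const bounded_linear_imp_has_derivative] by fastforce
qed

text \<open>On a complex line the complex linear derivative reduces to multiplication by a scalar,
  which brings in the theory of one variable.\<close>

lemma holomorphic_map_line:
  assumes \<psi>: "holomorphic_map_on \<psi> S" and y: "y + s *s v \<in> S"
  shows "((\<lambda>s. \<psi> (y + s *s v) $ k) has_field_derivative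
    frechet_derivative \<psi> (at (y + s *s v)) v $ k) (at s)"
proof -
  have "((\<lambda>s. \<psi> (y + s *s v)) has_derivative (\<lambda>h. frechet_derivative \<psi> (at (y + s *s v)) (h *s v))) (at s)"
    by (rule has_derivative_compose[OF has_derivative_complex_line holomorphic_map_has_derivative(1)[OF \<psi> y]])
  then have "((\<lambda>s. \<psi> (y + s *s v) $ k) has_derivative
      (\<lambda>h. frechet_derivative \<psi> (at (y + s *s v)) (h *s v) $ k)) (at s)"
    by (rule bounded_linear.has_derivative[OF bounded_linear_vec_nth])
  then show ?thesis
    by (simp add: has_field_derivative_def holomorphic_map_has_derivative(2)[OF \<psi> y] mult_commute_abs)
qed

text \<open>The derivative in the direction \<open>e\<close> is the uniform limit of difference quotients along a line,
  which are holomorphic.\<close>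

lemma holomorphic_map_derivative_differentiable:
  fixes \<psi> :: "complex^'n \<Rightarrow> complex^'m"
  assumes \<psi>: "holomorphic_map_on \<psi> S" and S: "open S" and y: "y \<in> S"
  shows "(\<lambda>t :: real. frechet_derivative \<psi> (at (y + t *\<^sub>R v)) e $ k) differentiable (at 0)"
proof -
  obtain \<epsilon> where \<epsilon>: "\<epsilon> > 0" "cball y \<epsilon> \<subseteq> S"
    using S y open_contains_cball by blast
  \<comment> \<open>This radius keeps y + s v + u e in the ball for all s and u of modulus at most
    r; the summand 1 excludes a zero denominator.\<close>
  define r where "r = \<epsilon> / (norm v + norm e + 1)"
  have pos: "norm v + norm e + 1 > 0"
    by (simp add: add_nonneg_pos)
  have r: "r > 0"
    using \<epsilon>(1) pos by (simp add: r_def)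
  have in_cball: "y + s *s v + u *s e \<in> cball y \<epsilon>" if "norm s \<le> r" "norm u \<le> r" for s u
  proof -
    have "norm (s *s v + u *s e) \<le> norm s * norm v + norm u * norm e"
      by (metis norm_triangle_ineq norm_vector_scalar)
    also have "\<dots> \<le> r * norm v + r * norm e"
      using that by (intro add_mono mult_right_mono) auto
    also have "\<dots> \<le> r * (norm v + norm e + 1)"
      using r by (simp add: algebra_simps)
    also have "\<dots> = \<epsilon>"
      using pos by (simp add: r_def)
    finally have "norm (s *s v + u *s e) \<le> \<epsilon>" .
    moreover have "dist y (y + s *s v + u *s e) = norm (s *s v + u *s e)"
      by (metis add.assoc add_diff_cancel_left' dist_commute dist_norm)
    ultimately show ?thesis
      by simp
  qed
  \<comment> \<open>The directional derivative \<open>g\<close> at s is the u-derivative of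
    \<open>\<Phi>\<close> at u = 0. In each variable separately \<open>\<Phi>\<close> is
    holomorphic, with one bound M for all.\<close>
  define \<Phi> where "\<Phi> s u = \<psi> (y + s *s v + u *s e) $ k" for s u
  define g where "g s = frechet_derivative \<psi> (at (y + s *s v)) e $ k" for s
  have "continuous_on (cball y \<epsilon>) \<psi>"
    using \<epsilon>(2) holomorphic_map_has_derivative(1)[OF \<psi>]
    by (metis continuous_at_imp_continuous_on has_derivative_continuous subsetD)
  then have "compact (\<psi> ` cball y \<epsilon>)"
    using compact_cball by (rule compact_continuous_image)
  then obtain M where M: "\<And>x. x \<in> cball y \<epsilon> \<Longrightarrow> norm (\<psi> x) \<le> M"
    by (meson bounded_iff compact_imp_bounded image_eqI)
  have bound: "norm (\<Phi> s u) \<le> M" if "norm s \<le> r" "norm u \<le> r" for s u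
    using Finite_Cartesian_Product.norm_nth_le order_trans[OF _ M[OF in_cball[OF that]]]
    unfolding \<Phi>_def by blast
  have hol1: "(\<lambda>s. \<Phi> s u) holomorphic_on ball 0 r" if u: "norm u \<le> r" for u
  proof (rule holomorphic_onI)
    fix s :: complex assume "s \<in> ball 0 r"
    then have "y + u *s e + s *s v \<in> S"
      using in_cball[of s u] u \<epsilon>(2) by (auto simp: add_ac)
    from holomorphic_map_line[OF \<psi> this, of k]
    have "(\<lambda>s. \<Phi> s u) field_differentiable (at s)"
      unfolding field_differentiable_def \<Phi>_def by (auto simp: add_ac)
    then show "(\<lambda>s. \<Phi> s u) field_differentiable (at s within ball 0 r)"
      by (rule field_differentiable_at_within)
  qed
  have der2: "(\<Phi> s has_field_derivative frechet_derivative \<psi> (at (y + s *s v + u *s e)) e $ k) (at u)"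
    if "norm s \<le> r" "norm u \<le> r" for s u
    using holomorphic_map_line[OF \<psi>, of "y + s *s v" u e k] in_cball[OF that] \<epsilon>(2)
    unfolding \<Phi>_def by blast
  have hol2: "\<Phi> s holomorphic_on ball 0 r" if s: "norm s \<le> r" for s
    unfolding holomorphic_on_def field_differentiable_def
    using der2[OF s] has_field_derivative_at_within by (metis less_imp_le mem_ball_0)
  have g: "deriv (\<Phi> s) 0 = g s" if "norm s \<le> r" for s
    using DERIV_imp_deriv[OF der2[OF that, of 0]] r by (simp add: g_def)
  \<comment> \<open>Nonzero increments that tend to 0 and stay in the disc of radius r / 4, where
    the estimate for difference quotients holds.\<close>
  define w where "w n = (of_real (r / 4 / real (Suc n)) :: complex)" for n
  have w: "w n \<noteq> 0" "norm (w n) \<le> r / 4" "norm (w n) = r / 4 / real (Suc n)" for n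
  proof -
    show "norm (w n) = r / 4 / real (Suc n)"
      using r unfolding w_def by (subst norm_of_real) simp
    then show "norm (w n) \<le> r / 4"
      using r by (simp add: divide_le_eq)
    show "w n \<noteq> 0"
      using r unfolding w_def by (simp del: of_real_divide)
  qed
  have "g holomorphic_on ball 0 r"
  proof (rule holomorphic_uniform_sequence[OF open_ball])
    show "(\<lambda>s. (\<Phi> s (w n) - \<Phi> s 0) / w n) holomorphic_on ball 0 r" for n
    proof -
      have "norm (w n) \<le> r"
        using w(2)[of n] r by linarith
      then show ?thesis
        using w(1)[of n] r by (intro holomorphic_intros hol1) auto
    qed
    fix x assume "x \<in> ball (0::complex) r"
    then obtain d where d: "d > 0" "cball x d \<subseteq> ball 0 r"
      using open_contains_cball open_ball by blast
    have "uniform_limit (cball x d) (\<lambda>n s. (\<Phi> s (w n) - \<Phi> s 0) / w n) g sequentially"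
    proof (rule uniform_limitI)
      fix \<delta> :: real assume "\<delta> > 0"
      have "(\<lambda>n. 32 * M / r\<^sup>2 * (r / 4 / real (Suc n))) \<longlonglongrightarrow> 32 * M / r\<^sup>2 * 0"
        by (intro tendsto_mult tendsto_const LIMSEQ_Suc[OF lim_const_over_n])
      then have "\<forall>\<^sub>F n in sequentially. 32 * M / r\<^sup>2 * (r / 4 / real (Suc n)) < \<delta>"
        using \<open>\<delta> > 0\<close> by (intro order_tendstoD(2)) auto
      then show "\<forall>\<^sub>F n in sequentially. \<forall>s\<in>cball x d. dist ((\<Phi> s (w n) - \<Phi> s 0) / w n) (g s) < \<delta>"
      proof eventually_elim
        case (elim n)
        show ?case
        proof
          fix s assume "s \<in> cball x d"
          then have s: "norm s \<le> r"
            using d(2) by (auto simp: subset_iff less_imp_le)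
          have "norm ((\<Phi> s (w n) - \<Phi> s 0) / w n - deriv (\<Phi> s) 0) \<le> 32 * M / r\<^sup>2 * norm (w n)"
            by (rule complex_difference_quotient_bound[OF hol2[OF s]]) (use bound[OF s] w(1,2) r in auto)
          then show "dist ((\<Phi> s (w n) - \<Phi> s 0) / w n) (g s) < \<delta>"
            using elim unfolding w(3) g[OF s] dist_norm by linarith
        qed
      qed
    qed
    then show "\<exists>d>0. cball x d \<subseteq> ball 0 r \<and>
        uniform_limit (cball x d) (\<lambda>n s. (\<Phi> s (w n) - \<Phi> s 0) / w n) g sequentially"
      using d by blast
  qed
  from holomorphic_derivI[OF this open_ball, of 0]
  have "(g has_field_derivative deriv g 0) (at (of_real 0))"
    using r by simp
  then have "((\<lambda>t. g (of_real t)) has_derivative (\<lambda>h. deriv g 0 * of_real h)) (at 0)"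
    unfolding has_field_derivative_def
    by (intro has_derivative_compose[where f="of_real" and g=g]
        bounded_linear_imp_has_derivative[OF bounded_linear_of_real])
  then show ?thesis
    unfolding g_def differentiable_def scaleR_eq_of_real_mult by auto
qed

section \<open>Tangent spaces of a complex manifold\<close>

lemma matrix_of_complex_linear:
  fixes f :: "complex^'n \<Rightarrow> complex^'m"
  assumes add: "\<And>v w. f (v + w) = f v + f w" and scale: "\<And>a v. f (a *s v) = a *s f v"
  shows "matrix f *v v = f v"
proof -
  have "Vector_Spaces.linear (*s) (*s) f"
    by (unfold_locales) (simp_all add: add scale vec_eq_iff algebra_simps)
  then show ?thesis
    by (rule matrix_works)
qed

lemma curve_at_eventually:
  assumes "curve_at \<A> p \<gamma>" "(U, e) \<in> \<A>" "p \<in> U"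
  shows "\<forall>\<^sub>F t in nhds 0. \<gamma> t \<in> U"
    "((e \<circ> \<gamma>) has_vector_derivative velocity \<A> \<gamma> (U, e)) (at 0)"
  using assms by (auto simp: curve_at_def velocity_def vector_derivative_works[symmetric])

text \<open>The differential is a derivative only within the image of the chart domain. The
  coordinates of the curve stay in that image for parameters near 0, so the chain rule within a set
  is enough.\<close>

lemma has_differential_along_curve:
  fixes \<A> :: "('p, 'e::euclidean_space) chart set" and f :: "'p \<Rightarrow> 'b::real_normed_vector"
  assumes f: "has_differential \<A> f \<alpha>" and \<gamma>: "curve_at \<A> p \<gamma>"
    and chart: "(U, e) \<in> \<A>" "p \<in> U" "inj_on e U"
  shows "((f \<circ> \<gamma>) has_vector_derivative \<alpha> p (velocity \<A> \<gamma>)) (at 0)"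
proof -
  let ?v = "velocity \<A> \<gamma>"
  obtain D where D: "((f \<circ> inv_into U e) has_derivative D) (at (e p) within e ` U)"
    and \<alpha>: "\<forall>v\<in>tangent_space \<A> p. \<alpha> p v = D (v (U, e))"
    using f chart(1,2) unfolding has_differential_def by blast
  have \<alpha>v: "\<alpha> p ?v = D (?v (U, e))"
    using \<alpha> \<gamma> by (simp add: tangent_space_def)
  have \<gamma>0: "\<gamma> 0 = p"
    using \<gamma> by (simp add: curve_at_def)
  obtain S where S: "open S" "0 \<in> S" "\<And>t. t \<in> S \<Longrightarrow> \<gamma> t \<in> U"
    using curve_at_eventually(1)[OF \<gamma> chart(1,2)] by (auto simp: eventually_nhds)
  have "((e \<circ> \<gamma>) has_derivative (\<lambda>t. t *\<^sub>R ?v (U, e))) (at 0 within S)"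
    using curve_at_eventually(2)[OF \<gamma> chart(1,2)]
    by (simp add: has_vector_derivative_def has_derivative_at_withinI)
  moreover have "((f \<circ> inv_into U e) has_derivative D) (at ((e \<circ> \<gamma>) 0) within (e \<circ> \<gamma>) ` S)"
    by (rule has_derivative_subset[OF D[folded \<gamma>0, unfolded o_apply[of e \<gamma> 0, symmetric]]]) (use S in auto)
  ultimately have "((\<lambda>t. (f \<circ> inv_into U e) ((e \<circ> \<gamma>) t)) has_derivative (\<lambda>t. D (t *\<^sub>R ?v (U, e)))) (at 0 within S)"
    by (rule has_derivative_in_compose)
  then have "((\<lambda>t. (f \<circ> inv_into U e) ((e \<circ> \<gamma>) t)) has_derivative (\<lambda>t. D (t *\<^sub>R ?v (U, e)))) (at 0)"
    by (simp only: at_within_open[OF S(2,1)])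
  then have "((f \<circ> \<gamma>) has_derivative (\<lambda>t. D (t *\<^sub>R ?v (U, e)))) (at 0)"
    by (rule has_derivative_transform_within_open[OF _ S(1,2)]) (simp add: inv_into_f_f[OF chart(3)] S(3))
  then show ?thesis
    using linear_cmul[OF has_derivative_linear[OF D]] by (simp add: has_vector_derivative_def \<alpha>v)
qed

locale complex_mfd =
  fixes M :: "'m topology" and \<A> :: "('m, complex^'n) chart set"
  assumes complex_manifold: "complex_manifold M \<A>"
begin

definition transition :: "('m, complex^'n) chart \<Rightarrow> ('m, complex^'n) chart \<Rightarrow> complex^'n \<Rightarrow> complex^'n" where
  "transition c c' = snd c' \<circ> inv_into (fst c) (snd c)"

lemma chart:
  assumes "(U, z) \<in> \<A>"
  shows "openin M U" "open (z ` U)" "homeomorphic_map (subtopology M U) (top_of_set (z ` U)) z"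
  using complex_manifold assms by (auto simp: complex_manifold_def)

lemma chart_inj: "(U, z) \<in> \<A> \<Longrightarrow> inj_on z U"
  using homeomorphic_imp_injective_map[OF chart(3)] topspace_subtopology_subset[OF openin_subset[OF chart(1)]]
  by metis

lemma chart_open_image:
  assumes c: "(U, z) \<in> \<A>" and W: "openin M W"
  shows "open (z ` (U \<inter> W))"
proof -
  have "openin (subtopology M U) (U \<inter> W)"
    using openin_subtopology_Int2[OF W, of U] by simp
  moreover have "U \<inter> W \<subseteq> topspace (subtopology M U)"
    using openin_subset[OF chart(1)[OF c]] by auto
  ultimately have "openin (top_of_set (z ` U)) (z ` (U \<inter> W))"
    using homeomorphic_map_openness[OF chart(3)[OF c]] by blast
  then show ?thesis
    using chart(2)[OF c] openin_open_trans by blast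
qed

lemma chart_open_preimage:
  assumes c: "(U, z) \<in> \<A>" and B: "open B"
  shows "openin M {x \<in> U. z x \<in> B}"
proof -
  have "continuous_map (subtopology M U) (top_of_set (z ` U)) z"
    using chart(3)[OF c] by (rule homeomorphic_imp_continuous_map)
  then have "continuous_map (subtopology M U) euclidean z"
    by (rule continuous_map_into_fulltopology)
  then have "openin (subtopology M U) {x \<in> topspace (subtopology M U). z x \<in> B}"
    using B by (auto simp: continuous_map_def)
  then have "openin (subtopology M U) {x \<in> U. z x \<in> B}"
    unfolding topspace_subtopology_subset[OF openin_subset[OF chart(1)[OF c]]] .
  then show ?thesis
    using chart(1)[OF c] by (rule openin_trans_full)
qed

lemma transition_holomorphic:
  assumes "(U, z) \<in> \<A>" "(W, w) \<in> \<A>"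
  shows "holomorphic_map_on (transition (U, z) (W, w)) (z ` (U \<inter> W))"
proof -
  have "\<forall>(U, z)\<in>\<A>. \<forall>(W, w)\<in>\<A>. holomorphic_map_on (w \<circ> inv_into U z) (z ` (U \<inter> W))"
    using complex_manifold unfolding complex_manifold_def by blast
  from bspec[OF bspec[OF this assms(1), unfolded case_prod_conv] assms(2)] show ?thesis
    by (simp only: case_prod_conv transition_def fst_conv snd_conv)
qed

abbreviation dtransition where
  "dtransition c c' x \<equiv> frechet_derivative (transition c c') (at (snd c x))"

lemma dtransition:
  assumes "(U, z) \<in> \<A>" "(W, w) \<in> \<A>" "x \<in> U" "x \<in> W"
  shows "(transition (U, z) (W, w) has_derivative dtransition (U, z) (W, w) x) (at (z x))"
    "dtransition (U, z) (W, w) x (a *s v) = a *s dtransition (U, z) (W, w) x v"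
    "dtransition (U, z) (W, w) x (v + v') = dtransition (U, z) (W, w) x v + dtransition (U, z) (W, w) x v'"
proof -
  have x: "z x \<in> z ` (U \<inter> W)"
    using assms by blast
  show 1: "(transition (U, z) (W, w) has_derivative dtransition (U, z) (W, w) x) (at (z x))"
    using holomorphic_map_has_derivative(1)[OF transition_holomorphic[OF assms(1,2)] x] by simp
  show "dtransition (U, z) (W, w) x (a *s v) = a *s dtransition (U, z) (W, w) x v"
    using holomorphic_map_has_derivative(2)[OF transition_holomorphic[OF assms(1,2)] x] by simp
  show "dtransition (U, z) (W, w) x (v + v') = dtransition (U, z) (W, w) x v + dtransition (U, z) (W, w) x v'"
    using linear_add[OF has_derivative_linear[OF 1]] by simp
qed

text \<open>Where the coordinate line has left the chart image, \<open>inv_into\<close> returns an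
  arbitrary value; hence the restriction to parameters near 0 in
  \<open>chart_line_eventually\<close>.\<close>

definition chart_line :: "('m, complex^'n) chart \<Rightarrow> 'm \<Rightarrow> complex^'n \<Rightarrow> real \<Rightarrow> 'm" where
  "chart_line c x v t = inv_into (fst c) (snd c) (snd c x + t *\<^sub>R v)"

lemma eventually_line_in_open:
  fixes a v :: "complex^'n"
  assumes "open S" "a \<in> S"
  shows "\<forall>\<^sub>F t :: real in nhds 0. a + t *\<^sub>R v \<in> S"
proof -
  have "((\<lambda>t. a + t *\<^sub>R v) \<longlongrightarrow> a + 0 *\<^sub>R v) (nhds 0)"
    by (intro tendsto_intros filterlim_ident)
  then show ?thesis
    using assms by (simp add: topological_tendstoD)
qed

lemma chart_line_eventually:
  assumes c: "(U, z) \<in> \<A>" "x \<in> U" and W: "openin M W" "x \<in> W"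
  shows "\<forall>\<^sub>F t in nhds 0. chart_line (U, z) x v t \<in> U \<inter> W \<and> z (chart_line (U, z) x v t) = z x + t *\<^sub>R v"
proof -
  have "\<forall>\<^sub>F t in nhds 0. z x + t *\<^sub>R v \<in> z ` (U \<inter> W)"
    by (rule eventually_line_in_open[OF chart_open_image[OF c(1) W(1)]]) (use c W in auto)
  then show ?thesis
  proof eventually_elim
    case (elim t)
    then obtain x' where "x' \<in> U \<inter> W" "z x + t *\<^sub>R v = z x'"
      by blast
    then show ?case
      using chart_inj[OF c(1)] by (simp add: chart_line_def)
  qed
qed

lemma chart_line_0:
  assumes "(U, z) \<in> \<A>" "x \<in> U"
  shows "chart_line (U, z) x v 0 = x"
  using chart_inj[OF assms(1)] assms(2) by (simp add: chart_line_def)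

lemma chart_line_has_vector_derivative:
  assumes "(U, z) \<in> \<A>" "(W, w) \<in> \<A>" "x \<in> U" "x \<in> W"
  shows "((w \<circ> chart_line (U, z) x v) has_vector_derivative dtransition (U, z) (W, w) x v) (at 0)"
proof -
  have "((\<lambda>t. z x + t *\<^sub>R v) has_derivative (\<lambda>t. t *\<^sub>R v)) (at 0)"
    by (auto intro!: derivative_eq_intros)
  moreover have "(transition (U, z) (W, w) has_derivative dtransition (U, z) (W, w) x) (at (z x + 0 *\<^sub>R v))"
    using dtransition(1)[OF assms] by simp
  ultimately have "((\<lambda>t. transition (U, z) (W, w) (z x + t *\<^sub>R v)) has_derivative
      (\<lambda>t. dtransition (U, z) (W, w) x (t *\<^sub>R v))) (at 0)"
    by (rule has_derivative_compose)
  moreover have "(\<lambda>t. transition (U, z) (W, w) (z x + t *\<^sub>R v)) = w \<circ> chart_line (U, z) x v"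
    by (simp add: fun_eq_iff transition_def chart_line_def)
  ultimately show ?thesis
    using linear_cmul[OF has_derivative_linear[OF dtransition(1)[OF assms]]]
    by (simp add: has_vector_derivative_def)
qed

lemma curve_at_chart_line:
  assumes c: "(U, z) \<in> \<A>" "x \<in> U"
  shows "curve_at \<A> x (chart_line (U, z) x v)"
  unfolding curve_at_def
proof (intro conjI ballI, safe)
  show "chart_line (U, z) x v 0 = x"
    by (rule chart_line_0[OF c])
  fix W w assume W: "(W, w) \<in> \<A>" "x \<in> W"
  show "\<forall>\<^sub>F t in nhds 0. chart_line (U, z) x v t \<in> W"
    using chart_line_eventually[OF c chart(1)[OF W(1)] W(2), of v] by (rule eventually_mono) auto
  show "(w \<circ> chart_line (U, z) x v) differentiable (at 0)"
    using chart_line_has_vector_derivative[OF c(1) W(1) c(2) W(2)] by (rule differentiableI_vector)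
qed

text \<open>The tangent vector with components v in the chart c, in the encoding of
  \<open>velocity\<close>: another chart at x sees v through the derivative of the transition map,
  and all remaining entries are 0.\<close>

definition coord_vector :: "('m, complex^'n) chart \<Rightarrow> 'm \<Rightarrow> complex^'n \<Rightarrow> ('m, complex^'n) tvec" where
  "coord_vector c x v = (\<lambda>c'. if c' \<in> \<A> \<and> x \<in> fst c' then dtransition c c' x v else 0)"

lemma velocity_chart_line:
  assumes c: "(U, z) \<in> \<A>" "x \<in> U"
  shows "velocity \<A> (chart_line (U, z) x v) = coord_vector (U, z) x v"
proof
  fix c' :: "('m, complex^'n) chart"
  obtain W w where c': "c' = (W, w)"
    by fastforce
  show "velocity \<A> (chart_line (U, z) x v) c' = coord_vector (U, z) x v c'"
    using vector_derivative_at[OF chart_line_has_vector_derivative[OF c(1) _ c(2), of W w v]]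
    by (auto simp: c' velocity_def coord_vector_def chart_line_0[OF c])
qed

text \<open>By the chain rule through transition maps, the velocity in one chart determines those in
  all others. This identifies the tangent space with the columns.\<close>

lemma velocity_curve:
  assumes c: "(U, z) \<in> \<A>" "x \<in> U" and \<gamma>: "curve_at \<A> x \<gamma>"
  shows "velocity \<A> \<gamma> = coord_vector (U, z) x (velocity \<A> \<gamma> (U, z))"
proof
  fix c' :: "('m, complex^'n) chart"
  obtain W w where c': "c' = (W, w)"
    by fastforce
  let ?v = "velocity \<A> \<gamma> (U, z)"
  have \<gamma>0: "\<gamma> 0 = x"
    using \<gamma> by (simp add: curve_at_def)
  have "velocity \<A> \<gamma> (W, w) = dtransition (U, z) (W, w) x ?v" if W: "(W, w) \<in> \<A>" "x \<in> W"
  proof -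
    have "((z \<circ> \<gamma>) has_derivative (\<lambda>t. t *\<^sub>R ?v)) (at 0)"
      using curve_at_eventually(2)[OF \<gamma> c] by (simp add: has_vector_derivative_def)
    moreover have "(transition (U, z) (W, w) has_derivative dtransition (U, z) (W, w) x) (at ((z \<circ> \<gamma>) 0))"
      using dtransition(1)[OF c(1) W(1) c(2) W(2)] by (simp add: \<gamma>0)
    ultimately have D: "((\<lambda>t. transition (U, z) (W, w) ((z \<circ> \<gamma>) t)) has_derivative
        (\<lambda>t. dtransition (U, z) (W, w) x (t *\<^sub>R ?v))) (at 0)"
      by (rule has_derivative_compose)
    obtain S where S: "open S" "0 \<in> S" "\<And>t. t \<in> S \<Longrightarrow> \<gamma> t \<in> U"
      using curve_at_eventually(1)[OF \<gamma> c] by (auto simp: eventually_nhds)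
    have "((w \<circ> \<gamma>) has_derivative (\<lambda>t. dtransition (U, z) (W, w) x (t *\<^sub>R ?v))) (at 0)"
      by (rule has_derivative_transform_within_open[OF D S(1,2)])
        (simp add: transition_def inv_into_f_f[OF chart_inj[OF c(1)]] S(3))
    then have "((w \<circ> \<gamma>) has_vector_derivative dtransition (U, z) (W, w) x ?v) (at 0)"
      using linear_cmul[OF has_derivative_linear[OF dtransition(1)[OF c(1) W(1) c(2) W(2)]]]
      by (simp add: has_vector_derivative_def)
    with curve_at_eventually(2)[OF \<gamma> W] show ?thesis
      by (rule vector_derivative_unique_at)
  qed
  then show "velocity \<A> \<gamma> c' = coord_vector (U, z) x ?v c'"
    by (auto simp: c' coord_vector_def velocity_def \<gamma>0)
qed

lemma tangent_space_eq:
  assumes c: "(U, z) \<in> \<A>" "x \<in> U"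
  shows "tangent_space \<A> x = range (coord_vector (U, z) x)"
proof
  show "tangent_space \<A> x \<subseteq> range (coord_vector (U, z) x)"
    unfolding tangent_space_def using velocity_curve[OF c] by blast
  show "range (coord_vector (U, z) x) \<subseteq> tangent_space \<A> x"
    unfolding tangent_space_def
    using velocity_chart_line[OF c] curve_at_chart_line[OF c] by (metis image_subsetI imageI mem_Collect_eq)
qed

text \<open>Differentiating a coordinate line, on which z is affine near 0, shows that the
  transition from a chart to itself has the identity as derivative.\<close>

lemma coord_vector_chart:
  assumes c: "(U, z) \<in> \<A>" "x \<in> U"
  shows "coord_vector (U, z) x v (U, z) = v"
proof -
  have "velocity \<A> (chart_line (U, z) x v) (U, z) = v"
  proof -
    have D: "((\<lambda>t. z x + t *\<^sub>R v) has_vector_derivative v) (at 0)"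
      by (auto intro!: derivative_eq_intros simp: has_vector_derivative_def)
    obtain S where S: "open S" "0 \<in> S" "\<And>t. t \<in> S \<Longrightarrow> z (chart_line (U, z) x v t) = z x + t *\<^sub>R v"
      using chart_line_eventually[OF c chart(1)[OF c(1)] c(2), of v] by (auto simp: eventually_nhds)
    have "((z \<circ> chart_line (U, z) x v) has_vector_derivative v) (at 0)"
      by (rule has_vector_derivative_transform_within_open[OF D S(1,2)]) (simp add: S(3))
    then show ?thesis
      using c by (simp add: velocity_def chart_line_0[OF c] vector_derivative_at)
  qed
  then show ?thesis
    by (simp add: velocity_chart_line[OF c])
qed

lemma coord_vector_linear:
  assumes c: "(U, z) \<in> \<A>" "x \<in> U"
  shows "coord_vector (U, z) x (v + v') = (\<lambda>c. coord_vector (U, z) x v c + coord_vector (U, z) x v' c)"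
    "coord_vector (U, z) x (a *s v) = cscale a (coord_vector (U, z) x v)"
proof -
  have *: "dtransition (U, z) c x (a *s v) = a *s dtransition (U, z) c x v"
    "dtransition (U, z) c x (v + v') = dtransition (U, z) c x v + dtransition (U, z) c x v'"
    if "c \<in> \<A>" "x \<in> fst c" for c
    using dtransition(2,3)[OF c(1) _ c(2), of "fst c" "snd c"] that by simp_all
  show "coord_vector (U, z) x (v + v') = (\<lambda>c. coord_vector (U, z) x v c + coord_vector (U, z) x v' c)"
    unfolding coord_vector_def by (rule ext) (simp add: *(2) del: snd_conv)
  show "coord_vector (U, z) x (a *s v) = cscale a (coord_vector (U, z) x v)"
    unfolding coord_vector_def cscale_def by (rule ext) (simp add: *(1) del: snd_conv)
qed

lemma tangent_vector_eq:
  assumes c: "(U, z) \<in> \<A>" "x \<in> U" and v: "v \<in> tangent_space \<A> x"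
  shows "v = coord_vector (U, z) x (v (U, z))"
  using v coord_vector_chart[OF c] by (auto simp: tangent_space_eq[OF c])

lemma coord_vector_in_tangent_space:
  "(U, z) \<in> \<A> \<Longrightarrow> x \<in> U \<Longrightarrow> coord_vector (U, z) x v \<in> tangent_space \<A> x"
  by (simp add: tangent_space_eq)

definition jacobian :: "('m, complex^'n) chart \<Rightarrow> ('m, complex^'n) chart \<Rightarrow> 'm \<Rightarrow> complex^'n^'n" where
  "jacobian c c' x = matrix (dtransition c c' x)"

lemma jacobian_vector:
  assumes "(U, z) \<in> \<A>" "(W, w) \<in> \<A>" "x \<in> U" "x \<in> W" "v \<in> tangent_space \<A> x"
  shows "jacobian (U, z) (W, w) x *v v (U, z) = v (W, w)"
proof -
  have "jacobian (U, z) (W, w) x *v v (U, z) = dtransition (U, z) (W, w) x (v (U, z))"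
    unfolding jacobian_def
    by (rule matrix_of_complex_linear) (rule dtransition[OF assms(1-4)])+
  also have "\<dots> = v (W, w)"
    using arg_cong[OF tangent_vector_eq[OF assms(1,3,5)], of "\<lambda>f. f (W, w)"] assms(2,4)
    by (simp add: coord_vector_def)
  finally show ?thesis .
qed

lemma jacobian_inverse:
  assumes "(U, z) \<in> \<A>" "(W, w) \<in> \<A>" "x \<in> U" "x \<in> W"
  shows "jacobian (U, z) (W, w) x ** jacobian (W, w) (U, z) x = mat 1"
proof -
  have "(jacobian (U, z) (W, w) x ** jacobian (W, w) (U, z) x) *v y = mat 1 *v y" for y
  proof -
    let ?v = "coord_vector (W, w) x y"
    have v: "?v \<in> tangent_space \<A> x" "?v (W, w) = y"
      using assms coord_vector_in_tangent_space coord_vector_chart by auto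
    have "jacobian (W, w) (U, z) x *v y = ?v (U, z)"
      using jacobian_vector[OF assms(2,1,4,3) v(1)] by (simp add: v(2))
    then show ?thesis
      using jacobian_vector[OF assms v(1)] by (simp add: v(2) matrix_vector_mul_assoc[symmetric])
  qed
  then show ?thesis
    by (simp add: matrix_eq)
qed

text \<open>A second-order fact about the base: the matrix part of a bundle coordinate changes from
  chart to chart by a Jacobian, and a curve of coframes has to be differentiable in all
  charts.\<close>

lemma jacobian_differentiable:
  assumes "(U, z) \<in> \<A>" "(W, w) \<in> \<A>" "x \<in> U" "x \<in> W"
  shows "(\<lambda>t. jacobian (U, z) (W, w) (chart_line (U, z) x v t)) differentiable (at 0)"
proof (rule differentiable_transform_nhds)
  have "\<forall>\<^sub>F t in nhds 0. z (chart_line (U, z) x v t) = z x + t *\<^sub>R v"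
    using chart_line_eventually[OF assms(1,3) chart(1)[OF assms(1)] assms(3), of v]
    by (rule eventually_mono) auto
  then show "\<forall>\<^sub>F t in nhds 0. matrix (frechet_derivative (transition (U, z) (W, w)) (at (z x + t *\<^sub>R v)))
      = jacobian (U, z) (W, w) (chart_line (U, z) x v t)"
    by (rule eventually_mono) (simp add: jacobian_def)
  have "z x \<in> z ` (U \<inter> W)"
    using assms by blast
  then show "(\<lambda>t. matrix (frechet_derivative (transition (U, z) (W, w)) (at (z x + t *\<^sub>R v))))
      differentiable (at 0)"
    by (intro differentiable_vecI)
      (simp add: matrix_def holomorphic_map_derivative_differentiable[OF transition_holomorphic[OF assms(1,2)]
          chart_open_image[OF assms(1) chart(1)[OF assms(2)]]])
qed

end

section \<open>Frames of a Kaehler metric\<close>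

lemma differentiable_Pair:
  assumes "f differentiable (at x)" "g differentiable (at x)"
  shows "(\<lambda>t. (f t, g t)) differentiable (at x)"
proof -
  obtain f' g' where "(f has_derivative f') (at x)" "(g has_derivative g') (at x)"
    using assms unfolding differentiable_def by blast
  from has_derivative_Pair[OF this] show ?thesis
    unfolding differentiable_def by blast
qed

lemma complex_linear_functional:
  fixes f :: "complex^'n \<Rightarrow> complex"
  assumes add: "\<And>v w. f (v + w) = f v + f w" and scale: "\<And>a v. f (a *s v) = a * f v"
  shows "f v = (\<Sum>k\<in>UNIV. v $ k * f (axis k 1))"
proof -
  have zero: "f 0 = 0"
    using scale[of 0 0] by simp
  have "f (\<Sum>k\<in>K. v $ k *s axis k 1) = (\<Sum>k\<in>K. v $ k * f (axis k 1))" for K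
    by (induction K rule: infinite_finite_induct) (simp_all add: zero add scale)
  from this[of UNIV] show ?thesis
    by (simp only: basis_expansion)
qed

text \<open>A real bilinear form \<open>b\<close> that is invariant under \<open>\<i>\<close> is the real part of the Hermitian form
  \<open>Q y y' = b y y' - \<i> b y (\<i> y')\<close>.\<close>

lemma hermitian_form_of_real_form:
  fixes b :: "complex^'n \<Rightarrow> complex^'n \<Rightarrow> real"
  assumes add: "\<And>y y' u. b (y + y') u = b y u + b y' u" and scale: "\<And>r y u. b (r *\<^sub>R y) u = r * b y u"
    and sym: "\<And>y u. b y u = b u y" and inv: "\<And>y u. b (\<i> *s y) (\<i> *s u) = b y u"
  defines "X \<equiv> \<chi> j k. of_real (b (axis j 1) (axis k 1)) - \<i> * of_real (b (axis j 1) (\<i> *s axis k 1))"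
  shows "Re (cdot y (X *v y')) = b y y'" and "hermitian X"
proof -
  define Q where "Q y y' = complex_of_real (b y y') - \<i> * of_real (b y (\<i> *s y'))" for y y'
  have ii: "\<i> *s (\<i> *s y) = (-1) *\<^sub>R y" for y :: "complex^'n"
    by (simp add: vec_eq_iff)
  have addR: "b u (y + y') = b u y + b u y'" for u y y'
    using add sym by metis
  have scaleR: "b u (r *\<^sub>R y) = r * b u y" for u r y
    using scale sym by metis
  \<comment> \<open>Invariance under i and i^2 = -1 make multiplication by i skew for b; this is the
    source of the Hermitian symmetry of Q.\<close>
  have swap: "b u (\<i> *s y) = - b (\<i> *s u) y" for u y
    using inv[of u "\<i> *s y"] unfolding ii scaleR by simp
  have Qadd: "Q u (y + y') = Q u y + Q u y'" for u y y'
    by (simp add: Q_def addR vector_add_ldistrib algebra_simps)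
  have Qscale: "Q u (a *s y) = a * Q u y" for u a y
  proof -
    have a: "a *s y = Re a *\<^sub>R y + Im a *\<^sub>R (\<i> *s y)"
      by (simp add: vec_eq_iff complex_eq_iff)
    have ia: "\<i> *s (a *s y) = Re a *\<^sub>R (\<i> *s y) + Im a *\<^sub>R ((-1) *\<^sub>R y)"
      by (simp add: vec_eq_iff complex_eq_iff)
    show ?thesis
      unfolding Q_def ia unfolding a addR scaleR by (simp add: complex_eq_iff algebra_simps)
  qed
  have Qcnj: "Q y' y = cnj (Q y y')" for y y'
    using sym[of y' y] sym[of y' "\<i> *s y"] swap[of y y'] by (simp add: Q_def)
  have X: "X $ j $ k = Q (axis j 1) (axis k 1)" for j k
    by (simp add: X_def Q_def)
  have "Q y y' = cdot y (X *v y')" for y y'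
  proof -
    have "Q y (axis k 1) = (\<Sum>j\<in>UNIV. cnj (y $ j) * X $ j $ k)" for k
    proof -
      have "Q y (axis k 1) = cnj (Q (axis k 1) y)"
        by (rule Qcnj)
      also have "\<dots> = cnj (\<Sum>j\<in>UNIV. y $ j * Q (axis k 1) (axis j 1))"
        by (subst complex_linear_functional[of "Q (axis k 1)"]) (simp_all add: Qadd Qscale)
      also have "\<dots> = (\<Sum>j\<in>UNIV. cnj (y $ j) * cnj (Q (axis k 1) (axis j 1)))"
        by simp
      finally show ?thesis
        by (simp add: X Qcnj[symmetric])
    qed
    moreover have "Q y y' = (\<Sum>k\<in>UNIV. y' $ k * Q y (axis k 1))"
      by (rule complex_linear_functional) (simp_all add: Qadd Qscale)
    ultimately have "Q y y' = (\<Sum>k\<in>UNIV. \<Sum>j\<in>UNIV. y' $ k * (cnj (y $ j) * X $ j $ k))"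
      by (simp add: sum_distrib_left)
    also have "\<dots> = (\<Sum>j\<in>UNIV. \<Sum>k\<in>UNIV. y' $ k * (cnj (y $ j) * X $ j $ k))"
      by (rule sum.swap)
    finally show ?thesis
      by (simp add: cdot_def matrix_vector_mult_def sum_distrib_left mult_ac)
  qed
  from this[of y y'] show "Re (cdot y (X *v y')) = b y y'"
    by (simp add: Q_def flip: \<open>Q y y' = cdot y (X *v y')\<close>)
  show "hermitian X"
    by (simp add: hermitian_def vec_eq_iff ctranspose_nth X Qcnj[symmetric])
qed

lemma matrix_eq_if_Re_cdot_eq:
  fixes A B :: "complex^'n^'n"
  assumes "\<And>y y'. Re (cdot y (A *v y')) = Re (cdot y (B *v y'))"
  shows "A = B"
proof -
  have "A *v y' = B *v y'" for y'
  proof -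
    let ?d = "A *v y' - B *v y'"
    have "?d \<bullet> ?d = 0"
      using assms[of ?d y'] by (simp add: inner_diff_right inner_eq_Re_cdot[symmetric])
    then show ?thesis
      by simp
  qed
  then show ?thesis
    by (simp add: matrix_eq)
qed

locale kaehler_mfd = complex_mfd M \<A> for M :: "'m topology" and \<A> :: "('m, complex^'n) chart set" +
  fixes g :: "'m \<Rightarrow> ('m, complex^'n) tvec \<Rightarrow> ('m, complex^'n) tvec \<Rightarrow> real"
  assumes metric: "riemannian_metric \<A> g"
    and metric_invariant: "\<And>x v w. x \<in> topspace M \<Longrightarrow> v \<in> tangent_space \<A> x \<Longrightarrow> w \<in> tangent_space \<A> x \<Longrightarrow>
      g x (cscale \<i> v) (cscale \<i> w) = g x v w"
begin

definition coord_form :: "('m, complex^'n) chart \<Rightarrow> 'm \<Rightarrow> complex^'n \<Rightarrow> complex^'n \<Rightarrow> real" where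
  "coord_form c x y y' = g x (coord_vector c x y) (coord_vector c x y')"

text \<open>The form g(y, y') - i g(y, i y') on the standard basis: conjugate-linear in the first
  argument, as \<open>cdot\<close> is, with real part g.\<close>

definition gram :: "('m, complex^'n) chart \<Rightarrow> 'm \<Rightarrow> complex^'n^'n" where
  "gram c x = (\<chi> j k. of_real (coord_form c x (axis j 1) (axis k 1))
    - \<i> * of_real (coord_form c x (axis j 1) (\<i> *s axis k 1)))"

lemma metric_at:
  assumes c: "(U, z) \<in> \<A>" "x \<in> U" and v: "v \<in> tangent_space \<A> x" and w: "w \<in> tangent_space \<A> x"
  shows "g x v w = g x w v" "v \<noteq> (\<lambda>_. 0) \<Longrightarrow> g x v v > 0"
    "u \<in> tangent_space \<A> x \<Longrightarrow> g x (\<lambda>c. a *\<^sub>R v c + b *\<^sub>R w c) u = a * g x v u + b * g x w u"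
proof -
  have x: "x \<in> \<Union>(fst ` \<A>)"
    using c by force
  have "\<forall>x\<in>\<Union>(fst ` \<A>). \<forall>v\<in>tangent_space \<A> x. \<forall>w\<in>tangent_space \<A> x.
      g x v w = g x w v \<and> (v \<noteq> (\<lambda>_. 0) \<longrightarrow> g x v v > 0) \<and>
      (\<forall>u\<in>tangent_space \<A> x. \<forall>a b :: real.
        g x (\<lambda>c. a *\<^sub>R v c + b *\<^sub>R w c) u = a * g x v u + b * g x w u)"
    using metric unfolding riemannian_metric_def by (rule conjunct1)
  from bspec[OF bspec[OF bspec[OF this x] v] w]
  show "g x v w = g x w v" "v \<noteq> (\<lambda>_. 0) \<Longrightarrow> g x v v > 0"
    "u \<in> tangent_space \<A> x \<Longrightarrow> g x (\<lambda>c. a *\<^sub>R v c + b *\<^sub>R w c) u = a * g x v u + b * g x w u"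
    by blast+
qed

lemma coord_vector_scaleR:
  assumes c: "(U, z) \<in> \<A>" "x \<in> U"
  shows "coord_vector (U, z) x (r *\<^sub>R v) = (\<lambda>c. r *\<^sub>R coord_vector (U, z) x v c + 0 *\<^sub>R coord_vector (U, z) x v c)"
  by (simp add: scaleR_eq_of_real_mult coord_vector_linear(2)[OF c] cscale_def)

lemma gram_form:
  assumes c: "(U, z) \<in> \<A>" "x \<in> U"
  shows "Re (cdot y (gram (U, z) x *v y')) = coord_form (U, z) x y y'" "hermitian (gram (U, z) x)"
proof -
  note cv = coord_vector_in_tangent_space[OF c]
  have x: "x \<in> topspace M"
    using openin_subset[OF chart(1)[OF c(1)]] c(2) by blast
  have add: "coord_form (U, z) x (y + y') u = coord_form (U, z) x y u + coord_form (U, z) x y' u" for y y' u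
    using metric_at(3)[OF c cv cv cv, of 1 y 1 y' u]
    by (simp add: coord_form_def coord_vector_linear(1)[OF c])
  have scale: "coord_form (U, z) x (r *\<^sub>R y) u = r * coord_form (U, z) x y u" for r y u
    unfolding coord_form_def coord_vector_scaleR[OF c] metric_at(3)[OF c cv cv cv] by simp
  have sym: "coord_form (U, z) x y u = coord_form (U, z) x u y" for y u
    unfolding coord_form_def by (rule metric_at(1)[OF c cv cv])
  have inv: "coord_form (U, z) x (\<i> *s y) (\<i> *s u) = coord_form (U, z) x y u" for y u
    unfolding coord_form_def coord_vector_linear(2)[OF c] by (rule metric_invariant[OF x cv cv])
  show "Re (cdot y (gram (U, z) x *v y')) = coord_form (U, z) x y y'" "hermitian (gram (U, z) x)"
    using hermitian_form_of_real_form[of "coord_form (U, z) x", OF add scale sym inv]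
    unfolding gram_def by blast+
qed

lemma gram_posdef:
  assumes c: "(U, z) \<in> \<A>" "x \<in> U" and y: "y \<noteq> 0"
  shows "0 < Re (cdot y (gram (U, z) x *v y))"
proof -
  have "coord_vector (U, z) x y \<noteq> (\<lambda>_. 0)"
    using coord_vector_chart[OF c, of y] y by auto
  then show ?thesis
    unfolding gram_form(1)[OF c] coord_form_def
    using metric_at(2)[OF c coord_vector_in_tangent_space[OF c] coord_vector_in_tangent_space[OF c]] by blast
qed

text \<open>Each entry is built from bounded linear functionals of the analytic coefficient
  \<open>G\<close> of the metric, evaluated along a line in the coordinates.\<close>

lemma gram_differentiable:
  assumes c: "(U, z) \<in> \<A>" "x \<in> U"
  obtains h where "h differentiable (at 0)" "\<And>t. hermitian (h t)" "h 0 = gram (U, z) x"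
    "\<forall>\<^sub>F t in nhds 0. h t = gram (U, z) (chart_line (U, z) x v t)"
proof -
  obtain G :: "complex^'n \<Rightarrow> (complex^'n) \<Rightarrow>\<^sub>L (complex^'n) \<Rightarrow>\<^sub>L real" where
    an: "real_analytic_on G (z ` U)" and
    G: "\<And>x v w. x \<in> U \<Longrightarrow> v \<in> tangent_space \<A> x \<Longrightarrow> w \<in> tangent_space \<A> x \<Longrightarrow>
        g x v w = blinfun_apply (blinfun_apply (G (z x)) (v (U, z))) (w (U, z))"
    using bspec[OF conjunct2[OF metric[unfolded riemannian_metric_def]] c(1)] by auto
  have form: "coord_form (U, z) x' y y' = blinfun_apply (blinfun_apply (G (z x')) y) y'" if "x' \<in> U" for x' y y'
    using G[OF that coord_vector_in_tangent_space[OF c(1) that] coord_vector_in_tangent_space[OF c(1) that]]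
    by (simp add: coord_form_def coord_vector_chart[OF c(1) that])
  have diffG: "(\<lambda>t. blinfun_apply (blinfun_apply (G (z x + t *\<^sub>R v)) y) y') differentiable (at (0::real))" for y y'
  proof -
    have "bounded_linear (\<lambda>B :: (complex^'n) \<Rightarrow>\<^sub>L (complex^'n) \<Rightarrow>\<^sub>L real. blinfun_apply (blinfun_apply B y) y')"
      by (rule bounded_linear_compose[OF blinfun.bounded_linear_left blinfun.bounded_linear_left])
    from real_analytic_on_linear_differentiable[OF an imageI[OF c(2)] this]
    obtain D where D: "((\<lambda>\<eta>. blinfun_apply (blinfun_apply (G \<eta>) y) y') has_derivative D) (at (z x + 0 *\<^sub>R v))"
      by (auto simp: differentiable_def)
    have "((\<lambda>t. z x + t *\<^sub>R v) has_derivative (\<lambda>t. t *\<^sub>R v)) (at (0::real))"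
      by (auto intro!: derivative_eq_intros)
    from has_derivative_compose[OF this D] show ?thesis
      by (auto simp: differentiable_def)
  qed
  let ?l = "chart_line (U, z) x v"
  \<comment> \<open>The value 0 off the chart domain keeps h Hermitian for every t, as
    \<open>frame_curve\<close> demands; near t = 0 the first case applies.\<close>
  define h where "h t = (if ?l t \<in> U then gram (U, z) (?l t) else 0)" for t
  have ev: "\<forall>\<^sub>F t in nhds 0. ?l t \<in> U \<and> z (?l t) = z x + t *\<^sub>R v"
    using chart_line_eventually[OF c chart(1)[OF c(1)] c(2), of v] by (rule eventually_mono) auto
  have h0: "h 0 = gram (U, z) x"
    using c by (simp add: h_def chart_line_0)
  have "h differentiable (at 0)"
  proof (rule differentiable_transform_nhds)
    let ?G = "\<lambda>t y y'. blinfun_apply (blinfun_apply (G (z x + t *\<^sub>R v)) y) y'"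
    show "(\<lambda>t. (\<chi> j k. complex_of_real (?G t (axis j 1) (axis k 1)) - \<i> * of_real (?G t (axis j 1) (\<i> *s axis k 1)))
        :: complex^'n^'n) differentiable (at 0)"
    proof (rule differentiable_vecI, rule differentiable_vecI)
      fix j k
      show "(\<lambda>t. (\<chi> j k. complex_of_real (?G t (axis j 1) (axis k 1)) - \<i> * of_real (?G t (axis j 1) (\<i> *s axis k 1)))
          $ j $ k) differentiable (at 0)"
        unfolding vec_lambda_beta
        by (intro differentiable_diff differentiable_mult differentiable_const differentiable_of_real diffG)
    qed
    show "\<forall>\<^sub>F t in nhds 0. (\<chi> j k. complex_of_real (?G t (axis j 1) (axis k 1)) - \<i> * of_real (?G t (axis j 1) (\<i> *s axis k 1)))
        = h t"
      using ev by (rule eventually_mono) (simp add: h_def gram_def form)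
  qed
  moreover have "hermitian (h t)" for t
    using gram_form(2)[OF c(1)] by (simp add: h_def) (simp add: hermitian_def vec_eq_iff ctranspose_nth)
  moreover have "\<forall>\<^sub>F t in nhds 0. h t = gram (U, z) (?l t)"
    using ev by (rule eventually_mono) (simp add: h_def)
  ultimately show ?thesis
    using that h0 by blast
qed

definition frame :: "('m, complex^'n) chart \<Rightarrow> 'm \<Rightarrow> complex^'n^'n \<Rightarrow> bool" where
  "frame c x A \<longleftrightarrow> ctranspose A ** A = gram c x"

text \<open>\<open>restrict\<close> matches the extensionality demanded of coframes, so that frames
  and coframes over a point of the chart correspond one to one.\<close>

definition coframe_of :: "('m, complex^'n) chart \<Rightarrow> 'm \<Rightarrow> complex^'n^'n \<Rightarrow> ('m, 'n) coframe" where
  "coframe_of c x A = (x, restrict (\<lambda>v. A *v v c) (tangent_space \<A> x))"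

lemma frame_det: "(U, z) \<in> \<A> \<Longrightarrow> x \<in> U \<Longrightarrow> frame (U, z) x A \<Longrightarrow> det A \<noteq> 0"
  unfolding frame_def using det_frame_nonzero gram_posdef by blast

lemma frame_exists:
  assumes "(U, z) \<in> \<A>" "x \<in> U"
  obtains A where "frame (U, z) x A"
  using posdef_has_frame[OF gram_form(2)[OF assms] gram_posdef[OF assms]] that unfolding frame_def by blast

lemma frame_iff:
  assumes c: "(U, z) \<in> \<A>" "x \<in> U"
  shows "frame (U, z) x A \<longleftrightarrow> (\<forall>y y'. (A *v y) \<bullet> (A *v y') = coord_form (U, z) x y y')"
proof -
  have eq: "(A *v y) \<bullet> (A *v y') = Re (cdot y ((ctranspose A ** A) *v y'))" for y y'
    by (simp add: inner_eq_Re_cdot matrix_vector_mul_assoc[symmetric] cdot_matrix[of y "ctranspose A"] ctranspose_simps)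
  show ?thesis
    unfolding frame_def eq gram_form(1)[OF c, symmetric] using matrix_eq_if_Re_cdot_eq by metis
qed

lemma coframe_of_in_bundle:
  assumes c: "(U, z) \<in> \<A>" "x \<in> U" and A: "frame (U, z) x A"
  shows "coframe_of (U, z) x A \<in> coframe_bundle \<A> g"
proof -
  let ?T = "tangent_space \<A> x" and ?u = "restrict (\<lambda>v. A *v v (U, z)) (tangent_space \<A> x)"
  note T = tangent_space_eq[OF c] and cv = coord_vector_chart[OF c] and lin = coord_vector_linear[OF c]
  have inT: "coord_vector (U, z) x y \<in> ?T" for y
    by (simp add: T)
  have u: "?u (coord_vector (U, z) x y) = A *v y" for y
    by (simp add: inT cv)
  have "bij_betw ?u ?T UNIV"
    unfolding bij_betw_def
  proof
    have "invertible A"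
      using frame_det[OF c A] by (simp add: invertible_det_nz)
    then obtain B where B: "A ** B = mat 1" "B ** A = mat 1"
      by (auto simp: invertible_def)
    show "inj_on ?u ?T"
    proof (rule inj_onI)
      fix v w assume vw: "v \<in> ?T" "w \<in> ?T" "?u v = ?u w"
      then have "B *v (A *v v (U, z)) = B *v (A *v w (U, z))"
        by simp
      then have "v (U, z) = w (U, z)"
        by (simp add: matrix_vector_mul_assoc B)
      then show "v = w"
        using tangent_vector_eq[OF c vw(1)] tangent_vector_eq[OF c vw(2)] by simp
    qed
    have "y \<in> ?u ` ?T" for y
    proof -
      have "?u (coord_vector (U, z) x (B *v y)) = y"
        unfolding u by (simp add: matrix_vector_mul_assoc B)
      then show ?thesis
        by (rule image_eqI[OF sym inT])
    qed
    then show "?u ` ?T = UNIV"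
      by blast
  qed
  moreover have "?u (\<lambda>c. v c + w c) = ?u v + ?u w \<and> (\<forall>a. ?u (cscale a v) = a *s ?u v) \<and> g x v w = ?u v \<bullet> ?u w"
    if v: "v \<in> ?T" and w: "w \<in> ?T" for v w
  proof -
    obtain y y' where y: "v = coord_vector (U, z) x y" "w = coord_vector (U, z) x y'"
      using v w by (auto simp: T)
    have "(A *v y) \<bullet> (A *v y') = g x v w"
      using A unfolding frame_iff[OF c] coord_form_def y by blast
    then show ?thesis
      unfolding y lin[symmetric] u by (simp add: matrix_vector_right_distrib mat_scalar(6))
  qed
  moreover have "x \<in> \<Union>(fst ` \<A>)"
    using c by force
  ultimately show ?thesis
    unfolding coframe_of_def coframe_bundle_def unitary_coframes_def by auto
qed

text \<open>The Jacobian from W to U converts components in W into components in U, on which A acts.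
  The matrix is unique because coordinate vectors realize every column as components.\<close>

lemma coframe_matrix_coframe_of:
  assumes "(U, z) \<in> \<A>" "(W, w) \<in> \<A>" "x \<in> U" "x \<in> W"
  shows "coframe_matrix \<A> (W, w) (coframe_of (U, z) x A) = A ** jacobian (W, w) (U, z) x"
  unfolding coframe_matrix_def
proof (rule the_equality)
  show "\<forall>v\<in>tangent_space \<A> (fst (coframe_of (U, z) x A)).
      snd (coframe_of (U, z) x A) v = (A ** jacobian (W, w) (U, z) x) *v v (W, w)"
    using jacobian_vector[OF assms(2,1,4,3)] by (simp add: coframe_of_def matrix_vector_mul_assoc[symmetric])
  fix B assume B: "\<forall>v\<in>tangent_space \<A> (fst (coframe_of (U, z) x A)).
      snd (coframe_of (U, z) x A) v = B *v v (W, w)"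
  have "B *v y = (A ** jacobian (W, w) (U, z) x) *v y" for y
  proof -
    let ?v = "coord_vector (W, w) x y"
    have v: "?v \<in> tangent_space \<A> x" "?v (W, w) = y"
      using assms coord_vector_in_tangent_space coord_vector_chart by auto
    have "A *v ?v (U, z) = B *v ?v (W, w)"
      using B v(1) by (simp add: coframe_of_def)
    then show ?thesis
      using jacobian_vector[OF assms(2,1,4,3) v(1)] by (simp add: v(2) matrix_vector_mul_assoc[symmetric])
  qed
  then show "B = A ** jacobian (W, w) (U, z) x"
    by (simp add: matrix_eq)
qed

lemma coframe_matrix_coframe_of_same:
  assumes c: "(U, z) \<in> \<A>" "x \<in> U"
  shows "coframe_matrix \<A> (U, z) (coframe_of (U, z) x A) = A"
proof -
  have "jacobian (U, z) (U, z) x *v y = mat 1 *v y" for y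
    using jacobian_vector[OF c(1,1,2,2) coord_vector_in_tangent_space[OF c]] by (simp add: coord_vector_chart[OF c])
  then have "jacobian (U, z) (U, z) x = mat 1"
    by (simp add: matrix_eq)
  then show ?thesis
    using coframe_matrix_coframe_of[OF c(1,1,2,2)] by simp
qed

text \<open>Complex linearity of u gives a matrix, the isometry condition makes it a frame, and
  extensionality gives equality with u also off the tangent space.\<close>

lemma coframe_eq_coframe_of:
  assumes c: "(U, z) \<in> \<A>" "x \<in> U" and u: "(x, u) \<in> coframe_bundle \<A> g"
  obtains A where "frame (U, z) x A" "(x, u) = coframe_of (U, z) x A"
proof -
  let ?T = "tangent_space \<A> x"
  have u: "u \<in> extensional ?T" "\<And>v w. v \<in> ?T \<Longrightarrow> w \<in> ?T \<Longrightarrow> u (\<lambda>c. v c + w c) = u v + u w"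
    "\<And>v a. v \<in> ?T \<Longrightarrow> u (cscale a v) = a *s u v" "\<And>v w. v \<in> ?T \<Longrightarrow> w \<in> ?T \<Longrightarrow> g x v w = u v \<bullet> u w"
    using u by (auto simp: coframe_bundle_def unitary_coframes_def)
  note cv = coord_vector_in_tangent_space[OF c]
  define A where "A = matrix (\<lambda>y. u (coord_vector (U, z) x y))"
  have A: "A *v y = u (coord_vector (U, z) x y)" for y
    unfolding A_def
    by (rule matrix_of_complex_linear) (simp_all add: coord_vector_linear[OF c] u(2,3) cv)
  show ?thesis
  proof (rule that)
    show "frame (U, z) x A"
      unfolding frame_iff[OF c] A coord_form_def using u(4) cv by simp
    have "u = restrict (\<lambda>v. A *v v (U, z)) ?T"
      by (rule extensionalityI[OF u(1) restrict_extensional]) (simp add: A tangent_vector_eq[OF c, symmetric])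
    then show "(x, u) = coframe_of (U, z) x A"
      by (simp add: coframe_of_def)
  qed
qed

section \<open>Curves in the coframe bundle\<close>

abbreviation bundle_chart_domain where
  "bundle_chart_domain U \<equiv> {p \<in> coframe_bundle \<A> g. fst p \<in> U}"

abbreviation bundle_coord where
  "bundle_coord c \<equiv> (\<lambda>p. (snd c (fst p), coframe_matrix \<A> c p))"

lemma bundle_chart_inj:
  assumes "(U, z) \<in> \<A>"
  shows "inj_on (bundle_coord (U, z)) (bundle_chart_domain U)"
proof (rule inj_onI)
  fix p q
  assume p: "p \<in> bundle_chart_domain U" and q: "q \<in> bundle_chart_domain U"
    and eq: "bundle_coord (U, z) p = bundle_coord (U, z) q"
  have x: "fst p = fst q"
    using p q eq chart_inj[OF assms] by (auto simp: inj_on_def)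
  obtain A where A: "p = coframe_of (U, z) (fst p) A"
    using coframe_eq_coframe_of[OF assms, of "fst p" "snd p"] p by auto
  obtain B where B: "q = coframe_of (U, z) (fst q) B"
    using coframe_eq_coframe_of[OF assms, of "fst q" "snd q"] q by auto
  have "A = coframe_matrix \<A> (U, z) p" "B = coframe_matrix \<A> (U, z) q"
    using coframe_matrix_coframe_of_same[OF assms] p q A B by (metis (no_types, lifting) mem_Collect_eq)+
  then show "p = q"
    using A B x eq by (metis prod.inject)
qed

lemma bundle_charts_eq:
  "bundle_charts \<A> g = (\<lambda>c. (bundle_chart_domain (fst c), bundle_coord c)) ` \<A>"
  unfolding bundle_charts_def by (rule image_cong) (auto simp: case_prod_beta)

text \<open>Differentiability has to hold in every bundle chart at the starting point. In the chart
  over W the coordinates are the base curve and A J^(-1), with J the Jacobian from U to W along the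
  line.\<close>

lemma curve_at_coframe_curve:
  assumes c: "(U, z) \<in> \<A>" "x \<in> U" and A: "A differentiable (at 0)"
    and frame: "\<forall>\<^sub>F t in nhds 0. frame (U, z) (chart_line (U, z) x v t) (A t)"
  shows "curve_at (bundle_charts \<A> g) (coframe_of (U, z) x (A 0))
    (\<lambda>t. coframe_of (U, z) (chart_line (U, z) x v t) (A t))"
  unfolding curve_at_def
proof (intro conjI ballI)
  let ?l = "chart_line (U, z) x v"
  let ?\<gamma> = "\<lambda>t. coframe_of (U, z) (?l t) (A t)"
  show "?\<gamma> 0 = coframe_of (U, z) x (A 0)"
    by (simp add: chart_line_0[OF c])
  fix C assume "C \<in> bundle_charts \<A> g"
  then obtain W w where W: "(W, w) \<in> \<A>" and C: "C = (bundle_chart_domain W, bundle_coord (W, w))"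
    by (auto simp: bundle_charts_eq)
  have main: "(\<forall>\<^sub>F t in nhds 0. ?\<gamma> t \<in> bundle_chart_domain W) \<and>
      (bundle_coord (W, w) \<circ> ?\<gamma>) differentiable (at 0)" if "x \<in> W"
  proof -
    have ev: "\<forall>\<^sub>F t in nhds 0. ?l t \<in> U \<inter> W"
      using chart_line_eventually[OF c chart(1)[OF W] that, of v] by (rule eventually_mono) auto
    have "\<forall>\<^sub>F t in nhds 0. ?\<gamma> t \<in> bundle_chart_domain W"
      using ev frame
    proof eventually_elim
      case (elim t)
      then show ?case
        using coframe_of_in_bundle[OF c(1), of "?l t" "A t"] by (simp add: coframe_of_def)
    qed
    moreover have "(bundle_coord (W, w) \<circ> ?\<gamma>) differentiable (at 0)"
    proof (rule differentiable_transform_nhds)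
      \<comment> \<open>The inverse of J stands in for the Jacobian from W to U: differentiability
        along a coordinate line is known for Jacobians out of the chart that defines the
        line.\<close>
      let ?J = "\<lambda>t. jacobian (U, z) (W, w) (?l t)"
      have "det (?J 0) \<noteq> 0"
        using jacobian_inverse[OF c(1) W c(2) that] invertible_right_inverse
        unfolding invertible_det_nz[symmetric] chart_line_0[OF c] by blast
      then have "(\<lambda>t. A t ** matrix_inv (?J t)) differentiable (at 0)"
        by (intro differentiable_matrix_mult A differentiable_matrix_inv
            jacobian_differentiable[OF c(1) W c(2) that])
      moreover have "(w \<circ> ?l) differentiable (at 0)"
        using chart_line_has_vector_derivative[OF c(1) W c(2) that] by (rule differentiableI_vector)
      ultimately show "(\<lambda>t. ((w \<circ> ?l) t, A t ** matrix_inv (?J t))) differentiable (at 0)"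
        by (rule differentiable_Pair[rotated])
      show "\<forall>\<^sub>F t in nhds 0. ((w \<circ> ?l) t, A t ** matrix_inv (?J t)) = (bundle_coord (W, w) \<circ> ?\<gamma>) t"
        using ev
      proof (rule eventually_mono)
        fix t assume "?l t \<in> U \<inter> W"
        then have t: "?l t \<in> U" "?l t \<in> W"
          by auto
        have "coframe_matrix \<A> (W, w) (?\<gamma> t) = A t ** matrix_inv (?J t)"
          unfolding coframe_matrix_coframe_of[OF c(1) W t]
          using matrix_inv_unique[OF jacobian_inverse[OF c(1) W t]] by simp
        then show "((w \<circ> ?l) t, A t ** matrix_inv (?J t)) = (bundle_coord (W, w) \<circ> ?\<gamma>) t"
          by (simp add: coframe_of_def)
      qed
    qed
    ultimately show ?thesis
      by blast
  qed
  show "case C of (U', e) \<Rightarrow> coframe_of (U, z) x (A 0) \<in> U' \<longrightarrow>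
      (\<forall>\<^sub>F t in nhds 0. ?\<gamma> t \<in> U') \<and> (e \<circ> ?\<gamma>) differentiable (at 0)"
    unfolding C case_prod_conv
  proof
    assume "coframe_of (U, z) x (A 0) \<in> bundle_chart_domain W"
    then have "x \<in> W"
      by (simp add: coframe_of_def)
    then show "(\<forall>\<^sub>F t in nhds 0. ?\<gamma> t \<in> bundle_chart_domain W) \<and>
        (bundle_coord (W, w) \<circ> ?\<gamma>) differentiable (at 0)"
      by (rule main)
  qed
qed

end

section \<open>The generating function is constant\<close>

lemma has_vector_derivative_translate:
  assumes "((\<lambda>s. f (t + s)) has_vector_derivative d) (at 0)"
  shows "(f has_vector_derivative d) (at t)"
proof -
  have D: "((\<lambda>s. f (t + s)) has_derivative (\<lambda>h. h *\<^sub>R d)) (at (t - t))"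
    using assms by (simp add: has_vector_derivative_def)
  have "((\<lambda>s. s - t) has_derivative (\<lambda>h. h)) (at t)"
    by (auto intro!: derivative_eq_intros)
  from has_derivative_compose[OF this D] show ?thesis
    by (simp add: has_vector_derivative_def)
qed

locale bochner_kaehler_mfd = kaehler_mfd M \<A> g
  for M :: "'m topology" and \<A> :: "('m, complex^'n) chart set"
    and g :: "'m \<Rightarrow> ('m, complex^'n) tvec \<Rightarrow> ('m, complex^'n) tvec \<Rightarrow> real" +
  fixes \<phi> :: "('m, 'n) coframe \<Rightarrow> ('m, 'n) bundle_tvec \<Rightarrow> complex^'n^'n"
    and H :: "('m, 'n) coframe \<Rightarrow> complex^'n^'n"
    and T :: "('m, 'n) coframe \<Rightarrow> complex^'n"
    and V :: "('m, 'n) coframe \<Rightarrow> real"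
  assumes connection: "connection_form \<A> g \<phi>"
    and bochner: "bochner_kaehler \<A> g \<phi> H T V"
begin

lemma charts_cover: "\<Union>(fst ` \<A>) = topspace M"
  using complex_manifold unfolding complex_manifold_def by blast

definition gen :: "real \<Rightarrow> ('m, 'n) coframe \<Rightarrow> complex" where
  "gen r p = bochner_gen (\<i> * of_real r) (H p) (T p) (V p)"

lemma hermitian_H: "p \<in> coframe_bundle \<A> g \<Longrightarrow> hermitian (H p)"
  using bochner unfolding bochner_kaehler_def Let_def by blast

text \<open>Evaluated on the velocity of the curve, the structure equations express the derivatives
  of H, T, V by a skew-Hermitian matrix and a column, the values of the two forms, which is the
  situation of \<open>bochner_gen_has_vector_derivative\<close>.\<close>

lemma gen_has_vector_derivative:
  assumes \<gamma>: "curve_at (bundle_charts \<A> g) p \<gamma>" and p: "p \<in> coframe_bundle \<A> g"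
  shows "((\<lambda>t. gen r (\<gamma> t)) has_vector_derivative 0) (at 0)"
proof -
  obtain U z where c: "(U, z) \<in> \<A>" "fst p \<in> U"
    using p unfolding coframe_bundle_def by force
  let ?B = "bundle_charts \<A> g"
  let ?v = "velocity ?B \<gamma>" and ?w = "tautological_form \<A> g p (velocity ?B \<gamma>)"
  have chart: "(bundle_chart_domain U, bundle_coord (U, z)) \<in> ?B"
    using c(1) unfolding bundle_charts_eq by force
  have dom: "p \<in> bundle_chart_domain U"
    using c(2) p by simp
  have \<gamma>0: "\<gamma> 0 = p"
    using \<gamma> by (simp add: curve_at_def)
  have "?v \<in> tangent_space ?B p"
    using \<gamma> by (simp add: tangent_space_def)
  then have skew: "skew_hermitian (\<phi> p ?v)"
    using connection p unfolding connection_form_def Let_def by blast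
  note bk = bochner[unfolded bochner_kaehler_def Let_def]
  note along = has_differential_along_curve[OF _ \<gamma> chart dom bundle_chart_inj[OF c(1)]]
  have H': "((\<lambda>t. H (\<gamma> t)) has_vector_derivative
      - (\<phi> p ?v ** H (\<gamma> 0)) + H (\<gamma> 0) ** \<phi> p ?v + outer (T (\<gamma> 0)) ?w + outer ?w (T (\<gamma> 0))) (at 0)"
    using along[OF bk[THEN conjunct2, THEN conjunct2, THEN conjunct1]] by (simp add: o_def \<gamma>0)
  have T': "((\<lambda>t. T (\<gamma> t)) has_vector_derivative
      - (\<phi> p ?v *v T (\<gamma> 0)) + (H (\<gamma> 0) ** H (\<gamma> 0) + mat (trace (H (\<gamma> 0))) ** H (\<gamma> 0) +
        mat (of_real (V (\<gamma> 0)))) *v ?w) (at 0)"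
    using along[OF bk[THEN conjunct2, THEN conjunct2, THEN conjunct2, THEN conjunct1]] by (simp add: o_def \<gamma>0)
  have V': "((\<lambda>t. complex_of_real (V (\<gamma> t))) has_vector_derivative
      trace (H (\<gamma> 0)) * (cdot (T (\<gamma> 0)) ?w + cdot ?w (T (\<gamma> 0))) +
      (cdot (T (\<gamma> 0)) (H (\<gamma> 0) *v ?w) + cdot ?w (H (\<gamma> 0) *v T (\<gamma> 0)))) (at 0)"
    using along[OF bk[THEN conjunct2, THEN conjunct2, THEN conjunct2, THEN conjunct2]] by (simp add: o_def \<gamma>0)
  have herm: "hermitian (H (\<gamma> 0))"
    using hermitian_H[OF p] by (simp add: \<gamma>0)
  show ?thesis
    unfolding gen_def
    by (rule bochner_gen_has_vector_derivative[OF herm skew det_one_minus_imaginary[OF herm] H' T' V'])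
qed

lemma gen_coframe_curve:
  assumes c: "(U, z) \<in> \<A>" "x \<in> U" and A: "A differentiable (at 0)"
    and frame: "\<forall>\<^sub>F t in nhds 0. frame (U, z) (chart_line (U, z) x v t) (A t)"
  shows "((\<lambda>t. gen r (coframe_of (U, z) (chart_line (U, z) x v t) (A t))) has_vector_derivative 0) (at 0)"
proof (rule gen_has_vector_derivative[OF curve_at_coframe_curve[OF c A frame]])
  have "frame (U, z) (chart_line (U, z) x v 0) (A 0)"
    using eventually_nhds_x_imp_x[OF frame] .
  then show "coframe_of (U, z) x (A 0) \<in> coframe_bundle \<A> g"
    using coframe_of_in_bundle[OF c] by (simp add: chart_line_0[OF c])
qed

lemma gen_constant_on_fibre:
  assumes c: "(U, z) \<in> \<A>" "x \<in> U" and A0: "frame (U, z) x A0" and A1: "frame (U, z) x A1"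
  shows "gen r (coframe_of (U, z) x A0) = gen r (coframe_of (U, z) x A1)"
proof (rule frames_path_connected[of A0 "gram (U, z) x" A1 "\<lambda>A. gen r (coframe_of (U, z) x A)"])
  show "ctranspose A0 ** A0 = gram (U, z) x" "ctranspose A1 ** A1 = gram (U, z) x"
    using A0 A1 by (simp_all add: frame_def)
  show "det A0 \<noteq> 0"
    by (rule frame_det[OF c A0])
  fix A :: "real \<Rightarrow> complex^'n^'n" and s t
  assume A: "\<And>t. A differentiable (at t)" "\<And>t. ctranspose (A t) ** A t = gram (U, z) x"
  let ?f = "\<lambda>t. gen r (coframe_of (U, z) x (A t))"
  \<comment> \<open>A coordinate line in the direction 0 is constant, so a path of frames over one
    point is a case of \<open>gen_coframe_curve\<close>.\<close>
  have line: "chart_line (U, z) x 0 t = x" for t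
    using chart_line_0[OF c, of 0] by (simp add: chart_line_def)
  have "(?f has_vector_derivative 0) (at t0)" for t0
  proof -
    have "(\<lambda>t. A (t0 + t)) differentiable (at 0)"
    proof -
      obtain D where "(A has_derivative D) (at (t0 + 0))"
        using A(1)[of t0] by (auto simp: differentiable_def)
      moreover have "((\<lambda>t. t0 + t) has_derivative (\<lambda>h. h)) (at 0)"
        by (auto intro!: derivative_eq_intros)
      ultimately show ?thesis
        unfolding differentiable_def by (blast intro: has_derivative_compose)
    qed
    from gen_coframe_curve[OF c this, of 0 r]
    have "((\<lambda>t. ?f (t0 + t)) has_vector_derivative 0) (at 0)"
      by (simp add: line frame_def A(2))
    then show ?thesis
      by (rule has_vector_derivative_translate)
  qed
  then have "(?f has_derivative (\<lambda>h. 0)) (at t0 within UNIV)" for t0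
    by (simp add: has_vector_derivative_def)
  then obtain k where "?f t = k" for t
    using has_derivative_zero_constant[of UNIV ?f] by auto
  then show "gen r (coframe_of (U, z) x (A s)) = gen r (coframe_of (U, z) x (A t))"
    by simp
qed

text \<open>An arbitrary choice in each fibre, with no continuity in x; constancy on the fibres
  makes the value of \<open>gen\<close> there independent of the choice.\<close>

definition coframe_at :: "'m \<Rightarrow> ('m, 'n) coframe" where
  "coframe_at x = (SOME p. p \<in> coframe_bundle \<A> g \<and> fst p = x)"

lemma coframe_at:
  assumes "x \<in> topspace M"
  shows "coframe_at x \<in> coframe_bundle \<A> g" "fst (coframe_at x) = x"
proof -
  obtain U z where c: "(U, z) \<in> \<A>" "x \<in> U"
    using assms unfolding charts_cover[symmetric] by force
  obtain A where "frame (U, z) x A"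
    using frame_exists[OF c] .
  then have "\<exists>p. p \<in> coframe_bundle \<A> g \<and> fst p = x"
    using coframe_of_in_bundle[OF c] by (metis coframe_of_def fst_conv)
  from someI_ex[OF this] show "coframe_at x \<in> coframe_bundle \<A> g" "fst (coframe_at x) = x"
    by (simp_all add: coframe_at_def)
qed

lemma gen_eq_gen_coframe_at:
  assumes p: "p \<in> coframe_bundle \<A> g"
  shows "gen r p = gen r (coframe_at (fst p))"
proof -
  obtain U z where c: "(U, z) \<in> \<A>" "fst p \<in> U"
    using p unfolding coframe_bundle_def by force
  have "fst p \<in> topspace M"
    using openin_subset[OF chart(1)[OF c(1)]] c(2) by blast
  note q = coframe_at[OF this]
  obtain A where A: "frame (U, z) (fst p) A" "p = coframe_of (U, z) (fst p) A"
    using coframe_eq_coframe_of[OF c, of "snd p"] p by auto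
  obtain B where B: "frame (U, z) (fst p) B" "coframe_at (fst p) = coframe_of (U, z) (fst p) B"
    using coframe_eq_coframe_of[OF c, of "snd (coframe_at (fst p))"] q by (metis prod.collapse)
  show ?thesis
    using gen_constant_on_fibre[OF c A(1) B(1)] A(2) B(2) by metis
qed

text \<open>Near t = 0 a differentiable lift of the line replaces the arbitrary coframes:
  \<open>gen\<close> takes the same values on it, fibre by fibre, and has derivative 0 along
  it.\<close>

lemma gen_directional_derivative:
  assumes c: "(U, z) \<in> \<A>" "x \<in> U"
  shows "((\<lambda>t. gen r (coframe_at (chart_line (U, z) x v t))) has_vector_derivative 0) (at 0)"
proof -
  obtain h where h: "h differentiable (at 0)" "\<And>t. hermitian (h t)" "h 0 = gram (U, z) x"
    "\<forall>\<^sub>F t in nhds 0. h t = gram (U, z) (chart_line (U, z) x v t)"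
    using gram_differentiable[OF c] by blast
  obtain A0 where A0: "frame (U, z) x A0"
    using frame_exists[OF c] .
  have "ctranspose A0 ** A0 = h 0"
    using A0 by (simp add: frame_def h(3))
  from frame_curve[OF h(1,2) this frame_det[OF c A0]]
  obtain A where A: "A differentiable (at 0)" "\<forall>\<^sub>F t in nhds 0. ctranspose (A t) ** A t = h t" .
  have fr: "\<forall>\<^sub>F t in nhds 0. frame (U, z) (chart_line (U, z) x v t) (A t)"
    using A(2) h(4) unfolding frame_def by (rule eventually_elim2) simp
  have in_U: "\<forall>\<^sub>F t in nhds 0. chart_line (U, z) x v t \<in> U"
    using chart_line_eventually[OF c chart(1)[OF c(1)] c(2), of v] by (rule eventually_mono) auto
  have "\<forall>\<^sub>F t in nhds 0. gen r (coframe_of (U, z) (chart_line (U, z) x v t) (A t)) =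
      gen r (coframe_at (chart_line (U, z) x v t))"
    using fr in_U
  proof eventually_elim
    case (elim t)
    from gen_eq_gen_coframe_at[OF coframe_of_in_bundle[OF c(1) elim(2,1)]] show ?case
      by (simp add: coframe_of_def)
  qed
  then obtain S where S: "open S" "0 \<in> S" "\<And>t. t \<in> S \<Longrightarrow>
      gen r (coframe_of (U, z) (chart_line (U, z) x v t) (A t)) = gen r (coframe_at (chart_line (U, z) x v t))"
    by (auto simp: eventually_nhds)
  show ?thesis
    by (rule has_vector_derivative_transform_within_open[OF gen_coframe_curve[OF c A(1) fr] S])
qed

text \<open>By convexity the segment between the two coordinate points stays in the chart image, and
  the derivative along it vanishes at every parameter.\<close>

lemma gen_constant_on_ball:
  assumes c: "(U, z) \<in> \<A>" and B: "ball a \<epsilon> \<subseteq> z ` U"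
    and x: "x0 \<in> U" "x1 \<in> U" "z x0 \<in> ball a \<epsilon>" "z x1 \<in> ball a \<epsilon>"
  shows "gen r (coframe_at x0) = gen r (coframe_at x1)"
proof -
  define v where "v = z x1 - z x0"
  let ?x = "\<lambda>t. chart_line (U, z) x0 v t"
  let ?f = "\<lambda>t. gen r (coframe_at (?x t))"
  have x0: "?x 0 = x0" and x1: "?x 1 = x1"
    using chart_inj[OF c] x(1,2) by (simp_all add: chart_line_def v_def)
  have der: "(?f has_derivative (\<lambda>h. 0)) (at t within {0..1})" if t: "t \<in> {0..1}" for t
  proof -
    have "z x0 + t *\<^sub>R v = (1 - t) *\<^sub>R z x0 + t *\<^sub>R z x1"
      by (simp add: v_def algebra_simps)
    then have "z x0 + t *\<^sub>R v \<in> z ` U"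
      using convexD_alt[OF convex_ball x(3,4), of t] t B by auto
    then have xt: "?x t \<in> U" "z (?x t) = z x0 + t *\<^sub>R v"
      by (simp_all add: chart_line_def inv_into_into f_inv_into_f)
    \<comment> \<open>Restarting the line at its point of parameter t turns the derivative at t into
      a directional derivative at that point.\<close>
    have "chart_line (U, z) (?x t) v s = ?x (t + s)" for s
      unfolding chart_line_def[of "(U, z)" "?x t"] snd_conv xt(2)
      by (simp add: chart_line_def scaleR_add_left add.assoc)
    then have "((\<lambda>s. ?f (t + s)) has_vector_derivative 0) (at 0)"
      using gen_directional_derivative[OF c xt(1), of r v] by simp
    then have "(?f has_vector_derivative 0) (at t)"
      by (rule has_vector_derivative_translate)
    then show ?thesis
      by (simp add: has_vector_derivative_def has_derivative_at_withinI)
  qed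
  then obtain k where "\<And>t. t \<in> {0..1} \<Longrightarrow> ?f t = k"
    using has_derivative_zero_constant[of "{0..1}" ?f] by auto
  from this[of 0] this[of 1] show ?thesis
    by (simp add: x0 x1)
qed

text \<open>The values of \<open>gen r\<close> at a coframe for all real r determine every C_k
  there, so constancy of each \<open>gen r\<close> on fibres and on coordinate balls passes to
  \<open>bochner_C\<close>.\<close>

lemma bochner_C_constant:
  "\<exists>C :: 'm \<Rightarrow> complex.
    (\<forall>(x, u)\<in>coframe_bundle \<A> g. bochner_C (H (x, u)) (T (x, u)) (V (x, u)) k = C x) \<and>
    locally_constant M C"
proof -
  define F where "F p = bochner_C (H p) (T p) (V p) k" for p
  have F_eq: "F p = F q"
    if "p \<in> coframe_bundle \<A> g" "q \<in> coframe_bundle \<A> g" "\<And>r. gen r p = gen r q" for p q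
    unfolding F_def using that(3)[unfolded gen_def]
    by (rule bochner_C_eqI[OF hermitian_H[OF that(1)] hermitian_H[OF that(2)]])
  have base: "fst p \<in> topspace M" if "p \<in> coframe_bundle \<A> g" for p
    using that unfolding coframe_bundle_def charts_cover by auto
  have "F p = F (coframe_at (fst p))" if "p \<in> coframe_bundle \<A> g" for p
    using F_eq[OF that coframe_at(1)[OF base[OF that]]] gen_eq_gen_coframe_at[OF that] by blast
  then have fibre: "\<forall>(x, u)\<in>coframe_bundle \<A> g. F (x, u) = F (coframe_at x)"
    by auto
  have "locally_constant M (\<lambda>x. F (coframe_at x))"
    unfolding locally_constant_def
  proof
    fix x assume x: "x \<in> topspace M"
    then obtain U z where c: "(U, z) \<in> \<A>" "x \<in> U"
      unfolding charts_cover[symmetric] by force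
    obtain \<epsilon> where \<epsilon>: "\<epsilon> > 0" "ball (z x) \<epsilon> \<subseteq> z ` U"
      using chart(2)[OF c(1)] c(2) open_contains_ball by blast
    let ?N = "{y \<in> U. z y \<in> ball (z x) \<epsilon>}"
    have top: "y \<in> topspace M" if "y \<in> U" for y
      using openin_subset[OF chart(1)[OF c(1)]] that by blast
    have "F (coframe_at y) = F (coframe_at x)" if "y \<in> ?N" for y
      using that gen_constant_on_ball[OF c(1) \<epsilon>(2), of y x] c(2) \<epsilon>(1)
      by (intro F_eq coframe_at(1) top) auto
    then have "(\<lambda>x. F (coframe_at x)) constant_on ?N"
      unfolding constant_on_def by blast
    moreover have "openin M ?N"
      by (rule chart_open_preimage[OF c(1) open_ball])
    moreover have "x \<in> ?N"
      using c(2) \<epsilon>(1) by simp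
    ultimately show "\<exists>N. openin M N \<and> x \<in> N \<and> (\<lambda>x. F (coframe_at x)) constant_on N"
      by blast
  qed
  with fibre show ?thesis
    unfolding F_def by (intro exI[of _ "\<lambda>x. bochner_C (H (coframe_at x)) (T (coframe_at x)) (V (coframe_at x)) k"]) blast
qed

end

theorem theorem3:
  fixes M :: "'m topology"
    and \<A> :: "('m, complex^'n) chart set"
    and g :: "'m \<Rightarrow> ('m, complex^'n) tvec \<Rightarrow> ('m, complex^'n) tvec \<Rightarrow> real"
    and \<phi> :: "('m, 'n) coframe \<Rightarrow> ('m, 'n) bundle_tvec \<Rightarrow> complex^'n^'n"
    and H :: "('m, 'n) coframe \<Rightarrow> complex^'n^'n"
    and T :: "('m, 'n) coframe \<Rightarrow> complex^'n"
    and V :: "('m, 'n) coframe \<Rightarrow> real"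
    and k :: nat
  assumes "kaehler_manifold M \<A> g"
    and "connected_space M"
    and "connection_form \<A> g \<phi>"
    and "bochner_kaehler \<A> g \<phi> H T V"
    and "2 \<le> k" and "k \<le> CARD('n) + 2"
  shows "\<exists>C :: 'm \<Rightarrow> complex.
    (\<forall>(x, u)\<in>coframe_bundle \<A> g. bochner_C (H (x, u)) (T (x, u)) (V (x, u)) k = C x) \<and>
    locally_constant M C"
proof -
  interpret bochner_kaehler_mfd M \<A> g \<phi> H T V
    by unfold_locales (use assms in \<open>auto simp: kaehler_manifold_def\<close>)
  show ?thesis
    by (rule bochner_C_constant)
qed

end
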